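(* Let $S=(S(n))_{n\ge 0}$ be a simple random walk on $\mathbb{Z}^4$ started at the origin, and let $\mathcal{R}_n=\{S(0),\dots,S(n)\}$. Then almost surely $$\lim_{n\to\infty}\ \frac{\log n}{n}\cdot \mathrm{Cap}(\mathcal{R}_n)\ =\ \frac{\pi^2}{8}.$$
   Context: $\mathbb{P}_x$ is the law of the simple random walk on $\mathbb{Z}^4$ started at $x$. For a finite set $A\subset\mathbb{Z}^4$, $H_A^+=\inf\{m\ge 1: S(m)\in A\}$ is the return time to $A$, and the capacity of $A$ is $\mathrm{Cap}(A)=\sum_{x\in A}\mathbb{P}_x(H_A^+=\infty)$. *)

theory Defs
  imports "HOL-Probability.Probability"
begin

definition unit_steps :: "(int ^ 'd::finite) set" where
  "unit_steps = (\<Union>i. {axis i 1, axis i (- 1)})"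

definition step_pmf :: "(int ^ 'd::finite) pmf" where
  "step_pmf = pmf_of_set unit_steps"

definition simple_random_walk ::
    "'a measure \<Rightarrow> int ^ 'd::finite \<Rightarrow> (nat \<Rightarrow> 'a \<Rightarrow> int ^ 'd) \<Rightarrow> bool" where
  "simple_random_walk M x S \<longleftrightarrow>
     prob_space M \<and>
     (\<forall>n. S n \<in> M \<rightarrow>\<^sub>M count_space UNIV) \<and>
     (AE \<omega> in M. S 0 \<omega> = x) \<and>
     prob_space.indep_vars M (\<lambda>_. count_space UNIV) (\<lambda>n \<omega>. S (Suc n) \<omega> - S n \<omega>) UNIV \<and>
     (\<forall>n. distr M (count_space UNIV) (\<lambda>\<omega>. S (Suc n) \<omega> - S n \<omega>) = measure_pmf step_pmf)"

text \<open>The law of the walk started at \<open>x\<close>, as a measure on the path space,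
  built from a sequence of i.i.d. steps.\<close>

definition srw_law :: "int ^ 'd::finite \<Rightarrow> (nat \<Rightarrow> int ^ 'd) measure" where
  "srw_law x =
     distr (\<Pi>\<^sub>M n\<in>(UNIV :: nat set). measure_pmf step_pmf)
           (\<Pi>\<^sub>M n\<in>(UNIV :: nat set). count_space UNIV)
           (\<lambda>\<xi> n. x + (\<Sum>i<n. \<xi> i))"

text \<open>In \<open>enat\<close> the infimum of the empty set is \<open>\<infinity>\<close>.\<close>

definition return_time :: "'b set \<Rightarrow> (nat \<Rightarrow> 'b) \<Rightarrow> enat" where
  "return_time A \<omega> = Inf {enat m |m. 1 \<le> m \<and> \<omega> m \<in> A}"

text \<open>Meaningful for finite \<open>A\<close> only: the sum over an infinite set is \<open>0\<close> by convention.\<close>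

definition capacity :: "(int ^ 'd::finite) set \<Rightarrow> real" where
  "capacity A = (\<Sum>x\<in>A. \<P>(\<omega> in srw_law x. return_time A \<omega> = \<infinity>))"

definition walk_range :: "(nat \<Rightarrow> 'b) \<Rightarrow> nat \<Rightarrow> 'b set" where
  "walk_range \<omega> n = \<omega> ` {0..n}"

lemma unit_steps_finite: "finite (unit_steps :: (int ^ 'd::finite) set)"
  and unit_steps_nonempty: "(unit_steps :: (int ^ 'd::finite) set) \<noteq> {}"
  by (auto simp: unit_steps_def)

lemma card_unit_steps: "card (unit_steps :: (int ^ 'd::finite) set) = 2 * CARD('d)"
proof -
  have "card (unit_steps :: (int ^ 'd) set) = (\<Sum>i\<in>(UNIV::'d set). card {axis i (1::int), axis i (- 1)})"
    unfolding unit_steps_def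
    by (rule card_UN_disjoint) (auto simp: axis_eq_axis)
  also have "\<dots> = (\<Sum>i\<in>(UNIV::'d set). 2)"
    by (intro sum.cong) (auto simp: axis_eq_axis)
  finally show ?thesis by simp
qed

lemma countable_int_vec: "countable (UNIV :: (int ^ 'd::finite) set)"
proof -
  have "countable (PiE (UNIV::'d set) (\<lambda>_. UNIV :: int set))"
    by (intro countable_PiE) auto
  then have "countable ((\<lambda>f. \<chi> i. f i) ` (UNIV :: ('d \<Rightarrow> int) set))"
    by (simp add: PiE_UNIV_domain)
  moreover have "(\<lambda>f. \<chi> i. f i) ` (UNIV :: ('d \<Rightarrow> int) set) = UNIV"
    by (metis surjI vec_nth_inverse vec_lambda_eta)
  ultimately show ?thesis by simp
qed

lemma meas_path:
  "(\<lambda>\<xi> n. x + (\<Sum>i<n. \<xi> i) :: int ^ 'd::finite)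
     \<in> (\<Pi>\<^sub>M n\<in>(UNIV :: nat set). measure_pmf step_pmf) \<rightarrow>\<^sub>M (\<Pi>\<^sub>M n\<in>(UNIV :: nat set). count_space UNIV)"
proof -
  have add: "(\<lambda>\<xi>. f \<xi> + g \<xi>) \<in> N \<rightarrow>\<^sub>M count_space UNIV"
    if f: "f \<in> N \<rightarrow>\<^sub>M count_space UNIV" and g: "g \<in> N \<rightarrow>\<^sub>M count_space UNIV"
    for f g :: "(nat \<Rightarrow> int ^ 'd) \<Rightarrow> int ^ 'd" and N
    by (rule measurable_compose_countable'[OF _ f countable_int_vec])
       (use g in measurable)
  have "(\<lambda>\<xi>. x + (\<Sum>i<n. \<xi> i)) \<in> (\<Pi>\<^sub>M n\<in>(UNIV :: nat set). measure_pmf step_pmf) \<rightarrow>\<^sub>M count_space UNIV" for n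
  proof (induction n)
    case (Suc n)
    have "(\<lambda>\<xi>. (x + (\<Sum>i<n. \<xi> i)) + \<xi> n) \<in> (\<Pi>\<^sub>M n\<in>(UNIV :: nat set). measure_pmf step_pmf) \<rightarrow>\<^sub>M count_space UNIV"
      by (rule add[OF Suc.IH]) measurable
    then show ?case by (simp add: add.assoc)
  qed simp
  then show ?thesis
    by (intro measurable_PiM_single') (auto simp: space_PiM)
qed

lemma simple_random_walk_law:
  fixes S :: "nat \<Rightarrow> 'a \<Rightarrow> int ^ 'd::finite"
  assumes "simple_random_walk M x S"
  shows "distr M (\<Pi>\<^sub>M n\<in>(UNIV :: nat set). count_space UNIV) (\<lambda>\<omega> n. S n \<omega>) = srw_law x"
proof -
  interpret prob_space M using assms by (simp add: simple_random_walk_def)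
  define D where "D = (\<lambda>n \<omega>. S (Suc n) \<omega> - S n \<omega>)"
  have mS: "\<And>n. S n \<in> M \<rightarrow>\<^sub>M count_space UNIV" and S0: "AE \<omega> in M. S 0 \<omega> = x"
    and ind: "indep_vars (\<lambda>_. count_space UNIV) D UNIV"
    and dD: "\<And>n. distr M (count_space UNIV) (D n) = measure_pmf step_pmf"
    using assms by (auto simp: simple_random_walk_def D_def)
  have mD: "D n \<in> M \<rightarrow>\<^sub>M count_space UNIV" for n
    using ind by (auto simp: indep_vars_def)
  have "distr M (\<Pi>\<^sub>M n\<in>UNIV. count_space UNIV) (\<lambda>\<omega>. \<lambda>n\<in>UNIV. D n \<omega>)
      = (\<Pi>\<^sub>M n\<in>UNIV. distr M (count_space UNIV) (D n))"
    using ind mD by (subst (asm) indep_vars_iff_distr_eq_PiM') auto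
  then have 1: "distr M (\<Pi>\<^sub>M n\<in>UNIV. count_space UNIV) (\<lambda>\<omega> n. D n \<omega>) = (\<Pi>\<^sub>M n\<in>UNIV. measure_pmf step_pmf)"
    by (simp add: dD restrict_UNIV)
  have 2: "sets (\<Pi>\<^sub>M n\<in>(UNIV::nat set). measure_pmf (step_pmf :: (int^'d) pmf)) = sets (\<Pi>\<^sub>M n\<in>(UNIV::nat set). count_space UNIV)"
    by (intro sets_PiM_cong) auto
  have mDD: "(\<lambda>\<omega> n. D n \<omega>) \<in> M \<rightarrow>\<^sub>M (\<Pi>\<^sub>M n\<in>UNIV. count_space UNIV)"
    by (intro measurable_PiM_single') (use mD in \<open>auto simp: space_PiM\<close>)
  have mSS: "(\<lambda>\<omega> n. S n \<omega>) \<in> M \<rightarrow>\<^sub>M (\<Pi>\<^sub>M n\<in>UNIV. count_space UNIV)"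
    by (intro measurable_PiM_single') (use mS in \<open>auto simp: space_PiM\<close>)
  have mp: "(\<lambda>\<xi> n. x + (\<Sum>i<n. \<xi> i)) \<in> (\<Pi>\<^sub>M n\<in>(UNIV :: nat set). count_space UNIV) \<rightarrow>\<^sub>M (\<Pi>\<^sub>M n\<in>(UNIV :: nat set). count_space UNIV)"
    using meas_path[of x] by (simp add: measurable_cong_sets[OF 2 refl])
  have "srw_law x = distr (distr M (\<Pi>\<^sub>M n\<in>UNIV. count_space UNIV) (\<lambda>\<omega> n. D n \<omega>)) (\<Pi>\<^sub>M n\<in>UNIV. count_space UNIV) (\<lambda>\<xi> n. x + (\<Sum>i<n. \<xi> i))"
    by (simp add: srw_law_def 1)
  also have "\<dots> = distr M (\<Pi>\<^sub>M n\<in>UNIV. count_space UNIV) (\<lambda>\<omega> n. x + (\<Sum>i<n. D i \<omega>))"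
    by (subst distr_distr[OF mp mDD]) (simp add: o_def)
  also have "\<dots> = distr M (\<Pi>\<^sub>M n\<in>UNIV. count_space UNIV) (\<lambda>\<omega> n. S n \<omega>)"
  proof (rule distr_cong_AE)
    show "AE \<omega> in M. (\<lambda>n. x + (\<Sum>i<n. D i \<omega>)) = (\<lambda>n. S n \<omega>)"
      using S0 by eventually_elim (simp add: D_def fun_eq_iff sum_lessThan_telescope[of "\<lambda>k. S k _"])
    show "(\<lambda>\<omega> n. x + (\<Sum>i<n. D i \<omega>)) \<in> M \<rightarrow>\<^sub>M (\<Pi>\<^sub>M n\<in>UNIV. count_space UNIV)"
      using measurable_compose[OF mDD mp] by simp
  qed (use mSS in auto)
  finally show ?thesis by simp
qed

lemma simple_random_walk_srw_law:
  "simple_random_walk (srw_law x) x (\<lambda>n \<omega>. \<omega> n :: int ^ 'd::finite)"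
proof -
  let ?P = "\<Pi>\<^sub>M n\<in>(UNIV :: nat set). measure_pmf (step_pmf :: (int ^ 'd) pmf)"
  let ?C = "\<Pi>\<^sub>M n\<in>(UNIV :: nat set). count_space (UNIV :: (int ^ 'd) set)"
  let ?f = "\<lambda>\<xi> n. x + (\<Sum>i<n. \<xi> i)"
  interpret P: product_prob_space "\<lambda>_. measure_pmf (step_pmf :: (int ^ 'd) pmf)" "UNIV :: nat set"
    by standard
  interpret L: prob_space "srw_law x"
    unfolding srw_law_def by (intro P.prob_space_distr meas_path)
  have mL: "(\<lambda>\<omega>. \<omega> n) \<in> srw_law x \<rightarrow>\<^sub>M count_space UNIV" for n
    by (simp add: srw_law_def)
  have sub: "(\<lambda>\<omega>. f \<omega> - g \<omega>) \<in> N \<rightarrow>\<^sub>M count_space UNIV"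
    if f: "f \<in> N \<rightarrow>\<^sub>M count_space UNIV" and g: "g \<in> N \<rightarrow>\<^sub>M count_space UNIV"
    for f g :: "(nat \<Rightarrow> int ^ 'd) \<Rightarrow> int ^ 'd" and N
    by (rule measurable_compose_countable'[OF _ f countable_int_vec])
       (use g in measurable)
  have mC: "(\<lambda>\<omega>. \<omega> (Suc n) - \<omega> n :: int ^ 'd) \<in> ?C \<rightarrow>\<^sub>M count_space UNIV" for n
    by (intro sub) measurable
  have mD: "(\<lambda>\<omega>. \<omega> (Suc n) - \<omega> n) \<in> srw_law x \<rightarrow>\<^sub>M count_space UNIV" for n
    using mC[of n] by (simp add: srw_law_def)
  have d: "distr (srw_law x) (count_space UNIV) (\<lambda>\<omega>. \<omega> (Suc n) - \<omega> n) = measure_pmf step_pmf" for n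
  proof -
    have "distr (srw_law x) (count_space UNIV) (\<lambda>\<omega>. \<omega> (Suc n) - \<omega> n)
        = distr ?P (count_space UNIV) (\<lambda>\<xi>. \<xi> n)"
      unfolding srw_law_def by (subst distr_distr[OF mC meas_path]) (simp add: o_def)
    also have "\<dots> = distr ?P (measure_pmf step_pmf) (\<lambda>\<xi>. \<xi> n)"
      by (intro distr_cong) auto
    also have "\<dots> = measure_pmf step_pmf"
      by (rule P.PiM_component) simp
    finally show ?thesis .
  qed
  have 2: "sets ?P = sets ?C"
    by (intro sets_PiM_cong) auto
  have mDD: "(\<lambda>\<omega> n. \<omega> (Suc n) - \<omega> n) \<in> ?C \<rightarrow>\<^sub>M ?C"
    by (intro measurable_PiM_single') (use mC in \<open>auto simp: space_PiM\<close>)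
  have "distr (srw_law x) ?C (\<lambda>\<omega> n. \<omega> (Suc n) - \<omega> n) = distr ?P ?C (\<lambda>\<xi>. \<xi>)"
    unfolding srw_law_def by (subst distr_distr[OF mDD meas_path]) (simp add: o_def)
  also have "\<dots> = ?P"
    by (rule distr_id2) (simp add: 2)
  finally have "L.indep_vars (\<lambda>_. count_space UNIV) (\<lambda>n \<omega>. \<omega> (Suc n) - \<omega> n) UNIV"
    by (subst L.indep_vars_iff_distr_eq_PiM') (use mD in \<open>auto simp: d restrict_UNIV\<close>)
  moreover have "AE \<omega> in srw_law x. \<omega> 0 = x"
    unfolding srw_law_def by (subst AE_distr_iff[OF meas_path]) auto
  ultimately show ?thesis
    unfolding simple_random_walk_def using mL d L.prob_space_axioms by blast
qed

end

theory Submission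
  imports Defs "HOL-Real_Asymp.Real_Asymp"
begin

text \<open>Write \<open>G\<close> for the Green function and \<open>V i\<close> for the sum of \<open>G (S i - S j)\<close> over \<open>j \<le> n\<close>. The escape probabilities
  \<open>e\<close> of a finite set \<open>A\<close> satisfy \<open>G e = 1\<close> on \<open>A\<close> and \<open>G e \<le> 1\<close> everywhere. Pairing this with the occupation measure of
  the walk, \<open>n + 1\<close> equals the integral of \<open>V\<close> against \<open>e\<close>, so that the capacity is about \<open>n / V\<close> if \<open>V\<close> is nearly constant.

  Up to boundary effects \<open>V i\<close> has mean \<open>(8 / \<pi>\<^sup>2) ln n\<close>, because the return probability at time \<open>2k\<close> is
  asymptotically \<open>2 / (\<pi> k)\<^sup>2\<close>, and its variance is of order \<open>ln n\<close>; hence \<open>V\<close> is atypical at a fraction of order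
  \<open>1 / ln n\<close> of the times. For the lower bound one restricts the occupation measure to the typical times. For the
  upper bound the number of atypical times is of the same order as the capacity itself, but such a time counts only
  if an independent walk escapes from the range near that time; this event is nearly independent of \<open>V\<close>, which
  feels the distant part of the walk, and its probability becomes small as the local window grows.

  The numbers of atypical times are sums of variables with a range of dependence much shorter than \<open>n\<close>. Chebyshev's
  inequality makes their deviations summable along a subsequence, and monotonicity of the capacity fills the gaps.\<close>

section \<open>The heat kernel\<close>

text \<open>The constant: with this return probability the Green function, averaged over k steps
  from the origin, is asymptotic to 4 / (pi^2 k). Each of the two sides of the walk thus contributes
  (4 / pi^2) ln n to the Green sum, and the limit is the reciprocal of the total 8 / pi^2.

  The obstacle in the upper bound is that the local window and the distant part share the
  displacement across the window. Summing over its values separates them, but then the distant sum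
  has to be controlled from every point reachable in 2k steps. Its mean falls short of the one from
  the origin by at most \<open>64 ^ k * (2 * k) * green_tail q 0\<close>, which drops below 1 once
  the first q times are ignored. Circularity is avoided because the Chebyshev constant does not
  depend on q: it fixes the tolerated local escape weight, this fixes k, and k fixes q.

  That the local escape weight is small on average is obtained by bootstrapping: the same capacity
  bound with a trivial window already shows that the mean capacity of a long block is a small
  fraction of its length.\<close>

fun heat_kernel :: "nat \<Rightarrow> int ^ 'd::finite \<Rightarrow> real" where
  "heat_kernel 0 x = (if x = 0 then 1 else 0)"
| "heat_kernel (Suc n) x = (\<Sum>e\<in>unit_steps. heat_kernel n (x - e)) / real (card (unit_steps :: (int ^ 'd) set))"

lemmas heat_kernel_Suc = heat_kernel.simps(2)

declare heat_kernel_Suc [simp del]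

text \<open>A finite box containing every point reachable in \<open>n\<close> steps
  (\<open>heat_kernel_support\<close>); it turns lattice sums against the kernel into finite
  sums.\<close>

definition cube :: "nat \<Rightarrow> (int ^ 'd::finite) set" where
  "cube n = {x. \<forall>i. \<bar>x $ i\<bar> \<le> int n}"

lemma finite_cube [simp]: "finite (cube n :: (int ^ 'd::finite) set)"
proof -
  have "(cube n :: (int ^ 'd) set) \<subseteq> vec_lambda ` PiE UNIV (\<lambda>_. {- int n..int n})"
  proof
    fix x :: "int ^ 'd"
    assume "x \<in> cube n"
    then have "vec_nth x \<in> PiE UNIV (\<lambda>_. {- int n..int n})"
      by (auto simp: cube_def abs_le_iff minus_le_iff)
    moreover have "x = vec_lambda (vec_nth x)"
      by simp
    ultimately show "x \<in> vec_lambda ` PiE UNIV (\<lambda>_. {- int n..int n})"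
      by blast
  qed
  then show ?thesis
    by (rule finite_subset) (intro finite_imageI finite_PiE; simp)
qed

lemma cube_mono: "m \<le> n \<Longrightarrow> cube m \<subseteq> cube n"
  unfolding cube_def by (intro Collect_mono impI allI) (metis of_nat_mono order_trans)

lemma cube_uminus [simp]: "- x \<in> cube n \<longleftrightarrow> x \<in> cube n"
  by (simp add: cube_def)

lemma cube_add: "x \<in> cube m \<Longrightarrow> y \<in> cube n \<Longrightarrow> x + y \<in> cube (m + n)"
  by (auto simp: cube_def intro: order_trans[OF abs_triangle_ineq] add_mono)

lemma cube_diff: "x \<in> cube m \<Longrightarrow> y \<in> cube n \<Longrightarrow> x - y \<in> cube (m + n)"
  using cube_add[of x m "- y" n] by simp

lemma zero_in_cube [simp]: "0 \<in> cube n"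
  by (simp add: cube_def)

lemma unit_steps_cube: "e \<in> unit_steps \<Longrightarrow> e \<in> cube 1"
  by (auto simp: unit_steps_def cube_def axis_def)

lemma unit_steps_uminus: "- e \<in> unit_steps \<longleftrightarrow> e \<in> unit_steps"
proof -
  have *: "- axis i (a::int) = axis i (- a)" for i :: 'a and a
    by (simp add: vec_eq_iff axis_def)
  have "- e \<in> unit_steps" if "e \<in> unit_steps" for e :: "int ^ 'a"
    using that by (auto simp: unit_steps_def *)
  from this[of e] this[of "- e"] show ?thesis by auto
qed

lemma sum_unit_steps_uminus: "(\<Sum>e\<in>unit_steps. f (- e)) = (\<Sum>e\<in>unit_steps. f e)"
  by (rule sum.reindex_bij_witness[of _ uminus uminus]) (auto simp: unit_steps_uminus)

lemma card_unit_steps_nonzero [simp]: "card (unit_steps :: (int ^ 'd::finite) set) \<noteq> 0"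
  by (simp add: card_unit_steps)

lemma heat_kernel_nonneg [simp]: "heat_kernel n x \<ge> 0"
  by (induction n arbitrary: x) (auto simp: heat_kernel_Suc intro!: divide_nonneg_nonneg sum_nonneg)

lemma heat_kernel_uminus: "heat_kernel n (- x) = heat_kernel n x"
proof (induction n arbitrary: x)
  case (Suc n)
  have "(\<Sum>e\<in>unit_steps. heat_kernel n (- x - e)) = (\<Sum>e\<in>unit_steps. heat_kernel n (x + e))"
  proof (intro sum.cong refl)
    fix e
    show "heat_kernel n (- x - e) = heat_kernel n (x + e)"
      using Suc.IH[of "x + e"] by (simp only: minus_add_distrib diff_conv_add_uminus)
  qed
  also have "\<dots> = (\<Sum>e\<in>unit_steps. heat_kernel n (x - e))"
    using sum_unit_steps_uminus[of "\<lambda>e. heat_kernel n (x - e)"] by simp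
  finally show ?case by (simp add: heat_kernel_Suc)
qed auto

lemma heat_kernel_support: "heat_kernel n x \<noteq> 0 \<Longrightarrow> x \<in> cube n"
proof (induction n arbitrary: x)
  case (Suc n)
  then obtain e where e: "e \<in> unit_steps" "heat_kernel n (x - e) \<noteq> 0"
    by (auto simp: heat_kernel_Suc divide_eq_0_iff intro: sum.not_neutral_contains_not_neutral)
  from cube_add[OF Suc.IH[OF e(2)] unit_steps_cube[OF e(1)]] show ?case by simp
qed (auto split: if_splits)

lemma heat_kernel_parity:
  "heat_kernel n (x :: int ^ 'd::finite) \<noteq> 0 \<Longrightarrow> even (int n + (\<Sum>i\<in>UNIV. x $ i))"
proof (induction n arbitrary: x)
  case (Suc n)
  then obtain e where e: "e \<in> unit_steps" "heat_kernel n (x - e) \<noteq> 0"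
    by (auto simp: heat_kernel_Suc divide_eq_0_iff intro: sum.not_neutral_contains_not_neutral)
  have "odd (\<Sum>i\<in>UNIV. e $ i)"
    using e(1) by (auto simp: unit_steps_def axis_def)
  with Suc.IH[OF e(2)] show ?case by (simp add: sum_subtractf)
qed (auto split: if_splits)

lemma heat_kernel_odd_zero: "odd n \<Longrightarrow> heat_kernel n 0 = 0"
  using heat_kernel_parity[of n 0] by auto

text \<open>Summation by parts: the average over one step moves from the kernel to the test
  function. Total mass one and the Chapman--Kolmogorov equation follow from this by induction on
  \<open>n\<close>.\<close>

lemma sum_heat_kernel_shift:
  fixes f :: "int ^ 'd::finite \<Rightarrow> real"
  assumes "finite F" "cube (Suc n) \<subseteq> F"
  shows "(\<Sum>x\<in>F. heat_kernel (Suc n) x * f x)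
    = (\<Sum>x\<in>cube n. heat_kernel n x * ((\<Sum>e\<in>unit_steps. f (x + e)) / real (card (unit_steps :: (int ^ 'd) set))))"
    (is "_ = (\<Sum>x\<in>_. _ * (_ / ?c))")
proof -
  have inner: "(\<Sum>x\<in>F. heat_kernel n (x - e) * f x) = (\<Sum>x\<in>cube n. heat_kernel n x * f (x + e))"
    if e: "e \<in> unit_steps" for e
  proof -
    have "(\<Sum>x\<in>cube n. heat_kernel n x * f (x + e)) = (\<Sum>x\<in>(\<lambda>x. x + e) ` cube n. heat_kernel n (x - e) * f x)"
      by (subst sum.reindex) (auto simp: inj_on_def)
    also have "\<dots> = (\<Sum>x\<in>F. heat_kernel n (x - e) * f x)"
    proof (rule sum.mono_neutral_left)
      show "(\<lambda>x. x + e) ` cube n \<subseteq> F"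
        using assms(2) cube_add[OF _ unit_steps_cube[OF e], of _ n] by auto
      show "\<forall>x\<in>F - (\<lambda>x. x + e) ` cube n. heat_kernel n (x - e) * f x = 0"
      proof
        fix x assume x: "x \<in> F - (\<lambda>x. x + e) ` cube n"
        have "x - e \<notin> cube n"
        proof
          assume "x - e \<in> cube n"
          then have "(x - e) + e \<in> (\<lambda>x. x + e) ` cube n" by blast
          with x show False by simp
        qed
        then show "heat_kernel n (x - e) * f x = 0"
          using heat_kernel_support by force
      qed
    qed (use assms in auto)
    finally show "(\<Sum>x\<in>F. heat_kernel n (x - e) * f x) = (\<Sum>x\<in>cube n. heat_kernel n x * f (x + e))" ..
  qed
  have "(\<Sum>x\<in>F. heat_kernel (Suc n) x * f x) = (\<Sum>x\<in>F. \<Sum>e\<in>unit_steps. heat_kernel n (x - e) * f x / ?c)"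
    by (simp add: heat_kernel_Suc sum_divide_distrib sum_distrib_right)
  also have "\<dots> = (\<Sum>e\<in>unit_steps. (\<Sum>x\<in>F. heat_kernel n (x - e) * f x) / ?c)"
    by (subst sum.swap) (simp add: sum_divide_distrib)
  also have "\<dots> = (\<Sum>e\<in>unit_steps. (\<Sum>x\<in>cube n. heat_kernel n x * f (x + e)) / ?c)"
    by (simp add: inner)
  also have "\<dots> = (\<Sum>x\<in>cube n. \<Sum>e\<in>unit_steps. heat_kernel n x * f (x + e) / ?c)"
    by (subst sum.swap) (simp add: sum_divide_distrib)
  finally show ?thesis
    by (simp add: sum_divide_distrib sum_distrib_left)
qed

lemma sum_heat_kernel: "(\<Sum>x\<in>cube n. heat_kernel n (x :: int ^ 'd::finite)) = 1"
proof (induction n)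
  case 0
  have "cube 0 = {0 :: int ^ 'd}" by (auto simp: cube_def vec_eq_iff)
  then show ?case by simp
next
  case (Suc n)
  then show ?case
    using sum_heat_kernel_shift[of "cube (Suc n)" n "\<lambda>_ :: int ^ 'd. 1"] by simp
qed

lemma sum_heat_kernel_superset:
  assumes "finite F" "cube n \<subseteq> F"
  shows "(\<Sum>x\<in>F. heat_kernel n x * f x) = (\<Sum>x\<in>cube n. heat_kernel n x * (f x :: real))"
  by (rule sum.mono_neutral_right) (use assms heat_kernel_support in force)+

text \<open>A reachable point is reached along one particular path of \<open>n\<close> steps, whose
  probability is the bound. In dimension four, \<open>2 * m\<close> steps produce the factor
  \<open>64 ^ m\<close> used later.\<close>

lemma heat_kernel_pos_lower:
  "heat_kernel n (x :: int ^ 'd::finite) \<noteq> 0 \<Longrightarrow>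
     heat_kernel n x \<ge> (1 / real (card (unit_steps :: (int ^ 'd) set))) ^ n"
proof (induction n arbitrary: x)
  case (Suc n)
  let ?c = "real (card (unit_steps :: (int ^ 'd) set))"
  from Suc.prems obtain e where e: "e \<in> unit_steps" "heat_kernel n (x - e) \<noteq> 0"
    by (auto simp: heat_kernel_Suc divide_eq_0_iff intro: sum.not_neutral_contains_not_neutral)
  have "(1 / ?c) ^ n \<le> heat_kernel n (x - e)" by (rule Suc.IH[OF e(2)])
  also have "\<dots> \<le> (\<Sum>e\<in>unit_steps. heat_kernel n (x - e))"
    by (rule member_le_sum) (auto simp: e unit_steps_finite)
  finally show ?case by (simp add: heat_kernel_Suc divide_right_mono)
qed (auto split: if_splits)

lemma chapman_kolmogorov:
  assumes "finite F" "cube n \<subseteq> F"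
  shows "heat_kernel (n + m) x = (\<Sum>y\<in>F. heat_kernel n y * heat_kernel m (x - y))"
proof -
  have "heat_kernel (n + m) x = (\<Sum>y\<in>cube n. heat_kernel n y * heat_kernel m (x - y))"
  proof (induction n arbitrary: m)
    case 0
    have "cube 0 = {0 :: int ^ 'a}" by (auto simp: cube_def vec_eq_iff)
    then show ?case by simp
  next
    case (Suc n)
    have "(\<Sum>y\<in>cube (Suc n). heat_kernel (Suc n) y * heat_kernel m (x - y))
        = (\<Sum>y\<in>cube n. heat_kernel n y * heat_kernel (Suc m) (x - y))"
      by (subst sum_heat_kernel_shift) (auto simp: heat_kernel_Suc diff_diff_eq)
    also have "\<dots> = heat_kernel (Suc n + m) x"
      using Suc.IH[of "Suc m"] by simp
    finally show ?case ..
  qed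
  then show ?thesis using sum_heat_kernel_superset[OF assms] by simp
qed

text \<open>Chapman--Kolmogorov at the midpoint and the inequality
  \<open>2 * a * b \<le> a\<^sup>2 + b\<^sup>2\<close>; both sums of squares equal the return
  probability, by the symmetry of the kernel and a translation.\<close>

lemma heat_kernel_even_le: "heat_kernel (2 * n) (x :: int ^ 'a::finite) \<le> heat_kernel (2 * n) (0 :: int ^ 'a)"
proof -
  obtain k where k: "x \<in> cube k"
  proof -
    have "x \<in> cube (nat (\<Sum>i\<in>UNIV. \<bar>x $ i\<bar>))"
      by (auto simp: cube_def intro!: member_le_sum sum_nonneg)
    then show ?thesis by (rule that)
  qed
  \<comment> \<open>Large enough for the support of the kernel at \<open>y\<close> and for that of
    the kernel at \<open>x - y\<close>.\<close>
  let ?F = "cube (n + k) :: (int ^ 'a) set"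
  have sub: "cube n \<subseteq> ?F" by (rule cube_mono) simp
  have sq0: "heat_kernel (2 * n) (0 :: int ^ 'a) = (\<Sum>y\<in>?F. (heat_kernel n y)\<^sup>2)"
    using chapman_kolmogorov[of ?F n n "0 :: int ^ 'a"] sub by (simp add: heat_kernel_uminus mult_2 power2_eq_square)
  have sq1: "(\<Sum>y\<in>?F. (heat_kernel n (x - y))\<^sup>2) = heat_kernel (2 * n) (0 :: int ^ 'a)"
  proof -
    have inj: "inj_on (\<lambda>y. x - y) (cube n)" by (auto simp: inj_on_def)
    have "heat_kernel (2 * n) (0 :: int ^ 'a) = (\<Sum>y\<in>cube n. (heat_kernel n (y :: int ^ 'a))\<^sup>2)"
      using chapman_kolmogorov[of "cube n" n n "0 :: int ^ 'a"] by (simp add: heat_kernel_uminus mult_2 power2_eq_square)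
    also have "\<dots> = (\<Sum>y\<in>(\<lambda>y. x - y) ` cube n. (heat_kernel n (x - y))\<^sup>2)"
      by (subst sum.reindex[OF inj]) simp
    also have "\<dots> = (\<Sum>y\<in>?F. (heat_kernel n (x - y))\<^sup>2)"
    proof (rule sum.mono_neutral_left)
      show "(\<lambda>y. x - y) ` cube n \<subseteq> ?F"
        using cube_diff[OF k, of _ n] by (auto simp: add.commute)
      show "\<forall>y\<in>?F - (\<lambda>y. x - y) ` cube n. (heat_kernel n (x - y))\<^sup>2 = 0"
      proof
        fix y assume y: "y \<in> ?F - (\<lambda>y. x - y) ` cube n"
        have "x - y \<notin> cube n"
        proof
          assume "x - y \<in> cube n"
          then have "x - (x - y) \<in> (\<lambda>y. x - y) ` cube n" by blast
          with y show False by simp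
        qed
        then show "(heat_kernel n (x - y))\<^sup>2 = 0"
          using heat_kernel_support by force
      qed
    qed auto
    finally show ?thesis ..
  qed
  have "heat_kernel (2 * n) x = (\<Sum>y\<in>?F. heat_kernel n y * heat_kernel n (x - y))"
    using chapman_kolmogorov[of ?F n n x] sub by (simp add: mult_2)
  also have "\<dots> \<le> (\<Sum>y\<in>?F. ((heat_kernel n y)\<^sup>2 + (heat_kernel n (x - y))\<^sup>2) / 2)"
  proof (rule sum_mono)
    fix y
    show "heat_kernel n y * heat_kernel n (x - y) \<le> ((heat_kernel n y)\<^sup>2 + (heat_kernel n (x - y))\<^sup>2) / 2"
      using sum_squares_bound[of "heat_kernel n y" "heat_kernel n (x - y)"] by simp
  qed
  also have "\<dots> = heat_kernel (2 * n) (0 :: int ^ 'a)"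
    by (simp add: sum_divide_distrib[symmetric] sum.distrib sq0[symmetric] sq1)
  finally show ?thesis .
qed

lemma heat_kernel_Suc_le:
  fixes x :: "int ^ 'd::finite"
  assumes "\<And>y :: int ^ 'd. heat_kernel n y \<le> c"
  shows "heat_kernel (Suc n) x \<le> c"
proof -
  have "(\<Sum>e\<in>unit_steps. heat_kernel n (x - e)) \<le> real (card (unit_steps :: (int ^ 'd) set)) * c"
    using sum_bounded_above[of unit_steps "\<lambda>e. heat_kernel n (x - e)" c] assms by auto
  then show ?thesis by (simp add: heat_kernel_Suc divide_le_eq mult.commute)
qed

text \<open>The walk misses the origin at odd times, so the comparison is with the even time just
  before.\<close>

lemma heat_kernel_odd_le:
  "heat_kernel (Suc (2 * n)) (x :: int ^ 'a::finite) \<le> heat_kernel (2 * n) (0 :: int ^ 'a)"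
  by (intro heat_kernel_Suc_le heat_kernel_even_le)

text \<open>Comparing \<open>x\<close> with the origin costs only a difference that telescopes in time;
  this replaces all gradient estimates for the heat kernel.\<close>

lemma heat_kernel_diff_le:
  fixes x :: "int ^ 'a::finite"
  assumes "even n"
  shows "heat_kernel m x * (heat_kernel n (0 :: int ^ 'a) - heat_kernel n x) \<le> heat_kernel n (0 :: int ^ 'a) - heat_kernel (n + m) (0 :: int ^ 'a)"
proof (cases "x \<in> cube m")
  case True
  obtain k where n: "n = 2 * k" using assms by blast
  have "heat_kernel m x * (heat_kernel n (0 :: int ^ 'a) - heat_kernel n x)
      \<le> (\<Sum>y\<in>cube m. heat_kernel m y * (heat_kernel n (0 :: int ^ 'a) - heat_kernel n (y :: int ^ 'a)))"
    using True by (intro member_le_sum[where f = "\<lambda>y. heat_kernel m y * (heat_kernel n (0 :: int ^ 'a) - heat_kernel n y)"])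
      (auto simp: n intro!: mult_nonneg_nonneg heat_kernel_even_le)
  also have "\<dots> = heat_kernel n (0 :: int ^ 'a) * (\<Sum>y\<in>cube m. heat_kernel m (y :: int ^ 'a)) - heat_kernel (m + n) (0 :: int ^ 'a)"
    using chapman_kolmogorov[of "cube m" m n "0 :: int ^ 'a"]
    by (simp add: heat_kernel_uminus algebra_simps sum_subtractf sum_distrib_left)
  also have "\<dots> = heat_kernel n (0 :: int ^ 'a) - heat_kernel (n + m) (0 :: int ^ 'a)"
    by (simp add: sum_heat_kernel add.commute)
  finally show ?thesis .
next
  case False
  obtain k where n: "n = 2 * k" using assms by blast
  have "heat_kernel (n + m) (0 :: int ^ 'a) = (\<Sum>y\<in>cube m. heat_kernel m y * heat_kernel n (y :: int ^ 'a))"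
    using chapman_kolmogorov[of "cube m" m n "0 :: int ^ 'a"] by (simp add: heat_kernel_uminus add.commute)
  also have "\<dots> \<le> (\<Sum>y\<in>cube m. heat_kernel m (y :: int ^ 'a) * heat_kernel n (0 :: int ^ 'a))"
    unfolding n by (intro sum_mono mult_left_mono heat_kernel_even_le heat_kernel_nonneg)
  also have "\<dots> = heat_kernel n (0 :: int ^ 'a)"
    by (simp add: sum_distrib_right[symmetric] sum_heat_kernel)
  finally have "heat_kernel (n + m) (0 :: int ^ 'a) \<le> heat_kernel n (0 :: int ^ 'a)" .
  with False show ?thesis using heat_kernel_support[of m x] by force
qed

section \<open>Return probabilities in dimension four\<close>

text \<open>Pascal's rule in the shape of the Leibniz rule for iterated derivatives. In
  \<open>heat_kernel_4\<close> the two sums correspond to a new step in the first or in the second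
  pair of coordinates.\<close>

lemma binomial_convolution_Suc:
  fixes f g :: "nat \<Rightarrow> 'a::comm_semiring_1"
  shows "(\<Sum>j\<le>Suc n. of_nat (Suc n choose j) * f j * g (Suc n - j))
    = (\<Sum>j\<le>n. of_nat (n choose j) * f (Suc j) * g (n - j))
      + (\<Sum>j\<le>n. of_nat (n choose j) * f j * g (Suc (n - j)))"
proof -
  have "(\<Sum>j\<le>Suc n. of_nat (Suc n choose j) * f j * g (Suc n - j))
      = f 0 * g (Suc n) + (\<Sum>j\<le>n. of_nat (Suc n choose Suc j) * f (Suc j) * g (n - j))"
    by (subst sum.atMost_Suc_shift) simp
  also have "\<dots> = (\<Sum>j\<le>n. of_nat (n choose j) * f (Suc j) * g (n - j))
      + (f 0 * g (Suc n) + (\<Sum>j\<le>n. of_nat (n choose Suc j) * f (Suc j) * g (n - j)))"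
    by (simp add: algebra_simps sum.distrib)
  also have "f 0 * g (Suc n) + (\<Sum>j\<le>n. of_nat (n choose Suc j) * f (Suc j) * g (n - j))
      = (\<Sum>j\<le>Suc n. of_nat (n choose j) * f j * g (Suc n - j))"
    by (subst sum.atMost_Suc_shift) simp
  also have "\<dots> = (\<Sum>j\<le>n. of_nat (n choose j) * f j * g (Suc (n - j)))"
    by (simp add: Suc_diff_le binomial_eq_0)
  finally show ?thesis .
qed

fun line_kernel :: "nat \<Rightarrow> int \<Rightarrow> real" where
  "line_kernel 0 a = (if a = 0 then 1 else 0)"
| "line_kernel (Suc n) a = (line_kernel n (a - 1) + line_kernel n (a + 1)) / 2"

lemma line_kernel_support: "line_kernel n a \<noteq> 0 \<Longrightarrow> \<bar>a\<bar> \<le> int n \<and> even (int n + a)"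
proof (induction n arbitrary: a)
  case (Suc n)
  then have "line_kernel n (a - 1) \<noteq> 0 \<or> line_kernel n (a + 1) \<noteq> 0" by auto
  then show ?case using Suc.IH[of "a - 1"] Suc.IH[of "a + 1"] by fastforce
qed (auto split: if_splits)

lemma line_kernel_binomial: "line_kernel n (2 * int k - int n) = real (n choose k) / 2 ^ n"
proof (induction n arbitrary: k)
  case (Suc n)
  show ?case
  proof (cases k)
    case 0
    have "line_kernel n (- int n - 2) = 0"
      using line_kernel_support[of n "- int n - 2"] by auto
    with 0 Suc.IH[of 0] show ?thesis by (simp add: algebra_simps)
  next
    case (Suc j)
    have "line_kernel (Suc n) (2 * int k - int (Suc n))
        = (line_kernel n (2 * int j - int n) + line_kernel n (2 * int k - int n)) / 2"
      by (simp add: Suc algebra_simps)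
    also have "\<dots> = real (Suc n choose k) / 2 ^ Suc n"
      unfolding Suc.IH by (simp add: Suc field_simps)
    finally show ?thesis .
  qed
qed auto

definition plane_kernel :: "nat \<Rightarrow> int \<Rightarrow> int \<Rightarrow> real" where
  "plane_kernel n a b = line_kernel n (a + b) * line_kernel n (a - b)"

text \<open>Each of the four planar steps changes both \<open>a + b\<close> and \<open>a - b\<close>
  by one, and every combination of signs occurs exactly once.\<close>

lemma plane_kernel_Suc:
  "plane_kernel (Suc n) a b = (plane_kernel n (a - 1) b + plane_kernel n (a + 1) b
      + plane_kernel n a (b - 1) + plane_kernel n a (b + 1)) / 4"
proof -
  have 1: "a - 1 + b = a + b - 1" "a - 1 - b = a - b - 1" "a + 1 + b = a + b + 1" "a + 1 - b = a - b + 1"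
    "a + (b - 1) = a + b - 1" "a - (b - 1) = a - b + 1" "a + (b + 1) = a + b + 1" "a - (b + 1) = a - b - 1"
    by auto
  show ?thesis
    unfolding plane_kernel_def line_kernel.simps 1 by (simp add: field_simps)
qed

lemma sum_unit_steps:
  "(\<Sum>e\<in>unit_steps. f e) = (\<Sum>i\<in>(UNIV :: 'd::finite set). f (axis i 1) + f (axis i (- 1)))"
proof -
  have "(\<Sum>e\<in>unit_steps. f e) = (\<Sum>i\<in>(UNIV :: 'd set). \<Sum>e\<in>{axis i 1, axis i (- 1)}. f e)"
    unfolding unit_steps_def by (rule sum.UNION_disjoint) (auto simp: axis_eq_axis)
  then show ?thesis by (simp add: axis_eq_axis)
qed

text \<open>The pairs of coordinates \<open>(1,2)\<close> and \<open>(3,4)\<close> perform independent planar walks at random times,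
  and a planar walk is, after a rotation, a pair of independent walks on the line.\<close>

lemma heat_kernel_4:
  fixes x :: "int ^ 4"
  shows "heat_kernel n x = (\<Sum>j\<le>n. real (n choose j) * plane_kernel j (x $ 1) (x $ 2)
            * plane_kernel (n - j) (x $ 3) (x $ 4)) / 2 ^ n"
proof (induction n arbitrary: x)
  case 0
  have "x = 0 \<longleftrightarrow> x $ 1 = 0 \<and> x $ 2 = 0 \<and> x $ 3 = 0 \<and> x $ 4 = 0"
    by (simp add: vec_eq_iff forall_4)
  then show ?case by (auto simp: plane_kernel_def)
next
  case (Suc n)
  define B where "B j = real (n choose j)" for j
  let ?P = plane_kernel
  obtain a b c d where abcd: "a = x $ 1" "b = x $ 2" "c = x $ 3" "d = x $ 4" by blast
  have quad: "4 * ?P (Suc j) a b = ?P j (a - 1) b + ?P j (a + 1) b + ?P j a (b - 1) + ?P j a (b + 1)" for j a b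
    by (simp add: plane_kernel_Suc)
  have c8: "real (card (unit_steps :: (int ^ 4) set)) = 8"
    by (simp add: card_unit_steps)
  have "heat_kernel (Suc n) x
      = (\<Sum>j\<le>n. B j * (?P j (a - 1) b + ?P j (a + 1) b + ?P j a (b - 1) + ?P j a (b + 1)) * ?P (n - j) c d
         + B j * ?P j a b * (?P (n - j) (c - 1) d + ?P (n - j) (c + 1) d + ?P (n - j) c (d - 1) + ?P (n - j) c (d + 1)))
        / (8 * 2 ^ n)"
    unfolding heat_kernel_Suc c8 sum_unit_steps sum_4 Suc.IH
    by (simp add: axis_def abcd[symmetric] B_def[symmetric] sum_divide_distrib[symmetric] add_divide_distrib[symmetric]
        sum.distrib[symmetric]) (simp add: algebra_simps)
  also have "\<dots> = (\<Sum>j\<le>n. B j * (4 * ?P (Suc j) a b) * ?P (n - j) c d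
         + B j * ?P j a b * (4 * ?P (Suc (n - j)) c d)) / (8 * 2 ^ n)"
    by (simp only: quad)
  also have "\<dots> = 4 * ((\<Sum>j\<le>n. B j * ?P (Suc j) a b * ?P (n - j) c d)
         + (\<Sum>j\<le>n. B j * ?P j a b * ?P (Suc (n - j)) c d)) / (8 * 2 ^ n)"
    by (simp add: sum.distrib sum_distrib_left algebra_simps)
  also have "\<dots> = 4 * (\<Sum>j\<le>Suc n. real (Suc n choose j) * ?P j a b * ?P (Suc n - j) c d) / (8 * 2 ^ n)"
    unfolding B_def by (subst binomial_convolution_Suc) simp
  also have "\<dots> = (\<Sum>j\<le>Suc n. real (Suc n choose j) * ?P j a b * ?P (Suc n - j) c d) / 2 ^ Suc n"
    by (simp del: sum.atMost_Suc)
  finally show ?case by (simp only: abcd)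
qed

section \<open>The Wallis product and the constant in the return probability\<close>

definition central_ratio :: "nat \<Rightarrow> real" where
  "central_ratio n = real ((2 * n) choose n) / 4 ^ n"

text \<open>The planar return probability at time \<open>2 * n\<close>, multiplied by
  \<open>2 * n + 1\<close>. It is the reciprocal of a partial Wallis product, hence decreases to 2 /
  pi, and the factors \<open>2 * n + 1\<close> taken out here are just what
  \<open>choose_shift_two\<close> absorbs.\<close>

definition wallis_seq :: "nat \<Rightarrow> real" where
  "wallis_seq n = (2 * real n + 1) * (central_ratio n)\<^sup>2"

lemma line_kernel_zero: "line_kernel (2 * n) 0 = central_ratio n"
  using line_kernel_binomial[of "2 * n" n] by (simp add: central_ratio_def power_mult)

lemma plane_kernel_zero:
  "plane_kernel j 0 0 = (if even j then wallis_seq (j div 2) / (real j + 1) else 0)"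
proof (cases "even j")
  case True
  then obtain k where "j = 2 * k" by blast
  then show ?thesis
    by (simp add: plane_kernel_def line_kernel_zero wallis_seq_def power2_eq_square)
next
  case False
  then show ?thesis using line_kernel_support[of j 0] by (auto simp: plane_kernel_def)
qed

text \<open>Absorbs the denominators of two planar return probabilities into the binomial
  coefficient, so that the convolution in \<open>heat_kernel_4_zero\<close> is weighted by the odd
  binomial coefficients of \<open>2 * n + 2\<close>.\<close>

lemma choose_shift_two:
  assumes "j \<le> n"
  shows "real (n choose j) / ((real j + 1) * (real (n - j) + 1))
    = real (Suc (Suc n) choose Suc j) / ((real n + 1) * (real n + 2))"
proof -
  have 1: "real (Suc (Suc n) choose Suc j) * (real j + 1) = (real n + 2) * real (Suc n choose j)"
    using arg_cong[OF Suc_times_binomial_eq[of "Suc n" j], of real] unfolding of_nat_mult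
    by (simp add: algebra_simps del: binomial_Suc_Suc)
  have 2: "real (Suc n choose j) * (real (n - j) + 1) = (real n + 1) * real (n choose j)"
  proof -
    have "Suc n choose j = Suc n choose Suc (n - j)" 
      using assms by (metis binomial_symmetric Suc_diff_le le_SucI)
    moreover have "n choose j = n choose (n - j)"
      using assms by (rule binomial_symmetric)
    ultimately show ?thesis
      using arg_cong[OF Suc_times_binomial_eq[of n "n - j"], of real] unfolding of_nat_mult
      by (simp add: algebra_simps del: binomial_Suc_Suc)
  qed
  have "real (Suc (Suc n) choose Suc j) * ((real j + 1) * (real (n - j) + 1))
      = (real n + 2) * (real (Suc n choose j) * (real (n - j) + 1))"
    by (simp only: mult.assoc[symmetric] 1)
  also have "\<dots> = real (n choose j) * ((real n + 1) * (real n + 2))"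
    unfolding 2 by (simp add: algebra_simps)
  finally show ?thesis
    by (subst frac_eq_eq) (auto simp: add_nonneg_eq_0_iff)
qed

text \<open>Only even \<open>j\<close> survive, since planar returns need an even time. The weights
  add up to 1/2 (\<open>sum_odd_binomials\<close>), so the sum is half of an average of products of
  Wallis factors, each of which lies between 2 / pi and 1.\<close>

lemma heat_kernel_4_zero:
  "heat_kernel (2 * n) (0 :: int ^ 4) = 4 / ((2 * real n + 1) * (2 * real n + 2))
     * (\<Sum>j\<le>n. real ((2 * n + 2) choose (2 * j + 1)) / 4 ^ Suc n * (wallis_seq j * wallis_seq (n - j)))"
proof -
  let ?f = "\<lambda>j. real ((2 * n) choose j) * plane_kernel j 0 0 * plane_kernel (2 * n - j) 0 0"
  have "(\<Sum>j\<le>2 * n. ?f j) = (\<Sum>j\<in>(\<lambda>j. 2 * j) ` {..n}. ?f j)"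
  proof (rule sum.mono_neutral_right)
    show "\<forall>i\<in>{..2 * n} - (\<lambda>j. 2 * j) ` {..n}. ?f i = 0"
    proof
      fix i assume i: "i \<in> {..2 * n} - (\<lambda>j. 2 * j) ` {..n}"
      have "odd i"
      proof
        assume "even i"
        then obtain k where "i = 2 * k" by blast
        with i show False by auto
      qed
      then show "?f i = 0" by (simp add: plane_kernel_zero)
    qed
  qed auto
  also have "\<dots> = (\<Sum>j\<le>n. ?f (2 * j))"
    by (subst sum.reindex) (auto simp: inj_on_def)
  also have "\<dots> = (\<Sum>j\<le>n. real ((2 * n + 2) choose (2 * j + 1)) / ((2 * real n + 1) * (2 * real n + 2))
        * (wallis_seq j * wallis_seq (n - j)))"
  proof (intro sum.cong refl)
    fix j assume "j \<in> {..n}"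
    then have j: "2 * j \<le> 2 * n" by simp
    have e: "2 * n - 2 * j = 2 * (n - j)" by simp
    have "?f (2 * j) = real ((2 * n) choose (2 * j)) / ((real (2 * j) + 1) * (real (2 * n - 2 * j) + 1))
        * (wallis_seq j * wallis_seq (n - j))"
      unfolding e by (simp add: plane_kernel_zero)
    also have "\<dots> = real ((2 * n + 2) choose (2 * j + 1)) / ((2 * real n + 1) * (2 * real n + 2))
        * (wallis_seq j * wallis_seq (n - j))"
      by (subst choose_shift_two[OF j]) (simp del: binomial_Suc_Suc)
    finally show "?f (2 * j) = \<dots>" .
  qed
  moreover have "(2 :: real) ^ (2 * n) = 4 ^ n"
    by (simp add: power_mult)
  ultimately show ?thesis
    unfolding heat_kernel_4[of "2 * n"]
    by (simp add: sum_distrib_left sum_divide_distrib mult_ac del: binomial_Suc_Suc)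
qed

lemma sum_odd_binomials: "(\<Sum>j\<le>n. real ((2 * n + 2) choose (2 * j + 1)) / 4 ^ Suc n) = 1 / 2"
proof -
  let ?N = "2 * n + 2"
  have "(\<Sum>j\<le>n. real (?N choose (2 * j + 1))) = (\<Sum>i\<in>(\<lambda>j. 2 * j + 1) ` {..n}. real (?N choose i))"
    by (subst sum.reindex) (auto simp: inj_on_def)
  also have "\<dots> = (\<Sum>i\<in>(\<lambda>j. 2 * j + 1) ` {..n}. if odd i then real (?N choose i) else 0)"
    by (intro sum.cong) auto
  also have "\<dots> = (\<Sum>i\<le>?N. if odd i then real (?N choose i) else 0)"
  proof (rule sum.mono_neutral_left)
    show "\<forall>i\<in>{..?N} - (\<lambda>j. 2 * j + 1) ` {..n}. (if odd i then real (?N choose i) else 0) = 0"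
    proof
      fix i assume i: "i \<in> {..?N} - (\<lambda>j. 2 * j + 1) ` {..n}"
      have "even i"
      proof (rule ccontr)
        assume "odd i"
        then obtain k where "i = 2 * k + 1" by (auto elim: oddE)
        with i show False by auto
      qed
      then show "(if odd i then real (?N choose i) else 0) = 0" by simp
    qed
  qed auto
  also have "2 * \<dots> = 2 ^ ?N"
    by (rule choose_odd_sum) simp
  finally have "2 * (\<Sum>j\<le>n. real (?N choose (2 * j + 1))) = 4 ^ Suc n"
    by (simp add: power_mult power_add del: binomial_Suc_Suc)
  then show ?thesis
    unfolding sum_divide_distrib[symmetric] by (simp add: field_simps del: binomial_Suc_Suc)
qed

lemma central_ratio_Suc: "central_ratio (Suc n) = central_ratio n * (2 * real n + 1) / (2 * real n + 2)"
proof -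
  have 1: "real (Suc n) * real (2 * Suc n choose Suc n) = (2 * real n + 2) * real (Suc (2 * n) choose n)"
    using arg_cong[OF Suc_times_binomial_eq[of "Suc (2 * n)" n], of real]
    unfolding of_nat_mult by (simp add: algebra_simps del: binomial_Suc_Suc)
  have 2: "real (Suc n) * real (Suc (2 * n) choose n) = (2 * real n + 1) * real (2 * n choose n)"
  proof -
    have "Suc (2 * n) choose n = Suc (2 * n) choose Suc n"
      using binomial_symmetric[of n "Suc (2 * n)"] by (simp del: binomial_Suc_Suc)
    then show ?thesis
      using arg_cong[OF Suc_times_binomial_eq[of "2 * n" n], of real]
      unfolding of_nat_mult by (simp add: algebra_simps del: binomial_Suc_Suc)
  qed
  have "real (Suc n) * real (2 * Suc n choose Suc n) = real (Suc n) * (2 * real (Suc (2 * n) choose n))"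
    unfolding 1 by (simp add: algebra_simps del: binomial_Suc_Suc)
  then have "real (2 * Suc n choose Suc n) = 2 * real (Suc (2 * n) choose n)"
    unfolding mult_cancel_left by (simp del: binomial_Suc_Suc)
  moreover have "real (Suc (2 * n) choose n) = (2 * real n + 1) * real (2 * n choose n) / (real n + 1)"
    using 2 by (simp add: field_simps del: binomial_Suc_Suc)
  ultimately have 3: "real (2 * Suc n choose Suc n) = 2 * ((2 * real n + 1) * real (2 * n choose n) / (real n + 1))"
    by (simp only:)
  have "2 * (a * z / b) / (4 * p) = z / p * a / (2 * b)" for a z b p :: real
    by (simp add: mult_ac)
  from this[of "2 * real n + 1" "real (2 * n choose n)" "real n + 1" "4 ^ n"] show ?thesis
    unfolding central_ratio_def 3 by (simp only: power_Suc distrib_left mult_1_right)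
qed

lemma wallis_seq_Suc:
  "wallis_seq (Suc n) = wallis_seq n * ((2 * real n + 3) * (2 * real n + 1) / (2 * real n + 2)\<^sup>2)"
proof -
  have "2 * real n + 2 \<noteq> 0" by linarith
  then show ?thesis
    by (simp add: wallis_seq_def central_ratio_Suc power2_eq_square field_simps)
qed

lemma wallis_seq_nonneg: "wallis_seq n \<ge> 0"
  by (simp add: wallis_seq_def)

lemma decseq_wallis_seq: "decseq wallis_seq"
proof (rule decseq_SucI)
  fix n
  have "(2 * real n + 3) * (2 * real n + 1) / (2 * real n + 2)\<^sup>2 \<le> 1"
    by (intro divide_le_eq_1_pos[THEN iffD2] zero_less_power) (simp_all add: power2_eq_square algebra_simps)
  then show "wallis_seq (Suc n) \<le> wallis_seq n"
    unfolding wallis_seq_Suc using mult_left_le wallis_seq_nonneg by blast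
qed

lemma wallis_seq_le_1: "wallis_seq n \<le> 1"
proof -
  have "wallis_seq 0 = 1" by (simp add: wallis_seq_def central_ratio_def)
  then show ?thesis using decseq_wallis_seq by (metis decseqD zero_le)
qed

lemma wallis_seq_limit: "wallis_seq \<longlonglongrightarrow> 2 / pi"
proof -
  have "wallis_seq n = inverse (\<Prod>k=1..n. (4 * real k ^ 2) / (4 * real k ^ 2 - 1))" for n
  proof (induction n)
    case (Suc n)
    have "(\<Prod>k=1..Suc n. (4 * real k ^ 2) / (4 * real k ^ 2 - 1))
        = (\<Prod>k=1..n. (4 * real k ^ 2) / (4 * real k ^ 2 - 1)) * (4 * real (Suc n) ^ 2 / (4 * real (Suc n) ^ 2 - 1))"
      by simp
    moreover have "inverse (4 * real (Suc n) ^ 2 / (4 * real (Suc n) ^ 2 - 1))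
        = (2 * real n + 3) * (2 * real n + 1) / (2 * real n + 2)\<^sup>2"
      by (simp add: field_simps power2_eq_square)
    ultimately show ?case
      unfolding wallis_seq_Suc Suc.IH by (simp only: inverse_mult_distrib)
  qed (simp add: wallis_seq_def central_ratio_def)
  then have "wallis_seq = (\<lambda>n. inverse (\<Prod>k=1..n. (4 * real k ^ 2) / (4 * real k ^ 2 - 1)))"
    by blast
  moreover have "(\<lambda>n. inverse (\<Prod>k=1..n. (4 * real k ^ 2) / (4 * real k ^ 2 - 1))) \<longlonglongrightarrow> inverse (pi / 2)"
    by (intro tendsto_inverse wallis) simp
  ultimately have "wallis_seq \<longlonglongrightarrow> inverse (pi / 2)"
    by (simp only:)
  then show ?thesis by (simp add: field_simps)
qed

lemma wallis_seq_ge: "wallis_seq n \<ge> 2 / pi"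
  by (rule decseq_ge[OF decseq_wallis_seq wallis_seq_limit])

lemma central_ratio_limit: "central_ratio \<longlonglongrightarrow> 0"
proof -
  have "(\<lambda>n. wallis_seq n / (2 * real n + 1)) \<longlonglongrightarrow> 0"
    by (rule tendsto_divide_0[OF wallis_seq_limit]) real_asymp
  then have "(\<lambda>n. sqrt (wallis_seq n / (2 * real n + 1))) \<longlonglongrightarrow> sqrt 0"
    by (intro tendsto_real_sqrt)
  moreover have "sqrt (wallis_seq n / (2 * real n + 1)) = central_ratio n" for n
  proof -
    have "wallis_seq n / (2 * real n + 1) = (central_ratio n)\<^sup>2"
      by (simp add: wallis_seq_def add_nonneg_eq_0_iff)
    then show ?thesis by (simp add: central_ratio_def)
  qed
  ultimately show ?thesis by simp
qed

lemma heat_kernel_4_zero_le: "heat_kernel (2 * n) (0 :: int ^ 4) \<le> 2 / ((2 * real n + 1) * (2 * real n + 2))"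
proof -
  have "(\<Sum>j\<le>n. real ((2 * n + 2) choose (2 * j + 1)) / 4 ^ Suc n * (wallis_seq j * wallis_seq (n - j)))
      \<le> (\<Sum>j\<le>n. real ((2 * n + 2) choose (2 * j + 1)) / 4 ^ Suc n * 1)"
    by (intro sum_mono mult_left_mono mult_le_one wallis_seq_le_1 wallis_seq_nonneg) auto
  then have "4 / ((2 * real n + 1) * (2 * real n + 2))
     * (\<Sum>j\<le>n. real ((2 * n + 2) choose (2 * j + 1)) / 4 ^ Suc n * (wallis_seq j * wallis_seq (n - j)))
     \<le> 4 / ((2 * real n + 1) * (2 * real n + 2)) * (1 / 2)"
    unfolding mult_1_right sum_odd_binomials by (intro mult_left_mono) auto
  then show ?thesis unfolding heat_kernel_4_zero by simp
qed

text \<open>The Wallis sequence decreases to its limit, so the limiting constant is a lower bound at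
  every time.\<close>

lemma heat_kernel_4_zero_ge:
  "heat_kernel (2 * n) (0 :: int ^ 4) \<ge> 8 / pi\<^sup>2 / ((2 * real n + 1) * (2 * real n + 2))"
proof -
  have "(\<Sum>j\<le>n. real ((2 * n + 2) choose (2 * j + 1)) / 4 ^ Suc n * (2 / pi * (2 / pi)))
      \<le> (\<Sum>j\<le>n. real ((2 * n + 2) choose (2 * j + 1)) / 4 ^ Suc n * (wallis_seq j * wallis_seq (n - j)))"
    by (intro sum_mono mult_left_mono mult_mono wallis_seq_ge wallis_seq_nonneg) auto
  then have "4 / ((2 * real n + 1) * (2 * real n + 2)) * (1 / 2 * (2 / pi * (2 / pi))) \<le>
    4 / ((2 * real n + 1) * (2 * real n + 2))
     * (\<Sum>j\<le>n. real ((2 * n + 2) choose (2 * j + 1)) / 4 ^ Suc n * (wallis_seq j * wallis_seq (n - j)))"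
    unfolding sum_distrib_right[symmetric] sum_odd_binomials by (intro mult_left_mono) auto
  then show ?thesis unfolding heat_kernel_4_zero
    by (simp add: power2_eq_square mult_ac del: binomial_Suc_Suc)
qed

text \<open>By the monotonicity of the Wallis sequence only the \<open>2K\<close> extreme terms of the convolution exceed
  \<open>(wallis_seq K)\<^sup>2\<close>, and each of them carries at most the central binomial weight.\<close>

lemma wallis_convolution_le:
  "(\<Sum>j\<le>n. real ((2 * n + 2) choose (2 * j + 1)) / 4 ^ Suc n * (wallis_seq j * wallis_seq (n - j)))
     \<le> (wallis_seq K)\<^sup>2 / 2 + 2 * real K * central_ratio (Suc n)"
proof -
  let ?w = "\<lambda>j. real ((2 * n + 2) choose (2 * j + 1)) / 4 ^ Suc n"
  let ?c = "central_ratio (Suc n)"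
  let ?E = "{j. j \<le> n \<and> (j < K \<or> n < K + j)}"
  have wc: "?w j \<le> ?c" for j
    using binomial_maximum'[of "Suc n" "2 * j + 1"]
    by (simp add: central_ratio_def divide_right_mono del: binomial_Suc_Suc)
  have "?E \<subseteq> {..<K} \<union> {n - j |j. j < K}"
  proof
    fix j assume j: "j \<in> ?E"
    then have "j = n - (n - j)" by auto
    moreover have "j < K \<or> n - j < K" using j by auto
    ultimately show "j \<in> {..<K} \<union> {n - j |j. j < K}" by blast
  qed
  also have "{n - j |j. j < K} = (\<lambda>j. n - j) ` {..<K}" by auto
  finally have "card ?E \<le> card ({..<K} \<union> (\<lambda>j. n - j) ` {..<K})"
    by (rule card_mono[rotated]) auto
  also have "\<dots> \<le> card {..<K} + card ((\<lambda>j. n - j) ` {..<K})" by (rule card_Un_le)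
  also have "\<dots> \<le> 2 * K" using card_image_le[of "{..<K}" "\<lambda>j. n - j"] by simp
  finally have card: "card ?E \<le> 2 * K" .
  have "(\<Sum>j\<le>n. ?w j * (wallis_seq j * wallis_seq (n - j)))
      \<le> (\<Sum>j\<le>n. ?w j * (wallis_seq K)\<^sup>2 + (if j \<in> ?E then ?c else 0))"
  proof (rule sum_mono)
    fix j assume j: "j \<in> {..n}"
    show "?w j * (wallis_seq j * wallis_seq (n - j)) \<le> ?w j * (wallis_seq K)\<^sup>2 + (if j \<in> ?E then ?c else 0)"
    proof (cases "j \<in> ?E")
      case True
      have "?w j * (wallis_seq j * wallis_seq (n - j)) \<le> ?w j * 1"
        by (intro mult_left_mono mult_le_one wallis_seq_le_1 wallis_seq_nonneg) auto
      also have "\<dots> \<le> ?w j * (wallis_seq K)\<^sup>2 + ?c"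
        using wc[of j] by (simp add: add_increasing del: binomial_Suc_Suc)
      finally show ?thesis using True by simp
    next
      case False
      then have "K \<le> j" "K \<le> n - j" using j by auto
      then have "wallis_seq j * wallis_seq (n - j) \<le> wallis_seq K * wallis_seq K"
        using decseq_wallis_seq by (intro mult_mono) (auto simp: decseq_def wallis_seq_nonneg)
      then have "?w j * (wallis_seq j * wallis_seq (n - j)) \<le> ?w j * (wallis_seq K)\<^sup>2"
        by (intro mult_left_mono) (auto simp: power2_eq_square)
      then show ?thesis unfolding if_not_P[OF False] by simp
    qed
  qed
  also have "\<dots> = (\<Sum>j\<le>n. ?w j) * (wallis_seq K)\<^sup>2 + (\<Sum>j\<in>{..n} \<inter> ?E. ?c)"
    unfolding sum.distrib sum_distrib_right by (subst sum.inter_restrict) simp_all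
  also have "{..n} \<inter> ?E = ?E" by auto
  also have "(\<Sum>j\<le>n. ?w j) * (wallis_seq K)\<^sup>2 + (\<Sum>j\<in>?E. ?c)
      \<le> 1 / 2 * (wallis_seq K)\<^sup>2 + real (2 * K) * ?c"
    unfolding sum_odd_binomials sum_constant
  proof (intro add_mono order_refl mult_right_mono of_nat_mono)
    show "0 \<le> ?c"
      by (simp add: central_ratio_def)
  qed (rule card)
  finally show ?thesis by simp
qed

lemma heat_kernel_4_limit:
  "(\<lambda>n. (2 * real n + 1) * (2 * real n + 2) * heat_kernel (2 * n) (0 :: int ^ 4)) \<longlonglongrightarrow> 8 / pi\<^sup>2"
proof (rule order_tendstoI)
  let ?f = "\<lambda>n. (2 * real n + 1) * (2 * real n + 2) * heat_kernel (2 * n) (0 :: int ^ 4)"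
  have pos: "(2 * real n + 1) * (2 * real n + 2) > 0" for n
    by (intro mult_pos_pos) auto
  fix a
  {
    assume a: "a < 8 / pi\<^sup>2"
    have "8 / pi\<^sup>2 \<le> ?f n" for n
      using heat_kernel_4_zero_ge[of n] pos[of n] by (simp add: divide_le_eq mult_ac)
    then show "\<forall>\<^sub>F n in sequentially. a < ?f n"
      using a by (intro always_eventually allI) (rule less_le_trans)
  }
  {
    assume a: "8 / pi\<^sup>2 < a"
    \<comment> \<open>The cut-off \<open>K\<close> is fixed first, so that the bulk term is below
      \<open>a\<close>; only then does \<open>n\<close> tend to infinity, which removes the
      contribution of the extreme terms.\<close>
    have "(\<lambda>K. 4 * ((wallis_seq K)\<^sup>2 / 2)) \<longlonglongrightarrow> 4 * ((2 / pi)\<^sup>2 / 2)"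
      by (intro tendsto_intros wallis_seq_limit) simp
    moreover have "4 * ((2 / pi)\<^sup>2 / 2) < a"
      using a by (simp add: power_divide)
    ultimately have "\<forall>\<^sub>F K in sequentially. 4 * ((wallis_seq K)\<^sup>2 / 2) < a"
      by (rule order_tendstoD)
    then obtain K where K: "4 * ((wallis_seq K)\<^sup>2 / 2) < a"
      by (auto simp: eventually_sequentially)
    have "(\<lambda>n. 4 * ((wallis_seq K)\<^sup>2 / 2 + 2 * real K * central_ratio (Suc n)))
        \<longlonglongrightarrow> 4 * ((wallis_seq K)\<^sup>2 / 2 + 2 * real K * 0)"
      by (intro tendsto_intros filterlim_compose[OF central_ratio_limit] filterlim_Suc)
    then have "\<forall>\<^sub>F n in sequentially. 4 * ((wallis_seq K)\<^sup>2 / 2 + 2 * real K * central_ratio (Suc n)) < a"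
      using K by (intro order_tendstoD) auto
    then show "\<forall>\<^sub>F n in sequentially. ?f n < a"
    proof eventually_elim
      case (elim n)
      have "?f n = 4 * (\<Sum>j\<le>n. real ((2 * n + 2) choose (2 * j + 1)) / 4 ^ Suc n * (wallis_seq j * wallis_seq (n - j)))"
        unfolding heat_kernel_4_zero using pos[of n] by simp
      also have "\<dots> \<le> 4 * ((wallis_seq K)\<^sup>2 / 2 + 2 * real K * central_ratio (Suc n))"
        by (rule mult_left_mono[OF wallis_convolution_le]) simp
      finally show ?case using elim by simp
    qed
  }
qed

section \<open>The Green function\<close>

text \<open>The denominator is chosen so that the bound telescopes.\<close>

lemma heat_kernel_4_le: "heat_kernel n (x :: int ^ 4) \<le> 6 / ((real n + 1) * (real n + 2))"
proof (cases "even n")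
  case True
  then obtain k where k: "n = 2 * k" by blast
  have "heat_kernel n x \<le> 2 / ((real n + 1) * (real n + 2))"
    using heat_kernel_even_le[of k x] heat_kernel_4_zero_le[of k] by (simp add: k)
  also have "\<dots> \<le> 6 / ((real n + 1) * (real n + 2))"
    by (intro divide_right_mono) auto
  finally show ?thesis .
next
  case False
  then obtain k where k: "n = Suc (2 * k)" by (auto elim: oddE)
  have "heat_kernel n x \<le> 2 / (real n * (real n + 1))"
    using heat_kernel_odd_le[of k x] heat_kernel_4_zero_le[of k] by (simp add: k algebra_simps)
  also have "\<dots> \<le> 6 / ((real n + 1) * (real n + 2))"
  proof -
    \<comment> \<open>\<open>n\<close> is odd, hence at least 1, and
      \<open>n + 2 \<le> 3 * n\<close>; this is where the 2 becomes 6.\<close>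
    have "2 * (real n + 2) \<le> 6 * real n" using k by simp
    then have "2 * ((real n + 1) * (real n + 2)) \<le> 6 * (real n * (real n + 1))"
      using mult_right_mono[of "2 * (real n + 2)" "6 * real n" "real n + 1"] by (simp add: algebra_simps)
    then show ?thesis using k by (subst frac_le_eq) (auto intro!: divide_nonpos_pos simp: add_pos_pos)
  qed
  finally show ?thesis .
qed

lemma sums_telescope_reciprocal:
  "(\<lambda>l. c / ((real (l + k) + 1) * (real (l + k) + 2))) sums (c / (real k + 1))"
proof -
  have "(\<lambda>l. c / (real (l + k) + 1)) \<longlonglongrightarrow> 0"
    by real_asymp
  then have "(\<lambda>l. c / (real (l + k) + 1) - c / (real (Suc l + k) + 1)) sums (c / (real (0 + k) + 1) - 0)"
    by (rule telescope_sums')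
  moreover have "c / (real (l + k) + 1) - c / (real (Suc l + k) + 1) = c / ((real (l + k) + 1) * (real (l + k) + 2))" for l
    by (simp add: divide_simps) (simp add: algebra_simps)
  ultimately show ?thesis by simp
qed

lemma summable_heat_kernel_4: "summable (\<lambda>l. heat_kernel (l + k) (x :: int ^ 4))"
  by (rule summable_comparison_test'[OF sums_summable[OF sums_telescope_reciprocal[of 6 k]], of 0])
     (use heat_kernel_4_le[of "_ + k" x] in \<open>auto simp: add.commute\<close>)

text \<open>Averaging the Green function over \<open>k\<close> steps deletes the first
  \<open>k\<close> terms of its series (\<open>sum_heat_kernel_green_tail\<close>). The tail is
  therefore the mean of \<open>green\<close> at the position after \<open>k\<close> steps from
  \<open>x\<close>.\<close>

definition green_tail :: "nat \<Rightarrow> int ^ 4 \<Rightarrow> real" where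
  "green_tail k x = (\<Sum>l. heat_kernel (l + k) x)"

abbreviation green :: "int ^ 4 \<Rightarrow> real" where
  "green \<equiv> green_tail 0"

lemma green_tail_nonneg [simp]: "green_tail k x \<ge> 0"
  unfolding green_tail_def by (intro suminf_nonneg summable_heat_kernel_4) simp

lemma green_tail_uminus: "green_tail k (- x) = green_tail k x"
  by (simp add: green_tail_def heat_kernel_uminus)

lemma green_minus_commute: "green (x - y) = green (y - x)"
  using green_tail_uminus[of 0 "x - y"] by simp

lemma green_tail_le: "green_tail k x \<le> 6 / (real k + 1)"
proof -
  have "green_tail k x \<le> (\<Sum>l. 6 / ((real (l + k) + 1) * (real (l + k) + 2)))"
    unfolding green_tail_def
    by (intro suminf_le summable_heat_kernel_4 sums_summable[OF sums_telescope_reciprocal] heat_kernel_4_le)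
  then show ?thesis
    using sums_unique[OF sums_telescope_reciprocal[of 6 k]] by simp
qed

lemma green_tail_split: "green_tail k x = (\<Sum>l\<in>{k..<k + m}. heat_kernel l x) + green_tail (k + m) x"
proof -
  have "green_tail k x = (\<Sum>l. heat_kernel (l + m + k) x) + (\<Sum>l<m. heat_kernel (l + k) x)"
    unfolding green_tail_def by (rule suminf_split_initial_segment[OF summable_heat_kernel_4])
  moreover have "(\<Sum>l<m. heat_kernel (l + k) x) = (\<Sum>l\<in>{k..<k + m}. heat_kernel l x)"
    using sum.shift_bounds_nat_ivl[of "\<lambda>l. heat_kernel l x" 0 k m] by (simp add: lessThan_atLeast0 add.commute)
  ultimately show ?thesis by (simp add: green_tail_def add_ac)
qed

lemma green_tail_Suc: "green_tail k x = heat_kernel k x + green_tail (Suc k) x"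
  using green_tail_split[of k x 1] by simp

lemma green_tail_antimono: "k \<le> m \<Longrightarrow> green_tail m x \<le> green_tail k x"
  using green_tail_split[of k x "m - k"] by (simp add: sum_nonneg)

lemma green_split: "k \<le> m \<Longrightarrow> green_tail k x = (\<Sum>l\<in>{k..<m}. heat_kernel l x) + green_tail m x"
  using green_tail_split[of k x "m - k"] by simp

text \<open>At points of odd parity the kernel lives at odd times, where it is bounded by the return
  probability one step earlier; this costs the shift to \<open>k - 1\<close>. The truncation at
  \<open>k = 0\<close> is harmless, because the term at time 0 vanishes at such points.\<close>

lemma green_tail_le_zero: "green_tail k x \<le> green_tail (k - 1) 0"
proof (cases "even (\<Sum>i\<in>UNIV. x $ i)")
  case True
  have "heat_kernel l x \<le> heat_kernel l (0 :: int ^ 4)" for l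
  proof (cases "even l")
    case True
    then obtain j where "l = 2 * j" by blast
    then show ?thesis using heat_kernel_even_le by blast
  next
    case False
    with True heat_kernel_parity[of l x] have "heat_kernel l x = 0" by auto
    then show ?thesis by simp
  qed
  then have "green_tail k x \<le> green_tail k 0"
    unfolding green_tail_def by (intro suminf_le summable_heat_kernel_4)
  then show ?thesis using green_tail_antimono[of "k - 1" k 0] by simp
next
  case odd: False
  have *: "heat_kernel l x \<le> (if l = 0 then 0 else heat_kernel (l - 1) (0 :: int ^ 4))" for l
  proof (cases "even l")
    case True
    with odd heat_kernel_parity[of l x] have "heat_kernel l x = 0" by auto
    then show ?thesis by simp
  next
    case False
    then obtain j where "l = Suc (2 * j)" by (auto elim: oddE)
    then show ?thesis using heat_kernel_odd_le[of j x] by simp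
  qed
  have le: "green_tail (Suc m) x \<le> green_tail m 0" for m
    unfolding green_tail_def
    by (intro suminf_le summable_heat_kernel_4) (use *[of "_ + Suc m"] in auto)
  show ?thesis
  proof (cases k)
    case 0
    then show ?thesis
      using le[of 0] green_tail_Suc[of 0 x] *[of 0] by simp
  next
    case (Suc m)
    then show ?thesis using le by simp
  qed
qed

lemma green_tail_even: "(\<lambda>i. heat_kernel (2 * (i + j)) (0 :: int ^ 4)) sums green_tail (2 * j) 0"
proof -
  have "(\<lambda>l. heat_kernel (l + 2 * j) (0 :: int ^ 4)) sums green_tail (2 * j) 0"
    unfolding green_tail_def by (intro summable_sums summable_heat_kernel_4)
  moreover have "strict_mono (\<lambda>i::nat. 2 * i)" by (simp add: strict_mono_def)
  moreover have "heat_kernel (l + 2 * j) (0 :: int ^ 4) = 0" if "l \<notin> range (\<lambda>i. 2 * i)" for l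
    using that by (intro heat_kernel_odd_zero) (auto elim: evenE)
  ultimately have "(\<lambda>i. heat_kernel (2 * i + 2 * j) (0 :: int ^ 4)) sums green_tail (2 * j) 0"
    by (subst sums_mono_reindex[of "\<lambda>i. 2 * i"]) auto
  then show ?thesis by (simp add: algebra_simps)
qed

text \<open>Comparison with a telescoping series. For odd \<open>k\<close> the tail agrees with the
  one from \<open>k + 1\<close>, which accounts for the 2 in the denominator.\<close>

lemma green_tail_zero_ge: "green_tail k 0 \<ge> 4 / pi\<^sup>2 / (real k + 2)"
proof -
  have even: "green_tail (2 * j) 0 \<ge> 4 / pi\<^sup>2 / (2 * real j + 1)" for j
  proof -
    \<comment> \<open>Its decrement is the lower bound of \<open>heat_kernel_4_zero_ge\<close> with
      the factor \<open>t + 2\<close> in the denominator enlarged to \<open>t + 3\<close>.\<close>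
    let ?f = "\<lambda>i. 4 / pi\<^sup>2 / (2 * real (i + j) + 1)"
    have "?f \<longlonglongrightarrow> 0" by real_asymp
    then have s: "(\<lambda>i. ?f i - ?f (Suc i)) sums (?f 0 - 0)" by (rule telescope_sums')
    have le: "?f i - ?f (Suc i) \<le> heat_kernel (2 * (i + j)) (0 :: int ^ 4)" for i
    proof -
      define t where "t = 2 * real (i + j)"
      have t: "t \<ge> 0" by (simp add: t_def)
      have "?f i - ?f (Suc i) = 4 / pi\<^sup>2 / (t + 1) - 4 / pi\<^sup>2 / (t + 3)"
        by (simp add: t_def algebra_simps)
      also have "\<dots> = 8 / pi\<^sup>2 / ((t + 1) * (t + 3))"
        using t by (simp add: divide_simps)
      also have "\<dots> \<le> 8 / pi\<^sup>2 / ((t + 1) * (t + 2))"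
        using t by (intro divide_left_mono mult_left_mono mult_pos_pos) auto
      also have "\<dots> \<le> heat_kernel (2 * (i + j)) (0 :: int ^ 4)"
        using heat_kernel_4_zero_ge[of "i + j"] by (simp add: t_def)
      finally show ?thesis .
    qed
    from sums_le[OF le s green_tail_even[of j]] show ?thesis by simp
  qed
  show ?thesis
  proof (cases "even k")
    case True
    then obtain j where k: "k = 2 * j" by blast
    have "4 / pi\<^sup>2 / (real k + 2) \<le> 4 / pi\<^sup>2 / (2 * real j + 1)"
      unfolding k by (intro divide_left_mono) auto
    then show ?thesis using even[of j] k by simp
  next
    case False
    then obtain j where k: "Suc k = 2 * Suc j" by (auto elim: oddE)
    have "heat_kernel k (0 :: int ^ 4) = 0" using False by (rule heat_kernel_odd_zero)
    then have "green_tail k 0 = green_tail (2 * Suc j) 0" using green_tail_Suc[of k 0] k by simp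
    moreover have "real k + 2 = 2 * real (Suc j) + 1" using k by linarith
    ultimately show ?thesis using even[of "Suc j"] by simp
  qed
qed

lemma green_tail_zero_le_eventually:
  assumes "c > 4 / pi\<^sup>2"
  shows "\<forall>\<^sub>F k in sequentially. green_tail k 0 \<le> c / real k"
proof -
  have "8 / pi\<^sup>2 < 2 * c" using assms by (simp add: field_simps)
  then have "\<forall>\<^sub>F n in sequentially. (2 * real n + 1) * (2 * real n + 2) * heat_kernel (2 * n) (0 :: int ^ 4) < 2 * c"
    by (rule order_tendstoD(2)[OF heat_kernel_4_limit])
  then obtain J where J: "\<And>n. n \<ge> J \<Longrightarrow> (2 * real n + 1) * (2 * real n + 2) * heat_kernel (2 * n) (0 :: int ^ 4) < 2 * c"
    by (auto simp: eventually_sequentially)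
  have c: "c > 0" using assms by (rule less_trans[rotated]) (simp add: zero_less_divide_iff)
  have even: "green_tail (2 * j) 0 \<le> c / real (2 * j)" if j: "j \<ge> J" "j > 0" for j
  proof -
    let ?f = "\<lambda>i. c / (2 * real (i + j))"
    have "?f \<longlonglongrightarrow> 0" by real_asymp
    then have s: "(\<lambda>i. ?f i - ?f (Suc i)) sums (?f 0 - 0)" by (rule telescope_sums')
    have le: "heat_kernel (2 * (i + j)) (0 :: int ^ 4) \<le> ?f i - ?f (Suc i)" for i
    proof -
      define t where "t = 2 * real (i + j)"
      have t: "t > 0" using j by (simp add: t_def)
      have "(t + 1) * (t + 2) * heat_kernel (2 * (i + j)) (0 :: int ^ 4) \<le> 2 * c"
        using J[of "i + j"] j by (simp add: t_def)
      then have "heat_kernel (2 * (i + j)) (0 :: int ^ 4) \<le> 2 * c / ((t + 1) * (t + 2))"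
        using t by (simp add: pos_le_divide_eq mult.commute)
      also have "\<dots> \<le> 2 * c / (t * (t + 2))"
        using t c by (intro divide_left_mono mult_right_mono mult_pos_pos) auto
      also have "\<dots> = c / t - c / (t + 2)"
        using t by (simp add: divide_simps) (simp add: algebra_simps)
      also have "\<dots> = ?f i - ?f (Suc i)"
        by (simp add: t_def algebra_simps)
      finally show ?thesis .
    qed
    from sums_le[OF le green_tail_even[of j] s] show ?thesis by simp
  qed
  have "green_tail k 0 \<le> c / real k" if k: "k \<ge> 2 * J + 2" for k
  proof (cases "even k")
    case True
    then obtain j where "k = 2 * j" by blast
    then show ?thesis using even[of j] k by simp
  next
    case False
    then obtain j where j: "Suc k = 2 * Suc j" by (auto elim: oddE)
    have "heat_kernel k (0 :: int ^ 4) = 0" using False by (rule heat_kernel_odd_zero)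
    then have "green_tail k 0 = green_tail (2 * Suc j) 0" using green_tail_Suc[of k 0] j by simp
    also have "\<dots> \<le> c / real (2 * Suc j)" using j k by (intro even) auto
    also have "\<dots> \<le> c / real k" using c k j[symmetric] by (intro divide_left_mono) auto
    finally show ?thesis .
  qed
  then show ?thesis by (auto simp: eventually_sequentially)
qed

lemma tendsto_green_tail_zero: "(\<lambda>k. real k * green_tail k 0) \<longlonglongrightarrow> 4 / pi\<^sup>2"
proof (rule order_tendstoI)
  fix a
  {
    assume a: "a < 4 / pi\<^sup>2"
    have "(\<lambda>k. 4 / pi\<^sup>2 * (real k / (real k + 2))) \<longlonglongrightarrow> 4 / pi\<^sup>2 * 1"
      by (intro tendsto_intros) real_asymp
    then have "\<forall>\<^sub>F k in sequentially. a < 4 / pi\<^sup>2 * (real k / (real k + 2))"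
      using a by (intro order_tendstoD) auto
    then show "\<forall>\<^sub>F k in sequentially. a < real k * green_tail k 0"
    proof eventually_elim
      case (elim k)
      have "4 / pi\<^sup>2 * (real k / (real k + 2)) = real k * (4 / pi\<^sup>2 / (real k + 2))" by simp
      also have "\<dots> \<le> real k * green_tail k 0"
        by (intro mult_left_mono green_tail_zero_ge) auto
      finally show ?case using elim by linarith
    qed
  }
  {
    assume a: "4 / pi\<^sup>2 < a"
    then obtain c where c: "4 / pi\<^sup>2 < c" "c < a" using dense by blast
    show "\<forall>\<^sub>F k in sequentially. real k * green_tail k 0 < a"
      using green_tail_zero_le_eventually[OF c(1)] eventually_gt_at_top[of 0]
    proof eventually_elim
      case (elim k)
      then show ?case using c(2) by (simp add: field_simps)
    qed
  }
qed

section \<open>First and second moments of Green functions along the walk\<close>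

lemma sum_heat_kernel_heat_kernel:
  "(\<Sum>y\<in>cube k. heat_kernel k y * heat_kernel l (w + y)) = heat_kernel (k + l) (w :: int ^ 'd::finite)"
proof -
  have "heat_kernel l (- w - y) = heat_kernel l (w + y)" for y
    using heat_kernel_uminus[of l "w + y"] by simp
  then show ?thesis
    using chapman_kolmogorov[of "cube k" k l "- w"] by (simp add: heat_kernel_uminus)
qed

lemma sum_heat_kernel_green_tail:
  "(\<Sum>y\<in>cube k. heat_kernel k y * green_tail m (w + y)) = green_tail (k + m) w"
proof -
  have "(\<Sum>y\<in>cube k. heat_kernel k y * green_tail m (w + y))
      = (\<Sum>l. \<Sum>y\<in>cube k. heat_kernel k y * heat_kernel (l + m) (w + y))"
    unfolding green_tail_def
    by (subst suminf_sum) (auto intro!: summable_mult summable_heat_kernel_4 sum.cong simp: suminf_mult[OF summable_heat_kernel_4])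
  also have "\<dots> = (\<Sum>l. heat_kernel (l + (k + m)) w)"
    unfolding sum_heat_kernel_heat_kernel by (simp only: add_ac)
  finally show ?thesis by (simp add: green_tail_def)
qed

lemma sum_heat_kernel_product_le:
  fixes z :: "int ^ 'd::finite"
  assumes "finite F"
  shows "(\<Sum>x\<in>F. heat_kernel l (z + x) * heat_kernel m (z + x)) \<le> heat_kernel (l + m) (0 :: int ^ 'd)"
proof -
  have "(\<Sum>x\<in>F. heat_kernel l (z + x) * heat_kernel m (z + x))
      = (\<Sum>w\<in>(\<lambda>x. z + x) ` F. heat_kernel l w * heat_kernel m w)"
    by (subst sum.reindex) (auto simp: inj_on_def)
  also have "\<dots> \<le> (\<Sum>w\<in>(\<lambda>x. z + x) ` F \<union> cube l. heat_kernel l w * heat_kernel m w)"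
    using assms by (intro sum_mono2) auto
  also have "\<dots> = heat_kernel (l + m) (0 :: int ^ 'd)"
    using chapman_kolmogorov[of "(\<lambda>x. z + x) ` F \<union> cube l" l m "0 :: int ^ 'd"] assms by (simp add: heat_kernel_uminus)
  finally show ?thesis .
qed

text \<open>The expectation of the product of the Green functions at \<open>z + S\<^sub>i\<close> and \<open>z + S\<^sub>i\<^sub>+\<^sub>k\<close>, with the last \<open>k\<close> steps
  integrated out.\<close>

definition green_pair :: "int ^ 4 \<Rightarrow> nat \<Rightarrow> nat \<Rightarrow> real" where
  "green_pair z i k = (\<Sum>x\<in>cube i. heat_kernel i x * (green (z + x) * green_tail k (z + x)))"

lemma green_pair_nonneg [simp]: "green_pair z i k \<ge> 0"
  unfolding green_pair_def by (intro sum_nonneg mult_nonneg_nonneg) auto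

text \<open>The factor with the later position is replaced by its supremum, then the other one is
  averaged. For \<open>k > i\<close> the resulting products add up to at most half of a square; for
  \<open>k \<le> i\<close> the finer \<open>sum_green_pair_le\<close> takes over.\<close>

lemma green_pair_le: "green_pair z i k \<le> green_tail (i - 1) 0 * green_tail (k - 1) 0"
proof -
  have "green_pair z i k \<le> (\<Sum>x\<in>cube i. heat_kernel i x * (green (z + x) * green_tail (k - 1) 0))"
    unfolding green_pair_def by (intro sum_mono mult_left_mono green_tail_le_zero) auto
  also have "\<dots> = green_tail i z * green_tail (k - 1) 0"
    unfolding mult.assoc[symmetric] sum_distrib_right[symmetric] sum_heat_kernel_green_tail by simp
  also have "\<dots> \<le> green_tail (i - 1) 0 * green_tail (k - 1) 0"
    by (intro mult_right_mono green_tail_le_zero) auto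
  finally show ?thesis .
qed

lemma sum_inverse_sqrt_le: "(\<Sum>l<n. 1 / sqrt (real l + 1)) \<le> 2 * sqrt (real n)"
proof (induction n)
  case (Suc n)
  let ?a = "sqrt (real n)" and ?b = "sqrt (real n + 1)"
  have "(?b - ?a) * (?b + ?a) = 1"
    by (simp add: algebra_simps)
  moreover have "(?b - ?a) * (?b + ?a) \<le> (?b - ?a) * (2 * ?b)"
    by (intro mult_left_mono) auto
  ultimately have "1 \<le> (?b - ?a) * 2 * ?b" by (simp only: mult.assoc)
  then have "1 / ?b \<le> (?b - ?a) * 2"
    by (subst pos_divide_le_eq) (auto simp: add_nonneg_pos)
  with Suc.IH show ?case by (simp add: add.commute)
qed simp

text \<open>A Hilbert-type double sum: \<open>l + m + 1\<close> dominates the geometric mean of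
  \<open>l + 1\<close> and \<open>m + 1\<close>, so the summand is bounded by a product.\<close>

lemma double_sum_reciprocal_le: "(\<Sum>l<n. \<Sum>m<n. 1 / (real l + real m + 1)) \<le> 4 * real n"
proof -
  have "(\<Sum>l<n. \<Sum>m<n. 1 / (real l + real m + 1)) \<le> (\<Sum>l<n. \<Sum>m<n. 1 / sqrt (real l + 1) * (1 / sqrt (real m + 1)))"
  proof (intro sum_mono)
    fix l m
    have "sqrt (real l + 1) * sqrt (real m + 1) \<le> sqrt ((real l + real m + 1) * (real l + real m + 1))"
      unfolding real_sqrt_mult[symmetric] by (intro real_sqrt_le_mono mult_mono) auto
    then have "sqrt (real l + 1) * sqrt (real m + 1) \<le> real l + real m + 1"
      by simp
    then show "1 / (real l + real m + 1) \<le> 1 / sqrt (real l + 1) * (1 / sqrt (real m + 1))"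
      by (simp add: frac_le)
  qed
  also have "\<dots> = (\<Sum>l<n. 1 / sqrt (real l + 1)) * (\<Sum>m<n. 1 / sqrt (real m + 1))"
    by (simp add: sum_product)
  also have "\<dots> \<le> (2 * sqrt (real n)) * (2 * sqrt (real n))"
    by (intro mult_mono sum_inverse_sqrt_le sum_nonneg) auto
  finally show ?thesis by simp
qed

text \<open>Among the three times in \<open>E (p\<^sub>l p\<^sub>m) (z + S\<^sub>i)\<close> the largest contributes its supremum bound, and the other two
  are merged by the Chapman--Kolmogorov equation. A cruder bound would cost a factor \<open>ln i\<close>.\<close>

lemma sum_green_pair_le:
  assumes "i > 0"
  shows "(\<Sum>k\<le>i. green_pair z i k) \<le> 216 / real i"
proof -
  let ?p = "heat_kernel :: nat \<Rightarrow> int ^ 4 \<Rightarrow> real"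
  define g where "g x = (\<Sum>l<i. ?p l x)" for x
  define f where "f x = (\<Sum>l<i. (real l + 1) * ?p l x)" for x
  let ?E = "\<lambda>h. \<Sum>x\<in>cube i. ?p i x * h (z + x)"
  have f0: "f x \<ge> 0" and g0: "g x \<ge> 0" for x
    by (auto simp: f_def g_def intro!: sum_nonneg)
  have green: "green x = g x + green_tail i x" for x
    using green_split[of 0 i x] by (simp add: g_def atLeast0LessThan)
  \<comment> \<open>The sum over \<open>k\<close> counts a time \<open>l < i\<close> once for each
    \<open>k \<le> l\<close>; this is the weight \<open>l + 1\<close> in \<open>f\<close>.\<close>
  have "(\<Sum>k\<le>i. green_tail k x) = f x + (real i + 1) * green_tail i x" for x
  proof -
    have "(\<Sum>l\<in>{k..<i}. ?p l x) = (\<Sum>l<i. if k \<le> l then ?p l x else 0)" for k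
      by (rule sum.mono_neutral_cong_left) auto
    then have gt: "green_tail k x = (\<Sum>l<i. if k \<le> l then ?p l x else 0) + green_tail i x" if "k \<le> i" for k
      using green_split[OF that, of x] by simp
    have "(\<Sum>k\<le>i. green_tail k x) = (\<Sum>k\<le>i. (\<Sum>l<i. if k \<le> l then ?p l x else 0) + green_tail i x)"
      by (rule sum.cong[OF refl]) (rule gt, simp)
    also have "\<dots> = (\<Sum>k\<le>i. \<Sum>l<i. if k \<le> l then ?p l x else 0) + (real i + 1) * green_tail i x"
      unfolding sum.distrib by simp
    also have "(\<Sum>k\<le>i. \<Sum>l<i. if k \<le> l then ?p l x else 0) = (\<Sum>l<i. \<Sum>k\<le>i. if k \<le> l then ?p l x else 0)"
      by (rule sum.swap)
    also have "\<dots> = f x"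
      unfolding f_def
    proof (intro sum.cong refl)
      fix l assume "l \<in> {..<i}"
      then have "{..i} \<inter> {k. k \<le> l} = {..l}" by auto
      then show "(\<Sum>k\<le>i. if k \<le> l then ?p l x else 0) = (real l + 1) * ?p l x"
        by (simp add: sum.If_cases)
    qed
    finally show ?thesis .
  qed
  moreover have "(\<Sum>k\<le>i. green_pair z i k) = ?E (\<lambda>x. green x * (\<Sum>k\<le>i. green_tail k x))"
    unfolding green_pair_def by (subst sum.swap) (simp add: sum_distrib_left)
  ultimately have "(\<Sum>k\<le>i. green_pair z i k) = ?E (\<lambda>x. green x * (f x + (real i + 1) * green_tail i x))"
    by simp
  \<comment> \<open>In the first expectation both Green times are below \<open>i\<close>, and the
    supremum bound falls on the kernel at time \<open>i\<close>; in the other two it falls on the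
    factor \<open>green_tail i\<close>.\<close>
  also have "\<dots> = ?E (\<lambda>x. g x * f x) + ?E (\<lambda>x. green_tail i x * f x) + ?E (\<lambda>x. green x * ((real i + 1) * green_tail i x))"
    unfolding sum.distrib[symmetric] by (intro sum.cong refl) (simp add: green algebra_simps)
  also have "\<dots> \<le> 144 / (real i + 1) + 36 / (real i + 1) + 36 / (real i + 1)"
  proof (intro add_mono)
    have sup: "?p i x \<le> 6 / (real i + 1)\<^sup>2" for x
    proof -
      have "?p i x \<le> 6 / ((real i + 1) * (real i + 2))" by (rule heat_kernel_4_le)
      also have "\<dots> \<le> 6 / (real i + 1)\<^sup>2"
        unfolding power2_eq_square by (intro divide_left_mono mult_left_mono mult_pos_pos) auto
      finally show ?thesis .
    qed
    show "?E (\<lambda>x. green x * ((real i + 1) * green_tail i x)) \<le> 36 / (real i + 1)"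
    proof -
      have six: "(real i + 1) * green_tail i x \<le> 6" for x
        using green_tail_le[of i x] by (simp add: field_simps)
      have "?E (\<lambda>x. green x * ((real i + 1) * green_tail i x)) \<le> ?E (\<lambda>x. green x * 6)"
        by (intro sum_mono mult_left_mono six) auto
      also have "\<dots> = 6 * green_tail i z"
        unfolding mult.assoc[symmetric] sum_distrib_right[symmetric] sum_heat_kernel_green_tail by simp
      finally show ?thesis using green_tail_le[of i z] by simp
    qed
    show "?E (\<lambda>x. green_tail i x * f x) \<le> 36 / (real i + 1)"
    proof -
      have "?E (\<lambda>x. green_tail i x * f x) \<le> ?E (\<lambda>x. 6 / (real i + 1) * f x)"
        by (intro sum_mono mult_left_mono mult_right_mono green_tail_le f0) auto
      also have "\<dots> = 6 / (real i + 1) * (\<Sum>l<i. (real l + 1) * (\<Sum>x\<in>cube i. ?p i x * ?p l (z + x)))"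
        unfolding f_def by (simp add: sum_distrib_left mult_ac) (rule sum.swap)
      also have "\<dots> \<le> 6 / (real i + 1) * (\<Sum>l<i. real i * (6 / (real i + 1)\<^sup>2))"
      proof (intro mult_left_mono sum_mono mult_mono)
        fix l assume "l \<in> {..<i}"
        have "?p (i + l) z \<le> 6 / ((real (i + l) + 1) * (real (i + l) + 2))" by (rule heat_kernel_4_le)
        also have "\<dots> \<le> 6 / (real i + 1)\<^sup>2"
          unfolding power2_eq_square by (intro divide_left_mono mult_mono mult_pos_pos) auto
        finally show "(\<Sum>x\<in>cube i. ?p i x * ?p l (z + x)) \<le> 6 / (real i + 1)\<^sup>2"
          by (simp add: sum_heat_kernel_heat_kernel)
      qed (auto intro!: sum_nonneg)
      also have "\<dots> = 36 / (real i + 1) * (real i * real i / (real i + 1)\<^sup>2)"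
        by simp
      also have "\<dots> \<le> 36 / (real i + 1) * 1"
        by (intro mult_left_mono divide_le_eq_1_pos[THEN iffD2])
          (auto simp: power2_eq_square algebra_simps add_pos_nonneg)
      finally show ?thesis by simp
    qed
    show "?E (\<lambda>x. g x * f x) \<le> 144 / (real i + 1)"
    proof -
      have "(\<Sum>x\<in>cube i. g (z + x) * f (z + x))
          = (\<Sum>l<i. \<Sum>m<i. (real m + 1) * (\<Sum>x\<in>cube i. ?p l (z + x) * ?p m (z + x)))"
      proof -
        have "(\<Sum>x\<in>cube i. g (z + x) * f (z + x))
            = (\<Sum>x\<in>cube i. \<Sum>l<i. \<Sum>m<i. (real m + 1) * (?p l (z + x) * ?p m (z + x)))"
          unfolding g_def f_def sum_product by (simp add: mult_ac)
        also have "\<dots> = (\<Sum>l<i. \<Sum>x\<in>cube i. \<Sum>m<i. (real m + 1) * (?p l (z + x) * ?p m (z + x)))"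
          by (rule sum.swap)
        also have "\<dots> = (\<Sum>l<i. \<Sum>m<i. \<Sum>x\<in>cube i. (real m + 1) * (?p l (z + x) * ?p m (z + x)))"
          by (intro sum.cong refl sum.swap)
        finally show ?thesis by (simp add: sum_distrib_left)
      qed
      also have "\<dots> \<le> (\<Sum>l<i. \<Sum>m<i. 6 * (1 / (real l + real m + 1)))"
      proof (intro sum_mono)
        fix l m
        have "(real m + 1) * (\<Sum>x\<in>cube i. ?p l (z + x) * ?p m (z + x)) \<le> (real m + 1) * ?p (l + m) 0"
          by (intro mult_left_mono sum_heat_kernel_product_le) auto
        also have "\<dots> \<le> (real l + real m + 1) * (6 / ((real (l + m) + 1) * (real (l + m) + 2)))"
          by (intro mult_mono heat_kernel_4_le) auto
        also have "\<dots> = 6 / (real l + real m + 2)"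
        proof -
          have "t * (6 / (t * (t + 1))) = 6 / (t + 1)" if "t > 0" for t :: real
            using that by simp
          from this[of "real l + real m + 1"] show ?thesis by (simp add: add.assoc)
        qed
        also have "\<dots> \<le> 6 * (1 / (real l + real m + 1))"
          by (simp add: frac_le)
        finally show "(real m + 1) * (\<Sum>x\<in>cube i. ?p l (z + x) * ?p m (z + x)) \<le> 6 * (1 / (real l + real m + 1))" .
      qed
      also have "\<dots> = 6 * (\<Sum>l<i. \<Sum>m<i. 1 / (real l + real m + 1))"
        by (simp add: sum_distrib_left)
      also have "\<dots> \<le> 6 * (4 * real i)"
        by (intro mult_left_mono double_sum_reciprocal_le) auto
      finally have gf: "(\<Sum>x\<in>cube i. g (z + x) * f (z + x)) \<le> 6 * (4 * real i)" .
      have "?E (\<lambda>x. g x * f x) \<le> (\<Sum>x\<in>cube i. 6 / (real i + 1)\<^sup>2 * (g (z + x) * f (z + x)))"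
        by (intro sum_mono mult_right_mono sup mult_nonneg_nonneg f0 g0)
      also have "\<dots> = 6 / (real i + 1)\<^sup>2 * (\<Sum>x\<in>cube i. g (z + x) * f (z + x))"
        by (simp add: sum_distrib_left)
      also have "\<dots> \<le> 6 / (real i + 1)\<^sup>2 * (6 * (4 * real i))"
        by (rule mult_left_mono[OF gf]) simp
      also have "\<dots> = 144 / (real i + 1) * (real i / (real i + 1))"
        by (simp add: power2_eq_square)
      also have "\<dots> \<le> 144 / (real i + 1) * 1"
        by (intro mult_left_mono divide_le_eq_1_pos[THEN iffD2]) auto
      finally show ?thesis by simp
    qed
  qed
  also have "\<dots> = 216 / (real i + 1)"
    by (simp add: add_divide_distrib[symmetric])
  also have "\<dots> \<le> 216 / real i"
    using assms by (intro divide_left_mono) auto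
  finally show ?thesis .
qed

text \<open>The mean of a one-sided Green sum over the times \<open>s + 1\<close> to
  \<open>n\<close> of a walk from the origin.\<close>

definition green_sum :: "nat \<Rightarrow> nat \<Rightarrow> real" where
  "green_sum s n = (\<Sum>k\<in>{s<..n}. green_tail k 0)"

lemma green_sum_nonneg [simp]: "green_sum s n \<ge> 0"
  by (simp add: green_sum_def sum_nonneg)

lemma sum_telescope_shift_le:
  fixes a :: "nat \<Rightarrow> real"
  assumes "decseq a" "\<And>k. a k \<ge> 0"
  shows "(\<Sum>k\<in>{s<..n}. a k - a (k + m)) \<le> real m * a s"
proof (cases "s \<le> n")
  case True
  have "(\<Sum>k\<in>{s<..n}. a k - a (k + m)) + (\<Sum>k\<in>{n<..n + m}. a k) = (\<Sum>k\<in>{s<..s + m}. a k)"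
  proof -
    have shift: "(\<Sum>k\<in>{s<..n}. a (k + m)) = (\<Sum>k\<in>{s + m<..n + m}. a k)"
      by (rule sum.reindex_bij_witness[of _ "\<lambda>k. k - m" "\<lambda>k. k + m"]) auto
    have "sum a {s<..n} + sum a {n<..n + m} = sum a ({s<..n} \<union> {n<..n + m})"
      by (rule sum.union_disjoint[symmetric]) auto
    also have "{s<..n} \<union> {n<..n + m} = {s<..s + m} \<union> {s + m<..n + m}"
      using True by auto
    also have "sum a \<dots> = sum a {s<..s + m} + sum a {s + m<..n + m}"
      by (rule sum.union_disjoint) auto
    finally have "sum a {s<..n} + sum a {n<..n + m} = sum a {s<..s + m} + sum a {s + m<..n + m}" .
    then show ?thesis using shift by (simp add: sum_subtractf)
  qed
  moreover have "(\<Sum>k\<in>{n<..n + m}. a k) \<ge> 0" using assms(2) by (intro sum_nonneg) auto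
  moreover have "(\<Sum>k\<in>{s<..s + m}. a k) \<le> (\<Sum>k\<in>{s<..s + m}. a s)"
    using assms(1) by (intro sum_mono) (auto simp: decseq_def)
  ultimately show ?thesis by simp
next
  case False
  then show ?thesis using assms(2) by simp
qed

lemma decseq_green_tail: "decseq (\<lambda>k. green_tail k x)"
  by (auto simp: decseq_def intro: green_tail_antimono)

text \<open>Adding up \<open>heat_kernel_diff_le\<close> over time bounds the defect of a tail at
  \<open>z\<close> by a difference of two tails at the origin, and the sum over \<open>k\<close>
  telescopes to at most \<open>2 * m\<close> of them. Division by the kernel at \<open>z\<close>
  costs at most \<open>64 ^ m\<close>. The even time \<open>2 * m\<close> forces even parity of
  \<open>z\<close>, so that both kernels vanish at odd times. As the error contains
  \<open>green_tail s 0\<close>, a large \<open>s\<close> beats the exponential factor.\<close>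

lemma sum_green_tail_ge:
  assumes "heat_kernel (2 * m) z \<noteq> 0"
  shows "(\<Sum>k\<in>{s<..n}. green_tail k z) \<ge> green_sum s n - 64 ^ m * (2 * real m) * green_tail s 0"
proof -
  let ?p = "heat_kernel :: nat \<Rightarrow> int ^ 4 \<Rightarrow> real"
  let ?q = "?p (2 * m) z"
  have q: "?q \<ge> 1 / 64 ^ m"
    using heat_kernel_pos_lower[OF assms] by (simp add: card_unit_steps power_mult power_divide)
  have qpos: "?q > 0" using assms heat_kernel_nonneg[of "2 * m" z] by linarith
  have even: "even (\<Sum>i\<in>UNIV. z $ i)" using heat_kernel_parity[OF assms] by simp
  have l: "?q * (?p l 0 - ?p l z) \<le> ?p l 0 - ?p (l + 2 * m) 0" for l
  proof (cases "even l")
    case True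
    then show ?thesis by (rule heat_kernel_diff_le)
  next
    case False
    moreover have "?p l z = 0" using heat_kernel_parity[of l z] even False by auto
    ultimately show ?thesis by (simp add: heat_kernel_odd_zero)
  qed
  have k: "?q * (green_tail k 0 - green_tail k z) \<le> green_tail k 0 - green_tail (k + 2 * m) 0" for k
  proof -
    have "(\<Sum>j. ?q * (?p (j + k) 0 - ?p (j + k) z)) \<le> (\<Sum>j. ?p (j + k) 0 - ?p (j + (k + 2 * m)) 0)"
    proof (intro suminf_le summable_mult summable_diff summable_heat_kernel_4)
      show "?q * (?p (j + k) 0 - ?p (j + k) z) \<le> ?p (j + k) 0 - ?p (j + (k + 2 * m)) 0" for j
        using l[of "j + k"] by (simp only: add.assoc)
    qed
    moreover have "(\<Sum>j. ?q * (?p (j + k) 0 - ?p (j + k) z)) = ?q * (green_tail k 0 - green_tail k z)"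
      by (subst suminf_mult, intro summable_diff summable_heat_kernel_4)
         (simp only: green_tail_def suminf_diff[OF summable_heat_kernel_4 summable_heat_kernel_4])
    moreover have "(\<Sum>j. ?p (j + k) 0 - ?p (j + (k + 2 * m)) 0)
        = green_tail k 0 - green_tail (k + 2 * m) 0"
      by (simp only: green_tail_def suminf_diff[OF summable_heat_kernel_4 summable_heat_kernel_4])
    ultimately show ?thesis by simp
  qed
  have "?q * (green_sum s n - (\<Sum>k\<in>{s<..n}. green_tail k z)) = (\<Sum>k\<in>{s<..n}. ?q * (green_tail k 0 - green_tail k z))"
    by (simp add: green_sum_def sum_subtractf sum_distrib_left right_diff_distrib)
  also have "\<dots> \<le> (\<Sum>k\<in>{s<..n}. green_tail k 0 - green_tail (k + 2 * m) 0)"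
    by (intro sum_mono k)
  also have "\<dots> \<le> real (2 * m) * green_tail s 0"
    by (intro sum_telescope_shift_le decseq_green_tail green_tail_nonneg)
  finally have "green_sum s n - (\<Sum>k\<in>{s<..n}. green_tail k z) \<le> real (2 * m) * green_tail s 0 / ?q"
    using qpos by (simp add: pos_le_divide_eq mult.commute)
  also have "\<dots> \<le> real (2 * m) * green_tail s 0 / (1 / 64 ^ m)"
    using q qpos by (intro divide_left_mono mult_nonneg_nonneg) auto
  finally show ?thesis by (simp add: mult_ac)
qed

lemma sum_off_diagonal_le:
  fixes b :: "nat \<Rightarrow> real"
  assumes "finite A"
  shows "2 * (\<Sum>i\<in>A. \<Sum>k\<in>{k\<in>A. i < k}. b i * b k) \<le> (\<Sum>i\<in>A. b i)\<^sup>2"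
  using assms
proof (induction A rule: finite_linorder_max_induct)
  case (insert m A)
  have m: "m \<notin> A" using insert by auto
  have "(\<Sum>i\<in>insert m A. \<Sum>k\<in>{k\<in>insert m A. i < k}. b i * b k)
      = (\<Sum>i\<in>A. (\<Sum>k\<in>{k\<in>A. i < k}. b i * b k) + b i * b m)"
  proof -
    have "(\<Sum>k\<in>{k\<in>insert m A. m < k}. b m * b k) = 0"
      using insert(2) by (intro sum.neutral) auto
    moreover have "(\<Sum>k\<in>{k\<in>insert m A. i < k}. b i * b k) = (\<Sum>k\<in>{k\<in>A. i < k}. b i * b k) + b i * b m"
      if "i \<in> A" for i
    proof -
      have "{k\<in>insert m A. i < k} = insert m {k\<in>A. i < k}" using insert(2) that by auto
      then show ?thesis using insert m by simp
    qed
    ultimately show ?thesis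
      unfolding sum.insert[OF insert(1) m] by (simp only: add_0_left) (intro sum.cong refl, blast)
  qed
  also have "2 * \<dots> = 2 * (\<Sum>i\<in>A. \<Sum>k\<in>{k\<in>A. i < k}. b i * b k) + 2 * (\<Sum>i\<in>A. b i) * b m"
    unfolding sum.distrib sum_distrib_right[symmetric] by simp
  also have "\<dots> \<le> (\<Sum>i\<in>A. b i)\<^sup>2 + 2 * (\<Sum>i\<in>A. b i) * b m + (b m)\<^sup>2"
    using insert.IH zero_le_power2[of "b m"] by linarith
  finally show ?case using insert m by (simp add: power2_eq_square algebra_simps)
qed simp

text \<open>Pairs whose gap exceeds \<open>i\<close> get the product bound, and twice their sum is
  at most a full square; pairs with a smaller gap get \<open>216 / i\<close> in total. The second
  moment thus exceeds the squared mean by a term of logarithmic order only.\<close>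

lemma sum_green_pair_total_le:
  "2 * (\<Sum>i\<in>{s<..n}. \<Sum>j\<in>{i..n}. green_pair z i (j - i))
     \<le> (green_sum s n + green 0)\<^sup>2 + 432 * (\<Sum>i\<in>{s<..n}. 1 / real i)"
proof -
  \<comment> \<open>The index \<open>i - 1\<close> comes from the parity shift; summed over
    \<open>i\<close>, it adds at most one term, bounded by \<open>green 0\<close>.\<close>
  define b where "b i = green_tail (i - 1) 0" for i
  have gp: "green_pair z i k \<le> b i * b k" for i k
    unfolding b_def by (rule green_pair_le)
  have row: "(\<Sum>j\<in>{i..n}. green_pair z i (j - i)) \<le> 216 / real i + (\<Sum>k\<in>{k\<in>{s<..n}. i < k}. b i * b k)"
    if i: "i \<in> {s<..n}" for i
  proof -
    have "(\<Sum>j\<in>{i..n}. green_pair z i (j - i)) = (\<Sum>k\<in>{..n - i}. green_pair z i k)"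
      by (rule sum.reindex_bij_witness[of _ "\<lambda>k. k + i" "\<lambda>j. j - i"]) (use i in auto)
    also have "\<dots> \<le> (\<Sum>k\<in>{..i} \<union> {i<..n}. green_pair z i k)"
      by (rule sum_mono2) auto
    also have "\<dots> = (\<Sum>k\<in>{..i}. green_pair z i k) + (\<Sum>k\<in>{i<..n}. green_pair z i k)"
      by (rule sum.union_disjoint) auto
    also have "\<dots> \<le> 216 / real i + (\<Sum>k\<in>{i<..n}. b i * b k)"
      using i by (intro add_mono sum_green_pair_le sum_mono gp) auto
    also have "{i<..n} = {k\<in>{s<..n}. i < k}" using i by auto
    finally show ?thesis .
  qed
  have "2 * (\<Sum>i\<in>{s<..n}. \<Sum>j\<in>{i..n}. green_pair z i (j - i))
      \<le> 2 * (\<Sum>i\<in>{s<..n}. 216 / real i + (\<Sum>k\<in>{k\<in>{s<..n}. i < k}. b i * b k))"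
    by (intro mult_left_mono sum_mono row) auto
  also have "\<dots> = 432 * (\<Sum>i\<in>{s<..n}. 1 / real i) + 2 * (\<Sum>i\<in>{s<..n}. \<Sum>k\<in>{k\<in>{s<..n}. i < k}. b i * b k)"
    by (simp add: sum.distrib sum_distrib_left)
  also have "\<dots> \<le> 432 * (\<Sum>i\<in>{s<..n}. 1 / real i) + (\<Sum>i\<in>{s<..n}. b i)\<^sup>2"
    by (intro add_left_mono sum_off_diagonal_le) simp
  also have "(\<Sum>i\<in>{s<..n}. b i)\<^sup>2 \<le> (green_sum s n + green 0)\<^sup>2"
  proof (rule power_mono)
    have "(\<Sum>i\<in>{s<..n}. b i - b (i + 1)) \<le> real 1 * b s"
      by (rule sum_telescope_shift_le) (auto simp: b_def decseq_def intro!: green_tail_antimono)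
    moreover have "(\<Sum>i\<in>{s<..n}. b (i + 1)) = green_sum s n" by (simp add: b_def green_sum_def)
    moreover have "b s \<le> green 0" by (simp add: b_def green_tail_antimono)
    ultimately show "(\<Sum>i\<in>{s<..n}. b i) \<le> green_sum s n + green 0" by (simp add: sum_subtractf)
  qed (auto simp: b_def intro!: sum_nonneg)
  finally show ?thesis by simp
qed

section \<open>Functionals of the increments of a random walk\<close>

text \<open>Invariance under changes that preserve the increments in \<open>I\<close>, in place of a
  generated \<sigma>-algebra. For finite \<open>I\<close> this yields measurability and
  integrability, and disjoint index sets yield independence. The starting point of the path is
  invisible to such functionals.\<close>

definition incr_dep :: "nat set \<Rightarrow> ((nat \<Rightarrow> int ^ 'd::finite) \<Rightarrow> 'b) \<Rightarrow> bool" where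
  "incr_dep I F \<longleftrightarrow> (\<forall>s t. (\<forall>k\<in>I. s (Suc k) - s k = t (Suc k) - t k) \<longrightarrow> F s = F t)"

lemma incr_depD: "incr_dep I F \<Longrightarrow> (\<And>k. k \<in> I \<Longrightarrow> s (Suc k) - s k = t (Suc k) - t k) \<Longrightarrow> F s = F t"
  by (auto simp: incr_dep_def)

lemma incr_dep_mono: "incr_dep I F \<Longrightarrow> I \<subseteq> J \<Longrightarrow> incr_dep J F"
  unfolding incr_dep_def by blast

lemma incr_dep_compose: "incr_dep I F \<Longrightarrow> incr_dep I (\<lambda>s. h (F s))"
  unfolding incr_dep_def by metis

lemma incr_dep_compose2: "incr_dep I F \<Longrightarrow> incr_dep I G \<Longrightarrow> incr_dep I (\<lambda>s. h (F s) (G s))"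
  unfolding incr_dep_def by metis

text \<open>For events whose parameter, a displacement, is itself read off the path.\<close>

lemma incr_dep_bind:
  assumes Z: "incr_dep I Z" and P: "\<And>z. incr_dep I (P z)"
  shows "incr_dep I (\<lambda>s. P (Z s) s)"
  unfolding incr_dep_def
proof (intro allI impI)
  fix s t :: "nat \<Rightarrow> int ^ 'a" assume st: "\<forall>k\<in>I. s (Suc k) - s k = t (Suc k) - t k"
  have "Z s = Z t" by (rule incr_depD[OF Z]) (use st in blast)
  moreover have "P (Z s) s = P (Z s) t" by (rule incr_depD[OF P]) (use st in blast)
  ultimately show "P (Z s) s = P (Z t) t" by simp
qed

lemma incr_dep_conj: "incr_dep I P \<Longrightarrow> incr_dep I Q \<Longrightarrow> incr_dep I (\<lambda>s. P s \<and> Q s)"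
  by (rule incr_dep_compose2)

lemma incr_dep_sum: "(\<And>k. k \<in> A \<Longrightarrow> incr_dep I (F k)) \<Longrightarrow> incr_dep I (\<lambda>s. \<Sum>k\<in>A. F k s)"
  unfolding incr_dep_def by (intro allI impI sum.cong) auto

lemma incr_dep_diff:
  assumes "{a..<b} \<subseteq> I" "a \<le> b"
  shows "incr_dep I (\<lambda>s. s b - s a)"
  unfolding incr_dep_def
proof (intro allI impI)
  fix s t :: "nat \<Rightarrow> int ^ 'a" assume *: "\<forall>k\<in>I. s (Suc k) - s k = t (Suc k) - t k"
  have "s b - s a = (\<Sum>k\<in>{a..<b}. s (Suc k) - s k)"
    using assms(2) by (simp add: sum_Suc_diff')
  also have "\<dots> = (\<Sum>k\<in>{a..<b}. t (Suc k) - t k)"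
    using assms(1) * by (intro sum.cong) auto
  also have "\<dots> = t b - t a"
    using assms(2) by (simp add: sum_Suc_diff')
  finally show "s b - s a = t b - t a" .
qed

lemma incr_dep_diff_eq: "{a..<b} \<subseteq> I \<Longrightarrow> a \<le> b \<Longrightarrow> incr_dep I (\<lambda>s. s b - s a = y)"
  by (rule incr_dep_compose[OF incr_dep_diff])

section \<open>The walk on its probability space\<close>

locale srw =
  fixes M :: "'a measure" and x0 :: "int ^ 'd::finite" and S :: "nat \<Rightarrow> 'a \<Rightarrow> int ^ 'd"
  assumes srw: "simple_random_walk M x0 S"
begin

sublocale prob_space M
  using srw by (simp add: simple_random_walk_def)

definition incr :: "nat \<Rightarrow> 'a \<Rightarrow> int ^ 'd" where
  "incr n \<omega> = S (Suc n) \<omega> - S n \<omega>"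

definition walk :: "'a \<Rightarrow> nat \<Rightarrow> int ^ 'd" where
  "walk \<omega> n = S n \<omega>"

abbreviation mean :: "((nat \<Rightarrow> int ^ 'd) \<Rightarrow> real) \<Rightarrow> real" where
  "mean F \<equiv> expectation (\<lambda>\<omega>. F (walk \<omega>))"

abbreviation walk_prob :: "((nat \<Rightarrow> int ^ 'd) \<Rightarrow> bool) \<Rightarrow> real" where
  "walk_prob P \<equiv> prob {\<omega>\<in>space M. P (walk \<omega>)}"

lemma measurable_S [measurable]: "S n \<in> M \<rightarrow>\<^sub>M count_space UNIV"
  using srw by (simp add: simple_random_walk_def)

lemma indep_incr: "indep_vars (\<lambda>_. count_space UNIV) incr UNIV"
  using srw by (simp add: simple_random_walk_def incr_def[abs_def])

lemma measurable_incr [measurable]: "incr n \<in> M \<rightarrow>\<^sub>M count_space UNIV"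
  using indep_incr by (auto simp: indep_vars_def)

lemma distr_incr: "distr M (count_space UNIV) (incr n) = measure_pmf step_pmf"
  using srw by (simp add: simple_random_walk_def incr_def[abs_def])

lemma prob_incr: "prob {\<omega>\<in>space M. incr n \<omega> = e} = (if e \<in> unit_steps then 1 / real (card (unit_steps :: (int ^ 'd) set)) else 0)"
proof -
  have "prob {\<omega>\<in>space M. incr n \<omega> = e} = measure (distr M (count_space UNIV) (incr n)) {e}"
    by (subst measure_distr) (auto simp: vimage_def Int_def intro!: arg_cong[of _ _ prob])
  also have "\<dots> = pmf step_pmf e" by (simp add: distr_incr pmf.rep_eq)
  finally show ?thesis
    by (simp add: step_pmf_def pmf_of_set[OF unit_steps_nonempty unit_steps_finite] indicator_def)
qed

lemma AE_incr: "AE \<omega> in M. incr n \<omega> \<in> unit_steps"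
proof -
  have "AE x in measure_pmf step_pmf. x \<in> (unit_steps :: (int ^ 'd) set)"
    by (simp add: AE_measure_pmf_iff step_pmf_def unit_steps_nonempty unit_steps_finite)
  then have "AE x in distr M (count_space UNIV) (incr n). x \<in> unit_steps"
    unfolding distr_incr .
  then show ?thesis by (subst (asm) AE_distr_iff) auto
qed

definition incr_path :: "(nat \<Rightarrow> int ^ 'd) \<Rightarrow> nat \<Rightarrow> int ^ 'd" where
  "incr_path d n = (\<Sum>k<n. d k)"

text \<open>Outside \<open>I\<close> the restricted increments are \<open>undefined\<close> and the
  rebuilt path is wrong, but a functional of the increments in \<open>I\<close> cannot see this. It
  thereby factors through the family of these increments.\<close>

lemma incr_path_eq: "incr_dep I F \<Longrightarrow> F (walk \<omega>) = F (incr_path (restrict (\<lambda>n. incr n \<omega>) I))"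
  by (erule incr_depD) (simp add: incr_path_def walk_def incr_def)

text \<open>Finitely many increments with countably many values: the product \<sigma>-algebra is
  discrete, so every function of them is measurable.\<close>

lemma measurable_restrict_incr:
  assumes "finite I"
  shows "(\<lambda>\<omega>. restrict (\<lambda>n. incr n \<omega>) I) \<in> M \<rightarrow>\<^sub>M count_space (PiE I (\<lambda>_. UNIV))"
proof -
  have "(\<lambda>\<omega>. restrict (\<lambda>n. incr n \<omega>) I) \<in> M \<rightarrow>\<^sub>M PiM I (\<lambda>_. count_space UNIV)"
    by (intro measurable_restrict) simp
  then show ?thesis
    using count_space_PiM_finite[OF assms, of "\<lambda>_. UNIV :: (int ^ 'd) set"] countable_int_vec by simp
qed

lemma measurable_incr_dep:
  assumes "finite I" "incr_dep I F"
  shows "(\<lambda>\<omega>. F (walk \<omega>)) \<in> M \<rightarrow>\<^sub>M count_space UNIV"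
  unfolding incr_path_eq[OF assms(2)]
  by (rule measurable_compose[OF measurable_restrict_incr[OF assms(1)]]) simp

lemma borel_measurable_incr_dep:
  fixes F :: "_ \<Rightarrow> real"
  assumes "finite I" "incr_dep I F"
  shows "(\<lambda>\<omega>. F (walk \<omega>)) \<in> borel_measurable M"
  by (rule measurable_compose[OF measurable_incr_dep[OF assms]]) simp

text \<open>Almost surely the finitely many relevant increments are unit steps, so \<open>F\<close>
  is bounded by the sum of its finitely many possible absolute values.\<close>

lemma integrable_incr_dep:
  fixes F :: "_ \<Rightarrow> real"
  assumes I: "finite I" and F: "incr_dep I F"
  shows "integrable M (\<lambda>\<omega>. F (walk \<omega>))"
proof -
  let ?P = "PiE I (\<lambda>_. unit_steps :: (int ^ 'd) set)"
  have fin: "finite ?P" using I by (intro finite_PiE) (auto simp: unit_steps_finite)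
  define B where "B = (\<Sum>d\<in>?P. \<bar>F (incr_path d)\<bar>)"
  have "AE \<omega> in M. \<forall>n\<in>I. incr n \<omega> \<in> unit_steps"
    using I by (intro AE_finite_allI AE_incr)
  then have "AE \<omega> in M. norm (F (walk \<omega>)) \<le> B"
  proof eventually_elim
    case (elim \<omega>)
    then have "restrict (\<lambda>n. incr n \<omega>) I \<in> ?P" by auto
    then show ?case
      unfolding incr_path_eq[OF F] B_def real_norm_def
      using fin by (intro member_le_sum[where f = "\<lambda>d. \<bar>F (incr_path d)\<bar>"]) auto
  qed
  then show ?thesis
    by (rule integrable_const_bound) (rule borel_measurable_incr_dep[OF I F])
qed

lemma indep_incr_dep:
  fixes F G :: "_ \<Rightarrow> real"
  assumes I: "finite I" "incr_dep I F" and J: "finite J" "incr_dep J G" and disj: "I \<inter> J = {}"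
  shows "indep_var borel (\<lambda>\<omega>. F (walk \<omega>)) borel (\<lambda>\<omega>. G (walk \<omega>))"
proof -
  let ?C = "\<lambda>_::nat. count_space UNIV :: (int ^ 'd) measure"
  have *: "indep_var (PiM I ?C) (\<lambda>\<omega>. restrict (\<lambda>n. incr n \<omega>) I) (PiM J ?C) (\<lambda>\<omega>. restrict (\<lambda>n. incr n \<omega>) J)"
    by (rule indep_var_restrict[OF indep_incr disj]) auto
  have eq: "PiM K ?C = count_space (PiE K (\<lambda>_. UNIV))" if "finite K" for K
    using count_space_PiM_finite[OF that, of "\<lambda>_. UNIV :: (int ^ 'd) set"] countable_int_vec by simp
  have "indep_var borel ((\<lambda>d. F (incr_path d)) \<circ> (\<lambda>\<omega>. restrict (\<lambda>n. incr n \<omega>) I))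
      borel ((\<lambda>d. G (incr_path d)) \<circ> (\<lambda>\<omega>. restrict (\<lambda>n. incr n \<omega>) J))"
    by (rule indep_var_compose[OF *]) (simp_all add: eq I(1) J(1))
  then show ?thesis
    by (simp add: o_def incr_path_eq[OF I(2), symmetric] incr_path_eq[OF J(2), symmetric])
qed

lemma expectation_mult_incr_dep:
  fixes F G :: "_ \<Rightarrow> real"
  assumes I: "finite I" "incr_dep I F" and J: "finite J" "incr_dep J G" and disj: "I \<inter> J = {}"
  shows "mean (\<lambda>s. F s * G s) = mean F * mean G"
  by (rule indep_var_lebesgue_integral[OF indep_incr_dep[OF assms]]) (intro integrable_incr_dep[OF I] integrable_incr_dep[OF J])+

lemma events_incr_dep:
  assumes "finite I" "incr_dep I P"
  shows "{\<omega>\<in>space M. P (walk \<omega>)} \<in> events"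
  using measurable_sets[OF measurable_incr_dep[OF assms], of "{True}"]
  by (simp add: vimage_def Int_def conj_commute)

lemma prob_eq_expectation:
  assumes "finite I" "incr_dep I P"
  shows "walk_prob P = mean (\<lambda>s. of_bool (P s))"
proof -
  have "mean (\<lambda>s. of_bool (P s)) = expectation (indicator {\<omega>\<in>space M. P (walk \<omega>)} :: 'a \<Rightarrow> real)"
    by (rule Bochner_Integration.integral_cong) (auto simp: indicator_def)
  then show ?thesis
    using events_incr_dep[OF assms] by simp
qed

lemma prob_conj_incr_dep:
  assumes I: "finite I" "incr_dep I P" and J: "finite J" "incr_dep J Q" and disj: "I \<inter> J = {}"
  shows "walk_prob (\<lambda>s. P s \<and> Q s) = walk_prob P * walk_prob Q"
proof -
  have dep: "incr_dep (I \<union> J) (\<lambda>s. P s \<and> Q s)"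
    by (rule incr_dep_conj[OF incr_dep_mono[OF I(2)] incr_dep_mono[OF J(2)]]) auto
  have "walk_prob (\<lambda>s. P s \<and> Q s) = mean (\<lambda>s. of_bool (P s) * of_bool (Q s))"
    using prob_eq_expectation[OF _ dep] I(1) J(1) by (simp add: of_bool_conj)
  also have "\<dots> = mean (\<lambda>s. of_bool (P s)) * mean (\<lambda>s. of_bool (Q s))"
    by (rule expectation_mult_incr_dep[OF I(1) incr_dep_compose[OF I(2)] J(1) incr_dep_compose[OF J(2)] disj])
  finally show ?thesis
    by (simp add: prob_eq_expectation[OF I] prob_eq_expectation[OF J])
qed

text \<open>The link between the recursively defined kernel and the walk: splitting by the last step
  reproduces the recursion.\<close>

lemma prob_diff: "a \<le> b \<Longrightarrow> walk_prob (\<lambda>s. s b - s a = x) = heat_kernel (b - a) x"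
proof (induction b arbitrary: x rule: dec_induct)
  case base
  then show ?case by (auto simp: prob_space)
next
  case (step b)
  let ?c = "real (card (unit_steps :: (int ^ 'd) set))"
  let ?A = "\<lambda>e. {\<omega>\<in>space M. walk \<omega> b - walk \<omega> a = x - e \<and> walk \<omega> (Suc b) - walk \<omega> b = e}"
  have dep: "incr_dep {a..<b} (\<lambda>s. s b - s a = y)" "incr_dep {b} (\<lambda>s. s (Suc b) - s b = y)" for y :: "int ^ 'd"
    using step by (auto intro: incr_dep_diff_eq)
  have A: "prob (?A e) = heat_kernel (b - a) (x - e) / ?c" if "e \<in> unit_steps" for e
  proof -
    have "prob (?A e) = walk_prob (\<lambda>s. s b - s a = x - e) * walk_prob (\<lambda>s. s (Suc b) - s b = e)"
      by (rule prob_conj_incr_dep[OF _ dep(1) _ dep(2)]) auto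
    also have "walk_prob (\<lambda>s. s (Suc b) - s b = e) = 1 / ?c"
      using prob_incr[of b e] that by (simp add: walk_def incr_def)
    finally show ?thesis by (simp add: step.IH)
  qed
  have ev: "?A e \<in> events" for e
    by (rule events_incr_dep[OF _ incr_dep_conj[OF incr_dep_mono[OF dep(1)] incr_dep_mono[OF dep(2)]]], rule finite_UnI[of "{a..<b}" "{b}"]) auto
  have "walk_prob (\<lambda>s. s (Suc b) - s a = x) = prob (\<Union>e\<in>unit_steps. ?A e)"
  proof (rule finite_measure_eq_AE)
    show "AE \<omega> in M. (\<omega> \<in> {\<omega>\<in>space M. walk \<omega> (Suc b) - walk \<omega> a = x}) = (\<omega> \<in> (\<Union>e\<in>unit_steps. ?A e))"
      using AE_incr[of b] AE_space
    proof eventually_elim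
      case (elim \<omega>)
      have "walk \<omega> (Suc b) - walk \<omega> a = x \<longleftrightarrow> walk \<omega> b - walk \<omega> a = x - (walk \<omega> (Suc b) - walk \<omega> b)"
        by (auto simp: algebra_simps)
      moreover have "walk \<omega> (Suc b) - walk \<omega> b \<in> unit_steps"
        using elim(1) by (simp add: walk_def incr_def)
      ultimately show ?case
        using elim(2) by blast
    qed
    show "{\<omega>\<in>space M. walk \<omega> (Suc b) - walk \<omega> a = x} \<in> events"
      by (rule events_incr_dep[of "{a..<Suc b}"]) (use step in \<open>auto intro: incr_dep_diff_eq\<close>)
    show "(\<Union>e\<in>unit_steps. ?A e) \<in> events"
      by (intro sets.finite_UN unit_steps_finite ev)
  qed
  also have "\<dots> = (\<Sum>e\<in>unit_steps. prob (?A e))"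
  proof (rule finite_measure_finite_Union)
    show "?A ` unit_steps \<subseteq> events" using ev by blast
    show "disjoint_family_on ?A unit_steps" by (auto simp: disjoint_family_on_def)
  qed (rule unit_steps_finite)
  also have "\<dots> = heat_kernel (Suc b - a) x"
    using step by (simp add: A Suc_diff_le heat_kernel_Suc sum_divide_distrib)
  finally show ?case .
qed

end

section \<open>Escape probabilities and capacity\<close>

lemma return_time_infinity: "return_time A \<omega> = \<infinity> \<longleftrightarrow> (\<forall>m\<ge>1. \<omega> m \<notin> A)"
  unfolding return_time_def top_enat_def[symmetric] Inf_top_conv by (auto simp: top_enat_def)

definition escape :: "(int ^ 'd::finite) set \<Rightarrow> int ^ 'd \<Rightarrow> real" where
  "escape A x = measure (srw_law x) {\<omega>\<in>space (srw_law x). \<forall>m\<ge>1. \<omega> m \<notin> A}"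

lemma capacity_escape: "capacity A = (\<Sum>x\<in>A. escape A x)"
  by (simp add: capacity_def escape_def return_time_infinity)

lemma space_srw_law [simp]: "space (srw_law x) = UNIV"
  by (simp add: srw_law_def space_PiM)

lemma sets_srw_law: "sets (srw_law x) = sets (\<Pi>\<^sub>M n\<in>(UNIV :: nat set). count_space (UNIV :: (int ^ 'd::finite) set))"
  by (simp add: srw_law_def)

lemma sets_no_visit:
  "{\<omega>. \<forall>m\<ge>1. \<omega> m \<notin> A} \<in> sets (\<Pi>\<^sub>M n\<in>(UNIV :: nat set). count_space (UNIV :: 'b set))"
proof -
  let ?C = "\<Pi>\<^sub>M n\<in>(UNIV :: nat set). count_space (UNIV :: 'b set)"
  have "(\<lambda>\<omega>. \<omega> m) -` (- A) \<inter> space ?C \<in> sets ?C" for m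
    by (rule measurable_sets[of _ _ "count_space UNIV"]) auto
  then have "(\<Inter>m\<in>{1..}. (\<lambda>\<omega>. \<omega> m) -` (- A) \<inter> space ?C) \<in> sets ?C"
    by (intro sets.countable_INT) auto
  also have "(\<Inter>m\<in>{1..}. (\<lambda>\<omega>. \<omega> m) -` (- A) \<inter> space ?C) = {\<omega>. \<forall>m\<ge>1. \<omega> m \<notin> A}"
    by (auto simp: space_PiM)
  finally show ?thesis .
qed

lemma escape_altdef: "escape A x = measure (srw_law x) {\<omega>. \<forall>m\<ge>1. \<omega> m \<notin> A}"
  by (simp add: escape_def)

lemma srw_srw_law: "srw (srw_law x) x (\<lambda>n \<omega>. \<omega> n)"
  by (simp add: srw_def simple_random_walk_srw_law)

lemma prob_space_srw_law: "prob_space (srw_law x)"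
  using simple_random_walk_srw_law[of x] by (simp add: simple_random_walk_def)

lemma escape_nonneg [simp]: "escape A x \<ge> 0"
  by (simp add: escape_def)

lemma escape_le_1: "escape A x \<le> 1"
  unfolding escape_def by (rule prob_space.prob_le_1[OF prob_space_srw_law])

lemma escape_antimono:
  assumes "A \<subseteq> B"
  shows "escape B x \<le> escape A x"
proof -
  interpret prob_space "srw_law x" by (rule prob_space_srw_law)
  show ?thesis
    unfolding escape_altdef
    by (rule finite_measure_mono) (use assms in \<open>auto simp: sets_srw_law sets_no_visit[simplified]\<close>)
qed

context srw
begin

text \<open>The later increments form a walk again, started at any chosen point \<open>y\<close>.
  The given probability space thus supplies both the past of the walk and the fresh walk in the
  definition of the capacity.\<close>

lemma restart: "simple_random_walk M y (\<lambda>k \<omega>. y + (walk \<omega> (n + k) - walk \<omega> n))"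
  unfolding simple_random_walk_def
proof (intro conjI allI)
  fix k
  have "incr_dep {n..<n + k} (\<lambda>s. y + (s (n + k) - s n))"
    by (rule incr_dep_compose[OF incr_dep_diff]) auto
  then show "(\<lambda>\<omega>. y + (walk \<omega> (n + k) - walk \<omega> n)) \<in> M \<rightarrow>\<^sub>M count_space UNIV"
    using measurable_incr_dep[of "{n..<n + k}" "\<lambda>s. y + (s (n + k) - s n)"] by simp
next
  have eq: "(\<lambda>\<omega>. y + (walk \<omega> (n + Suc k) - walk \<omega> n) - (y + (walk \<omega> (n + k) - walk \<omega> n))) = incr (n + k)" for k
    by (auto simp: walk_def incr_def)
  show "distr M (count_space UNIV) (\<lambda>\<omega>. y + (walk \<omega> (n + Suc k) - walk \<omega> n) - (y + (walk \<omega> (n + k) - walk \<omega> n)))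
      = measure_pmf step_pmf" for k
    unfolding eq by (rule distr_incr)
  let ?F = "\<lambda>k. {incr k -` A \<inter> space M |A. A \<in> sets (count_space UNIV)}"
  have ind: "indep_sets ?F UNIV"
    using indep_incr unfolding indep_vars_def2 by blast
  have "indep_sets (\<lambda>k. ?F (n + k)) UNIV"
  proof (rule indep_setsI)
    show "?F (n + k) \<subseteq> events" for k
      using ind unfolding indep_sets_def by blast
  next
    fix A and J :: "nat set" assume J: "J \<noteq> {}" "finite J" "\<forall>j\<in>J. A j \<in> ?F (n + j)"
    have "prob (\<Inter>j\<in>(\<lambda>k. n + k) ` J. A (j - n)) = (\<Prod>j\<in>(\<lambda>k. n + k) ` J. prob (A (j - n)))"
      by (rule indep_setsD[OF ind]) (use J in auto)
    also have "\<dots> = (\<Prod>j\<in>J. prob (A j))"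
      by (subst prod.reindex) auto
    finally show "prob (\<Inter>j\<in>J. A j) = (\<Prod>j\<in>J. prob (A j))"
      by simp
  qed
  then have "indep_vars (\<lambda>_. count_space UNIV) (\<lambda>k. incr (n + k)) UNIV"
    unfolding indep_vars_def2 using measurable_incr by blast
  then show "indep_vars (\<lambda>_. count_space UNIV) (\<lambda>k \<omega>. y + (walk \<omega> (n + Suc k) - walk \<omega> n) - (y + (walk \<omega> (n + k) - walk \<omega> n))) UNIV"
    unfolding eq .
qed (auto intro: prob_space_axioms)

lemma escape_eq_future: "escape A y = walk_prob (\<lambda>s. \<forall>k\<ge>1. y + (s (n + k) - s n) \<notin> A)"
proof -
  let ?C = "\<Pi>\<^sub>M n\<in>(UNIV :: nat set). count_space (UNIV :: (int ^ 'd) set)"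
  let ?f = "\<lambda>\<omega> k. y + (walk \<omega> (n + k) - walk \<omega> n)"
  have f: "?f \<in> M \<rightarrow>\<^sub>M ?C"
    using restart[of y n] by (intro measurable_PiM_single') (auto simp: simple_random_walk_def)
  have "escape A y = measure (distr M ?C ?f) {\<omega>. \<forall>m\<ge>1. \<omega> m \<notin> A}"
    by (simp add: escape_def simple_random_walk_law[OF restart])
  also have "\<dots> = prob (?f -` {\<omega>. \<forall>m\<ge>1. \<omega> m \<notin> A} \<inter> space M)"
    by (rule measure_distr[OF f]) (use sets_no_visit[of A] in simp)
  finally show ?thesis
    by (simp add: vimage_def Int_def conj_commute)
qed

text \<open>Escape involves infinitely many increments, out of reach of finite index sets. Escape up
  to step \<open>K\<close> is independent of the past, and continuity along decreasing events gives
  the limit.\<close>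

lemma prob_past_escape:
  assumes P: "incr_dep {..<n} P"
  shows "walk_prob (\<lambda>s. P s \<and> (\<forall>k\<ge>1. y + (s (n + k) - s n) \<notin> A))
    = walk_prob P * escape A y"
proof -
  let ?Q = "\<lambda>K s. \<forall>k\<in>{1..K}. y + (s (n + k) - s n) \<notin> A"
  let ?B = "\<lambda>K. {\<omega>\<in>space M. ?Q K (walk \<omega>)}"
  let ?PB = "\<lambda>K. {\<omega>\<in>space M. P (walk \<omega>) \<and> ?Q K (walk \<omega>)}"
  have Q: "incr_dep {n..<n + K} (?Q K)" for K
  proof -
    have dep: "incr_dep {n..<n + K} (\<lambda>s. s (n + k) - s n)" if "k \<in> {1..K}" for k
      using that by (intro incr_dep_diff) auto
    show ?thesis
      unfolding incr_dep_def
    proof (intro allI impI ball_cong refl)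
      fix s t :: "nat \<Rightarrow> int ^ 'd" and k
      assume st: "\<forall>j\<in>{n..<n + K}. s (Suc j) - s j = t (Suc j) - t j" and k: "k \<in> {1..K}"
      have "s (n + k) - s n = t (n + k) - t n"
        by (rule incr_depD[OF dep[OF k]]) (use st in blast)
      then show "(y + (s (n + k) - s n) \<notin> A) = (y + (t (n + k) - t n) \<notin> A)" by simp
    qed
  qed
  have ev: "?B K \<in> events" for K
    by (rule events_incr_dep[OF _ Q]) simp
  have ev': "?PB K \<in> events" for K
    by (rule events_incr_dep[of "{..<n} \<union> {n..<n + K}" "\<lambda>s. P s \<and> ?Q K s"], simp)
       (rule incr_dep_conj[OF incr_dep_mono[OF P] incr_dep_mono[OF Q]]; auto)
  have mult: "prob (?PB K) = walk_prob P * prob (?B K)" for K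
    by (rule prob_conj_incr_dep[OF _ P _ Q]) auto
  have "(\<lambda>K. prob (?B K)) \<longlonglongrightarrow> prob (\<Inter>K. ?B K)"
    by (rule finite_Lim_measure_decseq) (use ev in \<open>auto simp: decseq_def\<close>)
  moreover have "(\<Inter>K. ?B K) = {\<omega>\<in>space M. \<forall>k\<ge>1. y + (walk \<omega> (n + k) - walk \<omega> n) \<notin> A}"
    by fastforce
  ultimately have "(\<lambda>K. prob (?B K)) \<longlonglongrightarrow> escape A y"
    by (simp add: escape_eq_future[of A y n])
  then have "(\<lambda>K. prob (?PB K)) \<longlonglongrightarrow> walk_prob P * escape A y"
    unfolding mult by (intro tendsto_intros)
  moreover have "(\<lambda>K. prob (?PB K)) \<longlonglongrightarrow> prob (\<Inter>K. ?PB K)"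
    by (rule finite_Lim_measure_decseq) (use ev' in \<open>auto simp: decseq_def\<close>)
  moreover have "(\<Inter>K. ?PB K) = {\<omega>\<in>space M. P (walk \<omega>) \<and> (\<forall>k\<ge>1. y + (walk \<omega> (n + k) - walk \<omega> n) \<notin> A)}"
    by fastforce
  ultimately show ?thesis
    by (simp add: LIMSEQ_unique)
qed

lemma AE_start: "AE \<omega> in M. S 0 \<omega> = x0"
  using srw by (simp add: simple_random_walk_def)

lemma events_last_visit: "{\<omega>\<in>space M. S n \<omega> \<in> B \<and> (\<forall>k\<ge>1. S (n + k) \<omega> \<notin> A)} \<in> events"
proof -
  have [measurable]: "Measurable.pred M (\<lambda>\<omega>. S j \<omega> \<in> C)" for j C
    by (rule measurable_compose[OF measurable_S]) simp
  show ?thesis by measurable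
qed

lemma prob_last_visit:
  "prob {\<omega>\<in>space M. S n \<omega> = x \<and> (\<forall>k\<ge>1. S (n + k) \<omega> \<notin> A)} = heat_kernel n (x - x0) * escape A x"
proof -
  have "prob {\<omega>\<in>space M. S n \<omega> = x \<and> (\<forall>k\<ge>1. S (n + k) \<omega> \<notin> A)}
      = walk_prob (\<lambda>s. s n - s 0 = x - x0 \<and> (\<forall>k\<ge>1. x + (s (n + k) - s n) \<notin> A))"
  proof (rule finite_measure_eq_AE)
    show "AE \<omega> in M. (\<omega> \<in> {\<omega>\<in>space M. S n \<omega> = x \<and> (\<forall>k\<ge>1. S (n + k) \<omega> \<notin> A)})
      = (\<omega> \<in> {\<omega>\<in>space M. walk \<omega> n - walk \<omega> 0 = x - x0 \<and> (\<forall>k\<ge>1. x + (walk \<omega> (n + k) - walk \<omega> n) \<notin> A)})"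
      using AE_start
    proof eventually_elim
      case (elim \<omega>)
      have "walk \<omega> n - walk \<omega> 0 = x - x0 \<longleftrightarrow> S n \<omega> = x"
        by (simp add: walk_def elim)
      then show ?case by (auto simp: walk_def)
    qed
    show "{\<omega>\<in>space M. S n \<omega> = x \<and> (\<forall>k\<ge>1. S (n + k) \<omega> \<notin> A)} \<in> events"
      using events_last_visit[of n "{x}" A] by simp
    have [measurable]: "Measurable.pred M (\<lambda>\<omega>. x + (walk \<omega> (n + k) - walk \<omega> n) \<notin> A)" for k
    proof -
      have "incr_dep {n..<n + k} (\<lambda>s. x + (s (n + k) - s n) \<notin> A)"
        by (rule incr_dep_compose[OF incr_dep_diff]) auto
      from measurable_incr_dep[OF _ this] show ?thesis by simp
    qed
    have [measurable]: "Measurable.pred M (\<lambda>\<omega>. walk \<omega> n - walk \<omega> 0 = x - x0)"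
    proof -
      have "incr_dep {0..<n} (\<lambda>s. s n - s 0 = x - x0)"
        by (rule incr_dep_diff_eq) auto
      from measurable_incr_dep[OF _ this] show ?thesis by simp
    qed
    show "{\<omega>\<in>space M. walk \<omega> n - walk \<omega> 0 = x - x0 \<and> (\<forall>k\<ge>1. x + (walk \<omega> (n + k) - walk \<omega> n) \<notin> A)} \<in> events"
      by measurable
  qed
  also have "\<dots> = walk_prob (\<lambda>s. s n - s 0 = x - x0) * escape A x"
    by (rule prob_past_escape) (rule incr_dep_diff_eq, auto)
  finally show ?thesis using prob_diff[of 0 n "x - x0"] by simp
qed

lemma prob_hit: "finite A \<Longrightarrow> prob {\<omega>\<in>space M. S n \<omega> \<in> A} = (\<Sum>x\<in>A. heat_kernel n (x - x0))"
proof -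
  assume A: "finite A"
  \<comment> \<open>The empty set is never hit, so for it the last-visit formula reduces to the law
    of the position.\<close>
  have "escape {} x = 1" for x :: "int ^ 'd"
    using prob_space.prob_space[OF prob_space_srw_law[of x]] by (simp add: escape_def)
  then have 1: "prob {\<omega>\<in>space M. S n \<omega> = x} = heat_kernel n (x - x0)" for x
    using prob_last_visit[of n x "{}"] by simp
  have "prob {\<omega>\<in>space M. S n \<omega> \<in> A} = prob (\<Union>x\<in>A. {\<omega>\<in>space M. S n \<omega> = x})"
    by (intro arg_cong[of _ _ prob]) auto
  also have "\<dots> = (\<Sum>x\<in>A. prob {\<omega>\<in>space M. S n \<omega> = x})"
  proof (rule finite_measure_finite_Union[OF A])
    show "(\<lambda>x. {\<omega>\<in>space M. S n \<omega> = x}) ` A \<subseteq> events"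
      using events_last_visit[of n "{_}" "{}"] by auto
    show "disjoint_family_on (\<lambda>x. {\<omega>\<in>space M. S n \<omega> = x}) A"
      by (auto simp: disjoint_family_on_def)
  qed
  finally show ?thesis by (simp add: 1)
qed

lemma prob_last_visit_set:
  "finite A \<Longrightarrow> prob {\<omega>\<in>space M. S n \<omega> \<in> A \<and> (\<forall>k\<ge>1. S (n + k) \<omega> \<notin> A)} = (\<Sum>x\<in>A. heat_kernel n (x - x0) * escape A x)"
proof -
  assume A: "finite A"
  let ?E = "\<lambda>x. {\<omega>\<in>space M. S n \<omega> = x \<and> (\<forall>k\<ge>1. S (n + k) \<omega> \<notin> A)}"
  have "prob {\<omega>\<in>space M. S n \<omega> \<in> A \<and> (\<forall>k\<ge>1. S (n + k) \<omega> \<notin> A)} = prob (\<Union>x\<in>A. ?E x)"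
    by (intro arg_cong[of _ _ prob]) auto
  also have "\<dots> = (\<Sum>x\<in>A. prob (?E x))"
  proof (rule finite_measure_finite_Union[OF A])
    show "?E ` A \<subseteq> events"
      using events_last_visit[of n "{_}" A] by auto
    show "disjoint_family_on ?E A"
      by (auto simp: disjoint_family_on_def)
  qed
  finally show ?thesis unfolding prob_last_visit .
qed

end

lemma escape_translate: "escape ((\<lambda>x. c + x) ` A) (c + x) = escape A x"
proof -
  interpret srw "srw_law 0" 0 "\<lambda>n \<omega>. \<omega> n :: int ^ 'a" by (rule srw_srw_law)
  have "c + x + z \<in> (\<lambda>x. c + x) ` A \<longleftrightarrow> x + z \<in> A" for z
    by (auto simp: add.assoc image_iff)
  then show ?thesis
    unfolding escape_eq_future[of _ _ 0] by simp
qed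

text \<open>Last-exit decomposition: the events of a last visit to \<open>A\<close> at time
  \<open>n\<close> are disjoint, and their probabilities add up to the potential at
  \<open>y\<close>. A walk from a point of \<open>A\<close> does visit \<open>A\<close>, and by
  Borel--Cantelli and the finite Green function only finitely often, so a last visit exists almost
  surely.\<close>

lemma
  fixes A :: "(int ^ 4) set"
  assumes A: "finite A"
  shows equilibrium_potential_le: "(\<Sum>x\<in>A. green (x - y) * escape A x) \<le> 1"
    and equilibrium_potential_eq: "y \<in> A \<Longrightarrow> (\<Sum>x\<in>A. green (x - y) * escape A x) = 1"
proof -
  interpret srw "srw_law y" y "\<lambda>n \<omega>. \<omega> n" by (rule srw_srw_law)
  let ?F = "\<lambda>n. {\<omega>\<in>space (srw_law y). \<omega> n \<in> A \<and> (\<forall>k\<ge>1. \<omega> (n + k) \<notin> A)}"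
  have F: "?F n \<in> events" for n by (rule events_last_visit)
  have "disjoint_family ?F"
  proof (unfold disjoint_family_on_def, intro ballI impI)
    have *: "?F m \<inter> ?F n = {}" if "m < n" for m n
    proof -
      have "n = m + (n - m)" "n - m \<ge> 1" using that by auto
      then show ?thesis by fastforce
    qed
    fix m n :: nat assume "m \<noteq> n"
    then show "?F m \<inter> ?F n = {}" using *[of m n] *[of n m] by (cases "m < n") auto
  qed
  then have 1: "(\<lambda>n. prob (?F n)) sums prob (\<Union>n. ?F n)"
    using F by (intro finite_measure_UNION) auto
  have hk: "(\<lambda>n. heat_kernel n (x - y)) sums green (x - y)" for x
    using summable_sums[OF summable_heat_kernel_4[of 0 "x - y"]] by (simp add: green_tail_def)
  have "(\<lambda>n. \<Sum>x\<in>A. heat_kernel n (x - y) * escape A x) sums (\<Sum>x\<in>A. green (x - y) * escape A x)"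
    by (intro sums_sum sums_mult2 hk)
  with 1 have eq: "(\<Sum>x\<in>A. green (x - y) * escape A x) = prob (\<Union>n. ?F n)"
    unfolding prob_last_visit_set[OF A] by (rule sums_unique2[symmetric])
  then show "(\<Sum>x\<in>A. green (x - y) * escape A x) \<le> 1" by simp
  show "(\<Sum>x\<in>A. green (x - y) * escape A x) = 1" if y: "y \<in> A"
  proof -
    let ?V = "\<lambda>n. {\<omega>\<in>space (srw_law y). \<omega> n \<in> A}"
    have "summable (\<lambda>n. prob (?V n))"
      unfolding prob_hit[OF A] by (intro summable_sum sums_summable[OF hk])
    moreover have "?V n \<in> events" for n
      using events_last_visit[of n A "{}"] by simp
    ultimately have "AE \<omega> in srw_law y. \<forall>\<^sub>F n in sequentially. \<omega> \<in> space (srw_law y) - ?V n"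
      by (intro borel_cantelli_AE1) (auto simp: emeasure_eq_measure)
    with AE_start have "AE \<omega> in srw_law y. \<omega> \<in> (\<Union>n. ?F n)"
    proof eventually_elim
      case (elim \<omega>)
      then obtain N where N: "\<And>n. n \<ge> N \<Longrightarrow> \<omega> n \<notin> A"
        by (auto simp: eventually_sequentially)
      let ?T = "{n. \<omega> n \<in> A}"
      have "?T \<subseteq> {..<N}" using N by (auto simp: not_le[symmetric])
      then have fin: "finite ?T" by (rule finite_subset) simp
      moreover have "0 \<in> ?T" using elim y by simp
      ultimately have "Max ?T \<in> ?T" by (intro Max_in) auto
      moreover have "\<omega> (Max ?T + k) \<notin> A" if "k \<ge> 1" for k
        using Max_ge[OF fin, of "Max ?T + k"] that by auto
      ultimately show ?case by auto
    qed
    moreover have "(\<Union>n. ?F n) \<in> events" using F by auto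
    ultimately have "prob (\<Union>n. ?F n) = 1"
      by (subst prob_eq_1) auto
    with eq show ?thesis by simp
  qed
qed

lemma capacity_nonneg: "capacity A \<ge> 0"
  by (simp add: capacity_escape sum_nonneg)

text \<open>The potential of \<open>B\<close>, equal to 1 on \<open>A\<close>, is inserted into the
  capacity of \<open>A\<close>; after exchanging the sums by the symmetry of \<open>green\<close>,
  the potential of \<open>A\<close> appears, which is at most 1.\<close>

lemma capacity_mono:
  fixes A B :: "(int ^ 4) set"
  assumes B: "finite B" and AB: "A \<subseteq> B"
  shows "capacity A \<le> capacity B"
proof -
  have A: "finite A" using AB B by (rule finite_subset)
  have "capacity A = (\<Sum>x\<in>A. escape A x * (\<Sum>y\<in>B. green (y - x) * escape B y))"
    unfolding capacity_escape using AB by (intro sum.cong) (auto simp: equilibrium_potential_eq[OF B])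
  also have "\<dots> = (\<Sum>x\<in>A. \<Sum>y\<in>B. escape B y * (green (x - y) * escape A x))"
    by (simp add: sum_distrib_left green_minus_commute mult_ac)
  also have "\<dots> = (\<Sum>y\<in>B. escape B y * (\<Sum>x\<in>A. green (x - y) * escape A x))"
    unfolding sum_distrib_left by (rule sum.swap)
  also have "\<dots> \<le> (\<Sum>y\<in>B. escape B y * 1)"
    by (intro sum_mono mult_left_mono equilibrium_potential_le A) auto
  finally show ?thesis by (simp add: capacity_escape)
qed

section \<open>Capacity expressed through the times of the walk\<close>

lemma card_eq_sum_green_escape:
  fixes s :: "nat \<Rightarrow> int ^ 4"
  assumes "finite A" "s ` J \<subseteq> A"
  shows "real (card J) = (\<Sum>y\<in>A. escape A y * (\<Sum>j\<in>J. green (y - s j)))"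
proof -
  have "real (card J) = (\<Sum>j\<in>J. \<Sum>y\<in>A. green (y - s j) * escape A y)"
    using assms by (simp add: equilibrium_potential_eq[OF assms(1)] image_subset_iff)
  also have "\<dots> = (\<Sum>y\<in>A. \<Sum>j\<in>J. green (y - s j) * escape A y)"
    by (rule sum.swap)
  finally show ?thesis by (simp add: sum_distrib_left mult.commute)
qed

text \<open>Each point is charged to its last visiting time. Multiplicities of visits thereby turn
  into a condition on the future of the walk, which can be localised to a window.\<close>

lemma sum_image_last_visits:
  fixes f :: "'b \<Rightarrow> real" and I :: "nat set"
  assumes "finite I"
  shows "(\<Sum>x\<in>s ` I. f x) = (\<Sum>i\<in>I. if s i \<notin> s ` {j\<in>I. i < j} then f (s i) else 0)"
proof -
  let ?L = "{i\<in>I. s i \<notin> s ` {j\<in>I. i < j}}"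
  have inj: "inj_on s ?L"
  proof (rule inj_onI)
    fix i j assume "i \<in> ?L" "j \<in> ?L" "s i = s j"
    then show "i = j" by (cases i j rule: linorder_cases) (auto simp: image_iff)
  qed
  have "s ` I = s ` ?L"
  proof
    show "s ` I \<subseteq> s ` ?L"
    proof
      fix x assume "x \<in> s ` I"
      let ?T = "{i\<in>I. s i = x}"
      have fin: "finite ?T" and "?T \<noteq> {}" using assms \<open>x \<in> s ` I\<close> by auto
      then have "Max ?T \<in> ?T" by (rule Max_in)
      moreover have "s (Max ?T) \<notin> s ` {j\<in>I. Max ?T < j}"
      proof
        assume "s (Max ?T) \<in> s ` {j\<in>I. Max ?T < j}"
        then obtain j where "j \<in> I" "Max ?T < j" "s j = s (Max ?T)" by auto
        with \<open>Max ?T \<in> ?T\<close> Max_ge[OF fin, of j] show False by auto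
      qed
      ultimately show "x \<in> s ` ?L"
        by (intro image_eqI[of x s "Max ?T"]) auto
    qed
  qed auto
  then have "(\<Sum>x\<in>s ` I. f x) = (\<Sum>i\<in>?L. f (s i))"
    by (simp add: sum.reindex[OF inj])
  also have "\<dots> = (\<Sum>i\<in>I. if s i \<notin> s ` {j\<in>I. i < j} then f (s i) else 0)"
    using assms by (rule sum.inter_filter)
  finally show ?thesis .
qed

text \<open>Where the Green sum is at least \<open>c\<close>, the term \<open>c\<close> times the
  escape probability is paid for by the pairing with the occupation measure. The remaining points
  keep their escape probability as a weight instead of being merely counted.\<close>

lemma capacity_image_le:
  fixes s :: "nat \<Rightarrow> int ^ 4"
  assumes I: "finite I" and c: "c > 0"
  shows "c * capacity (s ` I) \<le> real (card I)
    + c * (\<Sum>i\<in>I. if (\<Sum>j\<in>I. green (s i - s j)) < c \<and> s i \<notin> s ` {j\<in>I. i < j} then escape (s ` I) (s i) else 0)"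
proof -
  let ?A = "s ` I" and ?V = "\<lambda>y. \<Sum>j\<in>I. green (y - s j)"
  have "c * capacity ?A = (\<Sum>y\<in>?A. escape ?A y * c)"
    by (simp add: capacity_escape sum_distrib_left mult.commute)
  also have "\<dots> \<le> (\<Sum>y\<in>?A. escape ?A y * ?V y + c * (if ?V y < c then escape ?A y else 0))"
  proof (rule sum_mono)
    fix y
    have "?V y \<ge> 0" by (simp add: sum_nonneg)
    then show "escape ?A y * c \<le> escape ?A y * ?V y + c * (if ?V y < c then escape ?A y else 0)"
      using c by (auto simp: mult.commute[of c] intro: mult_left_mono)
  qed
  also have "\<dots> = real (card I) + c * (\<Sum>y\<in>?A. if ?V y < c then escape ?A y else 0)"
    unfolding sum.distrib using card_eq_sum_green_escape[of ?A s I] I by (simp add: sum_distrib_left)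
  also have "(\<Sum>y\<in>?A. if ?V y < c then escape ?A y else 0)
      = (\<Sum>i\<in>I. if ?V (s i) < c \<and> s i \<notin> s ` {j\<in>I. i < j} then escape ?A (s i) else 0)"
    unfolding sum_image_last_visits[OF I] by (intro sum.cong refl) auto
  finally show ?thesis .
qed

text \<open>The equilibrium measure of the image of \<open>J\<close> is paired with the occupation
  measure of \<open>J\<close> itself, because the Green sum is controlled only there; monotonicity
  of the capacity then passes to \<open>I\<close>.\<close>

lemma capacity_image_ge:
  fixes s :: "nat \<Rightarrow> int ^ 4"
  assumes I: "finite I" "J \<subseteq> I" and V: "\<And>i. i \<in> J \<Longrightarrow> (\<Sum>j\<in>J. green (s i - s j)) \<le> c" and c: "c \<ge> 0"
  shows "real (card J) \<le> c * capacity (s ` I)"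
proof -
  have J: "finite J" using I finite_subset by blast
  have "real (card J) = (\<Sum>y\<in>s ` J. escape (s ` J) y * (\<Sum>j\<in>J. green (y - s j)))"
    using J by (intro card_eq_sum_green_escape) auto
  also have "\<dots> \<le> (\<Sum>y\<in>s ` J. escape (s ` J) y * c)"
    using V by (intro sum_mono mult_left_mono) auto
  also have "\<dots> = c * capacity (s ` J)"
    by (simp add: capacity_escape sum_distrib_left mult.commute)
  also have "\<dots> \<le> c * capacity (s ` I)"
    using I c by (intro mult_left_mono capacity_mono) auto
  finally show ?thesis .
qed

text \<open>A functional of the window \<open>[i - m, i + m]\<close> alone that dominates the contribution of the last visit to \<open>s i\<close>
  to the capacity of any range containing the window. For \<open>i < m\<close> the truncated subtraction just cuts the window
  at time 0.\<close>

definition no_return :: "nat \<Rightarrow> nat \<Rightarrow> (nat \<Rightarrow> int ^ 'd::finite) \<Rightarrow> real" where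
  "no_return m i s = (if s i \<notin> s ` {i<..i + m} then escape (s ` {i - m..i + m}) (s i) else 0)"

lemma no_return_nonneg [simp]: "no_return m i s \<ge> 0"
  by (simp add: no_return_def)

lemma no_return_le_1: "no_return m i s \<le> 1"
  by (simp add: no_return_def escape_le_1)

text \<open>Two paths with the same increments in the window differ there by a translation, under
  which escape probabilities are invariant.\<close>

lemma incr_dep_no_return: "incr_dep {i - m..<i + m} (no_return m i)"
  unfolding incr_dep_def
proof (intro allI impI)
  fix s t :: "nat \<Rightarrow> int ^ 'a"
  assume st: "\<forall>k\<in>{i - m..<i + m}. s (Suc k) - s k = t (Suc k) - t k"
  define c where "c = t (i - m) - s (i - m)"
  have t: "t j = c + s j" if j: "j \<in> {i - m..i + m}" for j
  proof -
    have "s j - s (i - m) = t j - t (i - m)"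
      by (rule incr_depD[OF incr_dep_diff[of "i - m" j "{i - m..<i + m}"]]) (use j st in auto)
    then show ?thesis by (simp add: c_def algebra_simps)
  qed
  have im: "t ` W = (\<lambda>x. c + x) ` s ` W" if "W \<subseteq> {i - m..i + m}" for W
    unfolding image_image using that by (intro image_cong) (auto simp: t)
  have im1: "t ` {i - m..i + m} = (\<lambda>x. c + x) ` s ` {i - m..i + m}" by (rule im) simp
  have im2: "t ` {i<..i + m} = (\<lambda>x. c + x) ` s ` {i<..i + m}" by (rule im) auto
  have ti: "t i = c + s i" by (intro t) auto
  show "no_return m i s = no_return m i t"
    unfolding no_return_def im1 im2 ti escape_translate by (auto simp: image_iff)
qed

text \<open>Seen from any time of a block of \<open>m + 1\<close> times, the window of radius
  \<open>m\<close> covers the whole block, so its escape probability is the smaller one. Here the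
  local weights are bounded by a capacity, the reverse of their use in
  \<open>capacity_range_le\<close>.\<close>

lemma sum_no_return_le_capacity:
  "(\<Sum>i\<in>{a..a + m}. no_return m i s) \<le> capacity (s ` {a..a + m})"
proof -
  have "capacity (s ` {a..a + m}) = (\<Sum>i\<in>{a..a + m}.
      if s i \<notin> s ` {j\<in>{a..a + m}. i < j} then escape (s ` {a..a + m}) (s i) else 0)"
    unfolding capacity_escape by (rule sum_image_last_visits) simp
  also have "\<dots> \<ge> (\<Sum>i\<in>{a..a + m}. no_return m i s)"
  proof (rule sum_mono)
    fix i assume i: "i \<in> {a..a + m}"
    have "{j\<in>{a..a + m}. i < j} \<subseteq> {i<..i + m}" using i by auto
    moreover have "escape (s ` {i - m..i + m}) (s i) \<le> escape (s ` {a..a + m}) (s i)"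
      using i by (intro escape_antimono image_mono) auto
    ultimately show "no_return m i s
        \<le> (if s i \<notin> s ` {j\<in>{a..a + m}. i < j} then escape (s ` {a..a + m}) (s i) else 0)"
      unfolding no_return_def by auto
  qed
  finally show ?thesis .
qed

text \<open>With \<open>a = i + m\<close> and \<open>z\<close> the displacement from
  \<open>i\<close> to \<open>a\<close>, this is a part of the Green sum at time \<open>i\<close>.
  Keeping \<open>z\<close> as a parameter leaves a functional of the increments after
  \<open>a\<close> alone; the first \<open>q\<close> times are skipped so that \<open>z\<close>
  hardly affects the mean.\<close>

definition forward_sum :: "nat \<Rightarrow> nat \<Rightarrow> nat \<Rightarrow> int ^ 4 \<Rightarrow> (nat \<Rightarrow> int ^ 4) \<Rightarrow> real" where
  "forward_sum q r a z s = (\<Sum>k\<in>{q<..r}. green (z + (s (a + k) - s a)))"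

definition backward_sum :: "nat \<Rightarrow> nat \<Rightarrow> nat \<Rightarrow> int ^ 4 \<Rightarrow> (nat \<Rightarrow> int ^ 4) \<Rightarrow> real" where
  "backward_sum q r a z s = (\<Sum>k\<in>{q<..r}. green (z + (s a - s (a - k))))"

lemma incr_dep_forward_sum: "incr_dep {a..<a + r} (forward_sum q r a z)"
  unfolding forward_sum_def
  by (intro incr_dep_sum incr_dep_compose[where h = "\<lambda>x. green (z + x)"] incr_dep_diff) auto

lemma incr_dep_backward_sum: "incr_dep {a - r..<a} (backward_sum q r a z)"
  unfolding backward_sum_def
  by (intro incr_dep_sum incr_dep_compose[where h = "\<lambda>x. green (z + x)"] incr_dep_diff) auto

text \<open>If the two-sided Green sum is below \<open>2 * c\<close>, one of its sides is below
  \<open>c\<close>. The sides start at the ends of the window of \<open>no_return\<close>, with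
  which they share only the displacement.\<close>

definition bad_weight :: "nat \<Rightarrow> nat \<Rightarrow> nat \<Rightarrow> real \<Rightarrow> nat \<Rightarrow> (nat \<Rightarrow> int ^ 4) \<Rightarrow> real" where
  "bad_weight m q r c i s = no_return m i s *
     (of_bool (forward_sum q r (i + m) (s (i + m) - s i) s < c)
      + of_bool (backward_sum q r (i - m) (s i - s (i - m)) s < c))"

lemma incr_dep_bad_forward:
  assumes "{i..<i + m + r} \<subseteq> I"
  shows "incr_dep I (\<lambda>s. of_bool (forward_sum q r (i + m) (s (i + m) - s i) s < c) :: real)"
proof (rule incr_dep_bind[where Z = "\<lambda>s. s (i + m) - s i"])
  show "incr_dep I (\<lambda>s. s (i + m) - s i)"
    by (rule incr_dep_diff) (use assms in auto)
  show "incr_dep I (\<lambda>s. of_bool (forward_sum q r (i + m) z s < c) :: real)" for z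
    by (rule incr_dep_compose[OF incr_dep_mono[OF incr_dep_forward_sum]]) (use assms in auto)
qed

lemma incr_dep_bad_backward:
  assumes "{i - m - r..<i} \<subseteq> I"
  shows "incr_dep I (\<lambda>s. of_bool (backward_sum q r (i - m) (s i - s (i - m)) s < c) :: real)"
proof (rule incr_dep_bind[where Z = "\<lambda>s. s i - s (i - m)"])
  show "incr_dep I (\<lambda>s. s i - s (i - m))"
    by (rule incr_dep_diff) (use assms in \<open>auto simp: subset_iff\<close>)
  show "incr_dep I (\<lambda>s. of_bool (backward_sum q r (i - m) z s < c) :: real)" for z
    by (rule incr_dep_compose[OF incr_dep_mono[OF incr_dep_backward_sum]]) (use assms in \<open>auto simp: subset_iff\<close>)
qed

lemma incr_dep_bad_weight:
  assumes "h \<ge> m + r"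
  shows "incr_dep {i - h..<i + h} (bad_weight m q r c i)"
  unfolding bad_weight_def
  by (rule incr_dep_compose2[OF incr_dep_mono[OF incr_dep_no_return]
        incr_dep_compose2[OF incr_dep_bad_forward incr_dep_bad_backward]])
     (use assms in auto)

lemma bad_weight_nonneg [simp]: "bad_weight m q r c i s \<ge> 0"
  by (auto simp: bad_weight_def)

lemma bad_weight_le_2: "bad_weight m q r c i s \<le> 2"
proof -
  have "bad_weight m q r c i s \<le> 1 * 2"
    unfolding bad_weight_def by (intro mult_mono no_return_le_1) auto
  then show ?thesis by simp
qed

lemma sum_green_ge_forward_backward:
  assumes "a + (m + r) \<le> i" "i + (m + r) \<le> b"
  shows "forward_sum q r (i + m) (s (i + m) - s i) s + backward_sum q r (i - m) (s i - s (i - m)) s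
    \<le> (\<Sum>j\<in>{a..b}. green (s i - s j))"
proof -
  have "forward_sum q r (i + m) (s (i + m) - s i) s = (\<Sum>j\<in>{i + m + q<..i + m + r}. green (s i - s j))"
    unfolding forward_sum_def
    by (rule sum.reindex_bij_witness[of _ "\<lambda>j. j - (i + m)" "\<lambda>k. i + m + k"])
      (auto simp: green_minus_commute[of "s i"])
  moreover have "backward_sum q r (i - m) (s i - s (i - m)) s = (\<Sum>j\<in>{i - m - r..<i - m - q}. green (s i - s j))"
    unfolding backward_sum_def
    by (rule sum.reindex_bij_witness[of _ "\<lambda>j. i - m - j" "\<lambda>k. i - m - k"]) (use assms in auto)
  moreover have "(\<Sum>j\<in>{i + m + q<..i + m + r}. green (s i - s j)) + (\<Sum>j\<in>{i - m - r..<i - m - q}. green (s i - s j))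
      = (\<Sum>j\<in>{i + m + q<..i + m + r} \<union> {i - m - r..<i - m - q}. green (s i - s j))"
    by (rule sum.union_disjoint[symmetric]) auto
  moreover have "\<dots> \<le> (\<Sum>j\<in>{a..b}. green (s i - s j))"
    using assms by (intro sum_mono2) auto
  ultimately show ?thesis by simp
qed

text \<open>Times within \<open>m + r\<close> of either end lack a full neighbourhood and contribute
  at most 1 each, which gives the term \<open>2 * (m + r)\<close>.\<close>

lemma capacity_range_le:
  fixes s :: "nat \<Rightarrow> int ^ 4"
  assumes c: "c > 0"
  shows "2 * c * capacity (s ` {a..a + n}) \<le> real (n + 1)
    + 2 * c * (2 * real (m + r) + (\<Sum>i\<in>{a + (m + r)..a + n - (m + r)}. bad_weight m q r c i s))"
proof -
  let ?I = "{a..a + n}" and ?J = "{a + (m + r)..a + n - (m + r)}"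
  let ?f = "\<lambda>i. if (\<Sum>j\<in>?I. green (s i - s j)) < 2 * c \<and> s i \<notin> s ` {j\<in>?I. i < j} then escape (s ` ?I) (s i) else 0"
  have f1: "?f i \<le> 1" for i by (simp add: escape_le_1)
  have fJ: "?f i \<le> bad_weight m q r c i s" if i: "i \<in> ?J" for i
  proof (cases "(\<Sum>j\<in>?I. green (s i - s j)) < 2 * c \<and> s i \<notin> s ` {j\<in>?I. i < j}")
    case True
    have i': "a + (m + r) \<le> i" "i + (m + r) \<le> a + n" using i by auto
    have "escape (s ` ?I) (s i) \<le> escape (s ` {i - m..i + m}) (s i)"
      using i' by (intro escape_antimono image_mono) auto
    moreover have "s ` {i<..i + m} \<subseteq> s ` {j\<in>?I. i < j}"
      using i' by (intro image_mono) auto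
    ultimately have "escape (s ` ?I) (s i) \<le> no_return m i s"
      using True unfolding no_return_def by auto
    moreover have "of_bool (forward_sum q r (i + m) (s (i + m) - s i) s < c)
      + of_bool (backward_sum q r (i - m) (s i - s (i - m)) s < c) \<ge> (1 :: real)"
      using sum_green_ge_forward_backward[OF i', where q = q and s = s] True by (auto simp: of_bool_def)
    ultimately have "escape (s ` ?I) (s i) * 1 \<le> bad_weight m q r c i s"
      unfolding bad_weight_def by (intro mult_mono) auto
    with True show ?thesis by simp
  next
    case False
    then show ?thesis unfolding if_not_P[OF False] by simp
  qed
  have sub: "?I - ?J \<subseteq> {a..<a + (m + r)} \<union> {a + n - (m + r)<..a + n}" by auto
  have "card (?I - ?J) \<le> card ({a..<a + (m + r)} \<union> {a + n - (m + r)<..a + n})"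
    by (rule card_mono[OF _ sub]) simp
  also have "\<dots> \<le> 2 * (m + r)"
    by (rule order_trans[OF card_Un_le]) auto
  finally have card: "card (?I - ?J) \<le> 2 * (m + r)" .
  have "(\<Sum>i\<in>?I. ?f i) \<le> (\<Sum>i\<in>(?I - ?J) \<union> ?J. ?f i)"
    by (rule sum_mono2) auto
  also have "\<dots> = (\<Sum>i\<in>?I - ?J. ?f i) + (\<Sum>i\<in>?J. ?f i)"
    by (rule sum.union_disjoint) auto
  also have "\<dots> \<le> (\<Sum>i\<in>?I - ?J. 1) + (\<Sum>i\<in>?J. bad_weight m q r c i s)"
    by (intro add_mono sum_mono f1 fJ)
  also have "\<dots> \<le> 2 * real (m + r) + (\<Sum>i\<in>?J. bad_weight m q r c i s)"
    using of_nat_mono[OF card, where 'a = real] by simp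
  finally have sum: "(\<Sum>i\<in>?I. ?f i) \<le> 2 * real (m + r) + (\<Sum>i\<in>?J. bad_weight m q r c i s)" .
  have "2 * c * capacity (s ` ?I) \<le> real (card ?I) + 2 * c * (\<Sum>i\<in>?I. ?f i)"
    by (rule capacity_image_le) (use c in auto)
  also have "\<dots> \<le> real (n + 1) + 2 * c * (2 * real (m + r) + (\<Sum>i\<in>?J. bad_weight m q r c i s))"
    using c by (intro add_mono mult_left_mono sum) auto
  finally show ?thesis .
qed

section \<open>Concentration\<close>

text \<open>Stated for an arbitrary process \<open>T\<close>, so that forward and time-reversed sums
  are covered alike.\<close>

lemma (in prob_space) green_second_moment:
  fixes T :: "nat \<Rightarrow> 'a \<Rightarrow> int ^ 4"
  assumes int1: "\<And>i. i \<in> {q<..r} \<Longrightarrow> integrable M (\<lambda>\<omega>. green (z + T i \<omega>))"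
    and int2: "\<And>i j. i \<in> {q<..r} \<Longrightarrow> j \<in> {q<..r} \<Longrightarrow> integrable M (\<lambda>\<omega>. green (z + T i \<omega>) * green (z + T j \<omega>))"
    and pair: "\<And>i j. i \<in> {q<..r} \<Longrightarrow> j \<in> {i..r} \<Longrightarrow>
      expectation (\<lambda>\<omega>. green (z + T i \<omega>) * green (z + T j \<omega>)) = green_pair z i (j - i)"
  shows "expectation (\<lambda>\<omega>. (\<Sum>i\<in>{q<..r}. green (z + T i \<omega>))\<^sup>2)
    \<le> (green_sum q r + green 0)\<^sup>2 + 432 * (\<Sum>i\<in>{q<..r}. 1 / real i)"
proof -
  let ?e = "\<lambda>i j. expectation (\<lambda>\<omega>. green (z + T i \<omega>) * green (z + T j \<omega>))"
  have e0: "?e i j \<ge> 0" for i j by (intro integral_nonneg_AE) auto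
  have sym: "?e i j = ?e j i" for i j by (simp add: mult.commute)
  have "expectation (\<lambda>\<omega>. (\<Sum>i\<in>{q<..r}. green (z + T i \<omega>))\<^sup>2) = (\<Sum>i\<in>{q<..r}. \<Sum>j\<in>{q<..r}. ?e i j)"
    unfolding power2_eq_square sum_product using int2
    by (subst Bochner_Integration.integral_sum) (auto intro!: sum.cong Bochner_Integration.integral_sum Bochner_Integration.integrable_sum)
  also have "\<dots> \<le> (\<Sum>i\<in>{q<..r}. \<Sum>j\<in>{q<..r}. (if i \<le> j then ?e i j else 0) + (if j \<le> i then ?e j i else 0))"
    using e0 sym by (intro sum_mono) auto
  also have "\<dots> = 2 * (\<Sum>i\<in>{q<..r}. \<Sum>j\<in>{q<..r}. if i \<le> j then ?e i j else 0)"
    unfolding sum.distrib by (subst (2) sum.swap) simp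
  also have "(\<Sum>i\<in>{q<..r}. \<Sum>j\<in>{q<..r}. if i \<le> j then ?e i j else 0)
      = (\<Sum>i\<in>{q<..r}. \<Sum>j\<in>{i..r}. green_pair z i (j - i))"
  proof (rule sum.cong[OF refl])
    fix i assume i: "i \<in> {q<..r}"
    then have "{j\<in>{q<..r}. i \<le> j} = {i..r}" by auto
    then have "(\<Sum>j\<in>{q<..r}. if i \<le> j then ?e i j else 0) = (\<Sum>j\<in>{i..r}. ?e i j)"
      by (subst sum.inter_filter[symmetric]) auto
    then show "(\<Sum>j\<in>{q<..r}. if i \<le> j then ?e i j else 0) = (\<Sum>j\<in>{i..r}. green_pair z i (j - i))"
      using pair[OF i] by simp
  qed
  finally show ?thesis using sum_green_pair_total_le[where s = q and n = r and z = z] by linarith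
qed

text \<open>Bounds the second moment around \<open>green_sum q r\<close>: the square of
  \<open>green_sum q r\<close> cancels between the second moment and the centring, and what is left
  is of order \<open>ln r\<close>.\<close>

definition moment_bound :: "nat \<Rightarrow> real" where
  "moment_bound r = 432 * (\<Sum>i\<in>{0<..r}. 1 / real i) + (2 + 2 * green 0) * green_sum 0 r + (green 0)\<^sup>2"

text \<open>Without centring: this serves the times beyond the window, where even the full second
  moment is small compared with the square of the threshold.\<close>

lemma (in prob_space) green_tail_bound:
  fixes T :: "nat \<Rightarrow> 'a \<Rightarrow> int ^ 4"
  assumes int1: "\<And>i. i \<in> {q<..r} \<Longrightarrow> integrable M (\<lambda>\<omega>. green (z + T i \<omega>))"
    and int2: "\<And>i j. i \<in> {q<..r} \<Longrightarrow> j \<in> {q<..r} \<Longrightarrow> integrable M (\<lambda>\<omega>. green (z + T i \<omega>) * green (z + T j \<omega>))"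
    and pair: "\<And>i j. i \<in> {q<..r} \<Longrightarrow> j \<in> {i..r} \<Longrightarrow>
      expectation (\<lambda>\<omega>. green (z + T i \<omega>) * green (z + T j \<omega>)) = green_pair z i (j - i)"
    and t: "t > 0"
  shows "prob {\<omega>\<in>space M. t < (\<Sum>i\<in>{q<..r}. green (z + T i \<omega>))}
    \<le> ((green_sum q r + green 0)\<^sup>2 + 432 * (\<Sum>i\<in>{q<..r}. 1 / real i)) / t\<^sup>2"
proof -
  let ?V = "\<lambda>\<omega>. \<Sum>i\<in>{q<..r}. green (z + T i \<omega>)"
  have V: "integrable M ?V" using int1 by auto
  have V2: "integrable M (\<lambda>\<omega>. (?V \<omega>)\<^sup>2)"
    unfolding power2_eq_square sum_product by (intro Bochner_Integration.integrable_sum int2)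
  have "prob {\<omega>\<in>space M. t < ?V \<omega>} \<le> prob {\<omega>\<in>space M. t \<le> \<bar>?V \<omega>\<bar>}"
    by (rule finite_measure_mono) (use V in \<open>auto simp del: sum_abs_ge_zero\<close>)
  also have "\<dots> \<le> expectation (\<lambda>\<omega>. (?V \<omega>)\<^sup>2) / t\<^sup>2"
    by (rule second_moment_method) (use V V2 t in auto)
  also have "\<dots> \<le> ((green_sum q r + green 0)\<^sup>2 + 432 * (\<Sum>i\<in>{q<..r}. 1 / real i)) / t\<^sup>2"
    by (rule divide_right_mono[OF green_second_moment[OF int1 int2 pair]]) auto
  finally show ?thesis .
qed

text \<open>Centring at \<open>green_sum q r\<close> makes the bound uniform in \<open>z\<close>. By
  \<open>defect\<close> the true mean falls short of it by at most 1, which costs only a multiple of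
  \<open>green_sum q r\<close>.\<close>

lemma (in prob_space) green_chebyshev:
  fixes T :: "nat \<Rightarrow> 'a \<Rightarrow> int ^ 4"
  assumes int1: "\<And>i. i \<in> {q<..r} \<Longrightarrow> integrable M (\<lambda>\<omega>. green (z + T i \<omega>))"
    and int2: "\<And>i j. i \<in> {q<..r} \<Longrightarrow> j \<in> {q<..r} \<Longrightarrow> integrable M (\<lambda>\<omega>. green (z + T i \<omega>) * green (z + T j \<omega>))"
    and mean: "\<And>i. i \<in> {q<..r} \<Longrightarrow> expectation (\<lambda>\<omega>. green (z + T i \<omega>)) = green_tail i z"
    and pair: "\<And>i j. i \<in> {q<..r} \<Longrightarrow> j \<in> {i..r} \<Longrightarrow>
      expectation (\<lambda>\<omega>. green (z + T i \<omega>) * green (z + T j \<omega>)) = green_pair z i (j - i)"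
    and defect: "green_sum q r \<le> (\<Sum>i\<in>{q<..r}. green_tail i z) + 1"
    and t: "t > 0"
  shows "prob {\<omega>\<in>space M. t \<le> \<bar>(\<Sum>i\<in>{q<..r}. green (z + T i \<omega>)) - green_sum q r\<bar>} \<le> moment_bound r / t\<^sup>2"
proof -
  let ?V = "\<lambda>\<omega>. \<Sum>i\<in>{q<..r}. green (z + T i \<omega>)" and ?A = "green_sum q r"
  have V: "integrable M ?V" using int1 by auto
  have V2: "integrable M (\<lambda>\<omega>. (?V \<omega>)\<^sup>2)"
    unfolding power2_eq_square sum_product by (intro Bochner_Integration.integrable_sum int2)
  have sq: "(\<lambda>\<omega>. (?V \<omega> - ?A)\<^sup>2) = (\<lambda>\<omega>. (?V \<omega>)\<^sup>2 - 2 * ?A * ?V \<omega> + ?A\<^sup>2)"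
    by (auto simp: power2_eq_square algebra_simps)
  have int: "integrable M (\<lambda>\<omega>. (?V \<omega> - ?A)\<^sup>2)"
    unfolding sq using V V2 by auto
  have EV: "expectation ?V = (\<Sum>i\<in>{q<..r}. green_tail i z)"
    using int1 mean by (subst Bochner_Integration.integral_sum) auto
  have "expectation (\<lambda>\<omega>. (?V \<omega> - ?A)\<^sup>2) = expectation (\<lambda>\<omega>. (?V \<omega>)\<^sup>2) - 2 * ?A * expectation ?V + ?A\<^sup>2"
    unfolding sq using V V2 by (simp add: prob_space)
  also have "\<dots> \<le> ((?A + green 0)\<^sup>2 + 432 * (\<Sum>i\<in>{q<..r}. 1 / real i)) - 2 * ?A * (?A - 1) + ?A\<^sup>2"
    using green_second_moment[OF int1 int2 pair] defect
    by (intro add_mono diff_mono mult_left_mono) (auto simp: EV)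
  also have "\<dots> = 432 * (\<Sum>i\<in>{q<..r}. 1 / real i) + (2 + 2 * green 0) * ?A + (green 0)\<^sup>2"
    by (simp add: power2_eq_square algebra_simps)
  also have "\<dots> \<le> moment_bound r"
    unfolding moment_bound_def green_sum_def
    by (intro add_mono mult_left_mono sum_mono2) auto
  finally have E: "expectation (\<lambda>\<omega>. (?V \<omega> - ?A)\<^sup>2) \<le> moment_bound r" .
  have "prob {\<omega>\<in>space M. t \<le> \<bar>?V \<omega> - ?A\<bar>} \<le> expectation (\<lambda>\<omega>. (?V \<omega> - ?A)\<^sup>2) / t\<^sup>2"
    by (rule second_moment_method) (use V int t in auto)
  also have "\<dots> \<le> moment_bound r / t\<^sup>2"
    using E by (intro divide_right_mono) auto
  finally show ?thesis .
qed

context srw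
begin

lemma AE_diff_cube:
  assumes "a \<le> b"
  shows "AE \<omega> in M. walk \<omega> b - walk \<omega> a \<in> cube (b - a)"
proof -
  have "AE \<omega> in M. \<forall>n. incr n \<omega> \<in> unit_steps"
    using AE_incr by (simp add: AE_all_countable)
  then show ?thesis
  proof eventually_elim
    case (elim \<omega>)
    show ?case using assms
    proof (induction b rule: dec_induct)
      case (step b)
      have "walk \<omega> (Suc b) - walk \<omega> b \<in> cube 1"
        using elim unit_steps_cube unfolding incr_def walk_def by blast
      from cube_add[OF step.IH this] show ?case
        using step by (simp add: Suc_diff_le)
    qed simp
  qed
qed

lemma expectation_pair:
  fixes f :: "int ^ 'd \<Rightarrow> int ^ 'd \<Rightarrow> real"
  assumes ab: "a \<le> b" and bc: "b \<le> c"
  shows "mean (\<lambda>s. f (s b - s a) (s c - s b))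
    = (\<Sum>x\<in>cube (b - a). \<Sum>y\<in>cube (c - b). heat_kernel (b - a) x * heat_kernel (c - b) y * f x y)"
proof -
  let ?X = "\<lambda>\<omega>. walk \<omega> b - walk \<omega> a" and ?Y = "\<lambda>\<omega>. walk \<omega> c - walk \<omega> b"
  have dX: "incr_dep {a..<b} (\<lambda>s. s b - s a = x)" for x :: "int ^ 'd"
    using ab by (intro incr_dep_diff_eq) auto
  have dY: "incr_dep {b..<c} (\<lambda>s. s c - s b = y)" for y :: "int ^ 'd"
    using bc by (intro incr_dep_diff_eq) auto
  let ?E = "\<lambda>x y. {\<omega>\<in>space M. ?X \<omega> = x \<and> ?Y \<omega> = y}"
  have ev: "?E x y \<in> events" for x y
    by (rule events_incr_dep[OF _ incr_dep_conj[OF incr_dep_mono[OF dX] incr_dep_mono[OF dY]]], rule finite_UnI[of "{a..<b}" "{b..<c}"]) auto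
  have pr: "prob (?E x y) = heat_kernel (b - a) x * heat_kernel (c - b) y" for x y
    by (subst prob_conj_incr_dep[OF _ dX _ dY]) (auto simp: prob_diff ab bc)
  have "expectation (\<lambda>\<omega>. f (?X \<omega>) (?Y \<omega>))
      = expectation (\<lambda>\<omega>. \<Sum>x\<in>cube (b - a). \<Sum>y\<in>cube (c - b). f x y * indicator (?E x y) \<omega>)"
  proof (rule integral_cong_AE)
    show "AE \<omega> in M. f (?X \<omega>) (?Y \<omega>) = (\<Sum>x\<in>cube (b - a). \<Sum>y\<in>cube (c - b). f x y * indicator (?E x y) \<omega>)"
      using AE_diff_cube[OF ab] AE_diff_cube[OF bc] AE_space
    proof eventually_elim
      case (elim \<omega>)
      have "(\<Sum>x\<in>cube (b - a). \<Sum>y\<in>cube (c - b). f x y * indicator (?E x y) \<omega>)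
          = (\<Sum>x\<in>cube (b - a). if x = ?X \<omega> then f x (?Y \<omega>) else 0)"
      proof (intro sum.cong refl)
        fix x
        have "(\<Sum>y\<in>cube (c - b). f x y * indicator (?E x y) \<omega>)
            = (\<Sum>y\<in>cube (c - b). if y = ?Y \<omega> then (if x = ?X \<omega> then f x y else 0) else 0)"
          using elim(3) by (intro sum.cong refl) (auto simp: indicator_def)
        also have "\<dots> = (if x = ?X \<omega> then f x (?Y \<omega>) else 0)"
          using elim(2) by (subst sum.delta) auto
        finally show "(\<Sum>y\<in>cube (c - b). f x y * indicator (?E x y) \<omega>) = (if x = ?X \<omega> then f x (?Y \<omega>) else 0)" .
      qed
      also have "\<dots> = f (?X \<omega>) (?Y \<omega>)"
        using elim(1) by (subst sum.delta) auto
      finally show ?case ..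
    qed
    have "incr_dep {a..<c} (\<lambda>s. f (s b - s a) (s c - s b))"
      by (rule incr_dep_compose2[OF incr_dep_diff incr_dep_diff]) (use ab bc in auto)
    from borel_measurable_incr_dep[OF _ this]
    show "(\<lambda>\<omega>. f (?X \<omega>) (?Y \<omega>)) \<in> borel_measurable M" by simp
    show "(\<lambda>\<omega>. \<Sum>x\<in>cube (b - a). \<Sum>y\<in>cube (c - b). f x y * indicator (?E x y) \<omega>) \<in> borel_measurable M"
      using ev by (intro borel_measurable_sum borel_measurable_times borel_measurable_indicator) auto
  qed
  also have "\<dots> = (\<Sum>x\<in>cube (b - a). \<Sum>y\<in>cube (c - b). f x y * prob (?E x y))"
  proof -
    have int: "integrable M (\<lambda>\<omega>. f x y * indicator (?E x y) \<omega>)" for x y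
      using ev by (simp add: emeasure_eq_measure)
    have "expectation (\<lambda>\<omega>. f x y * indicator (?E x y) \<omega>) = f x y * prob (?E x y)" for x y
      using ev by simp
    then show ?thesis
      by (simp only: Bochner_Integration.integral_sum Bochner_Integration.integrable_sum int)
  qed
  finally show ?thesis by (simp add: pr mult_ac)
qed

end

section \<open>Concentration of Green sums along the four-dimensional walk\<close>

locale srw4 = srw M x0 S for M :: "'a measure" and x0 :: "int ^ 4" and S
begin

lemma integrable_green:
  assumes "a \<le> b" "c \<le> d"
  shows "integrable M (\<lambda>\<omega>. green (z + (walk \<omega> b - walk \<omega> a)) * green (w + (walk \<omega> d - walk \<omega> c)))"
    and "integrable M (\<lambda>\<omega>. green (z + (walk \<omega> b - walk \<omega> a)))"
proof -
  let ?I = "{a..<b} \<union> {c..<d}"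
  have d1: "incr_dep ?I (\<lambda>s. green (z + (s b - s a)))"
    by (rule incr_dep_compose[OF incr_dep_diff]) (use assms in auto)
  have d2: "incr_dep ?I (\<lambda>s. green (w + (s d - s c)))"
    by (rule incr_dep_compose[OF incr_dep_diff]) (use assms in auto)
  show "integrable M (\<lambda>\<omega>. green (z + (walk \<omega> b - walk \<omega> a)) * green (w + (walk \<omega> d - walk \<omega> c)))"
    using integrable_incr_dep[OF _ incr_dep_compose2[OF d1 d2, of "(*)"]] by simp
  show "integrable M (\<lambda>\<omega>. green (z + (walk \<omega> b - walk \<omega> a)))"
    using integrable_incr_dep[OF _ d1] by simp
qed

lemma expectation_green:
  assumes "a \<le> b"
  shows "mean (\<lambda>s. green (z + (s b - s a))) = green_tail (b - a) z"
proof -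
  have "cube 0 = {0 :: int ^ 4}" by (auto simp: cube_def vec_eq_iff)
  then show ?thesis
    using expectation_pair[OF assms order_refl, of "\<lambda>x y. green (z + x)"] sum_heat_kernel_green_tail[of "b - a" 0 z]
    by simp
qed

lemma sum_green_pair_eq:
  "(\<Sum>x\<in>cube i. \<Sum>y\<in>cube k. heat_kernel i x * heat_kernel k y * (green (z + x) * green (z + x + y))) = green_pair z i k"
proof -
  have "(\<Sum>y\<in>cube k. heat_kernel i x * heat_kernel k y * (green (z + x) * green (z + x + y)))
      = heat_kernel i x * (green (z + x) * (\<Sum>y\<in>cube k. heat_kernel k y * green (z + x + y)))" for x
    by (simp add: sum_distrib_left mult_ac)
  then show ?thesis by (simp add: green_pair_def sum_heat_kernel_green_tail)
qed

lemma expectation_forward: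
  assumes "i \<le> j"
  shows "mean (\<lambda>s. green (z + (s (a + i) - s a)) * green (z + (s (a + j) - s a)))
    = green_pair z i (j - i)"
proof -
  have ij: "a \<le> a + i" "a + i \<le> a + j" using assms by auto
  show ?thesis
    using expectation_pair[OF ij, of "\<lambda>x y. green (z + x) * green (z + x + y)"] sum_green_pair_eq[of i "j - i" z]
    by (simp add: algebra_simps)
qed

lemma expectation_backward:
  assumes "i \<le> j" "j \<le> a"
  shows "mean (\<lambda>s. green (z + (s a - s (a - i))) * green (z + (s a - s (a - j))))
    = green_pair z i (j - i)"
proof -
  have ij: "a - j \<le> a - i" "a - i \<le> a" using assms by auto
  have len: "a - i - (a - j) = j - i" "a - (a - i) = i" using assms by auto
  \<comment> \<open>Looking back from \<open>a\<close>, the part shared by both positions is the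
    later increment, so the roles of \<open>x\<close> and \<open>y\<close> are exchanged.\<close>
  have "mean (\<lambda>s. green (z + (s a - s (a - i))) * green (z + (s a - s (a - j))))
      = (\<Sum>x\<in>cube (j - i). \<Sum>y\<in>cube i. heat_kernel (j - i) x * heat_kernel i y * (green (z + y) * green (z + y + x)))"
    using expectation_pair[OF ij, of "\<lambda>x y. green (z + y) * green (z + y + x)"] unfolding len
    by (simp add: algebra_simps)
  also have "\<dots> = (\<Sum>y\<in>cube i. \<Sum>x\<in>cube (j - i). heat_kernel i y * heat_kernel (j - i) x * (green (z + y) * green (z + y + x)))"
    by (subst sum.swap) (simp add: mult_ac)
  finally show ?thesis
    by (simp add: sum_green_pair_eq)
qed

lemma forward_chebyshev:
  assumes "green_sum q r \<le> (\<Sum>i\<in>{q<..r}. green_tail i z) + 1" "t > 0"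
  shows "walk_prob (\<lambda>s. t \<le> \<bar>forward_sum q r a z s - green_sum q r\<bar>) \<le> moment_bound r / t\<^sup>2"
  unfolding forward_sum_def
  by (rule green_chebyshev[OF _ _ _ _ assms])
     (auto simp: expectation_green expectation_forward intro!: integrable_green)

lemma backward_chebyshev:
  assumes "green_sum q r \<le> (\<Sum>i\<in>{q<..r}. green_tail i z) + 1" "t > 0" and a: "r \<le> a"
  shows "walk_prob (\<lambda>s. t \<le> \<bar>backward_sum q r a z s - green_sum q r\<bar>) \<le> moment_bound r / t\<^sup>2"
  unfolding backward_sum_def
  by (rule green_chebyshev[OF _ _ _ _ assms(1,2)])
     (use a in \<open>auto simp: expectation_green expectation_backward intro!: integrable_green\<close>)

lemma forward_tail_bound:
  assumes "t > 0"
  shows "walk_prob (\<lambda>s. t < forward_sum q r a z s)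
    \<le> ((green_sum q r + green 0)\<^sup>2 + 432 * (\<Sum>i\<in>{q<..r}. 1 / real i)) / t\<^sup>2"
  unfolding forward_sum_def
  by (rule green_tail_bound[OF _ _ _ assms]) (auto simp: expectation_forward intro!: integrable_green)

lemma backward_tail_bound:
  assumes "t > 0" and a: "r \<le> a"
  shows "walk_prob (\<lambda>s. t < backward_sum q r a z s)
    \<le> ((green_sum q r + green 0)\<^sup>2 + 432 * (\<Sum>i\<in>{q<..r}. 1 / real i)) / t\<^sup>2"
  unfolding backward_sum_def
  by (rule green_tail_bound[OF _ _ _ assms(1)])
     (use a in \<open>auto simp: expectation_backward intro!: integrable_green\<close>)

end

context srw
begin

text \<open>Functionals of windows of radius \<open>h\<close> are uncorrelated when their centres are \<open>2h\<close> apart.\<close>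

lemma range_dependent_chebyshev:
  fixes Y :: "nat \<Rightarrow> (nat \<Rightarrow> int ^ 'd) \<Rightarrow> real"
  assumes J: "finite J" and dep: "\<And>i. i \<in> J \<Longrightarrow> incr_dep {i - h..<i + h} (Y i)"
    and Y0: "\<And>i s. 0 \<le> Y i s" and YK: "\<And>i s. Y i s \<le> K" and t: "t > 0"
  shows "walk_prob (\<lambda>s. (\<Sum>i\<in>J. mean (Y i)) + t \<le> (\<Sum>i\<in>J. Y i s))
    \<le> real (card J) * (4 * real h + 1) * K\<^sup>2 / t\<^sup>2"
proof -
  define Z where "Z i s = Y i s - mean (Y i)" for i s
  have depZ: "incr_dep {i - h..<i + h} (Z i)" if "i \<in> J" for i
    unfolding Z_def by (rule incr_dep_compose[OF dep[OF that]])
  have intZ: "integrable M (\<lambda>\<omega>. Z i (walk \<omega>))" if "i \<in> J" for i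
    by (rule integrable_incr_dep[OF _ depZ[OF that]]) simp
  have intY: "integrable M (\<lambda>\<omega>. Y i (walk \<omega>))" if "i \<in> J" for i
    by (rule integrable_incr_dep[OF _ dep[OF that]]) simp
  have intZZ: "integrable M (\<lambda>\<omega>. Z i (walk \<omega>) * Z j (walk \<omega>))" if "i \<in> J" "j \<in> J" for i j
  proof -
    have "incr_dep ({i - h..<i + h} \<union> {j - h..<j + h}) (\<lambda>s. Z i s * Z j s)"
      by (rule incr_dep_compose2[OF incr_dep_mono[OF depZ[OF that(1)]] incr_dep_mono[OF depZ[OF that(2)]]]) auto
    from integrable_incr_dep[OF _ this] show ?thesis by simp
  qed
  have EZ: "mean (Z i) = 0" if "i \<in> J" for i
    using intY[OF that] by (simp add: Z_def prob_space)
  have ZK: "\<bar>Z i s\<bar> \<le> K" if "i \<in> J" for i s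
  proof -
    have "mean (Y i) \<le> K"
      using intY[OF that] YK by (intro integral_le_const) auto
    moreover have "0 \<le> mean (Y i)"
      using Y0 by (intro integral_nonneg_AE) auto
    ultimately show ?thesis using Y0[of i s] YK[of i s] unfolding Z_def by linarith
  qed
  have cov: "mean (\<lambda>s. Z i s * Z j s) \<le> (if j \<in> {i - 2 * h..i + 2 * h} then K\<^sup>2 else 0)"
    if i: "i \<in> J" and j: "j \<in> J" for i j
  proof (cases "j \<in> {i - 2 * h..i + 2 * h}")
    case True
    have "Z i s * Z j s \<le> K\<^sup>2" for s
    proof -
      have "Z i s * Z j s \<le> \<bar>Z i s\<bar> * \<bar>Z j s\<bar>"
        by (metis abs_ge_self abs_mult)
      also have "\<dots> \<le> K * K"
        using ZK[OF i, of s] ZK[OF j, of s] by (intro mult_mono) auto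
      finally show ?thesis by (simp add: power2_eq_square)
    qed
    then show ?thesis
      using True intZZ[OF i j] by (auto intro!: integral_le_const)
  next
    case False
    then have "{i - h..<i + h} \<inter> {j - h..<j + h} = {}" by auto
    from expectation_mult_incr_dep[OF _ depZ[OF i] _ depZ[OF j] this] show ?thesis
      using False by (simp add: EZ[OF i])
  qed
  have "mean (\<lambda>s. (\<Sum>i\<in>J. Z i s)\<^sup>2) = (\<Sum>i\<in>J. \<Sum>j\<in>J. mean (\<lambda>s. Z i s * Z j s))"
    unfolding power2_eq_square sum_product
    by (subst Bochner_Integration.integral_sum)
       (auto intro!: sum.cong Bochner_Integration.integral_sum Bochner_Integration.integrable_sum intZZ)
  also have "\<dots> \<le> (\<Sum>i\<in>J. \<Sum>j\<in>J. if j \<in> {i - 2 * h..i + 2 * h} then K\<^sup>2 else 0)"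
    by (intro sum_mono cov)
  also have "\<dots> \<le> (\<Sum>i\<in>J. (4 * real h + 1) * K\<^sup>2)"
  proof (rule sum_mono)
    fix i
    have "(\<Sum>j\<in>J. if j \<in> {i - 2 * h..i + 2 * h} then K\<^sup>2 else 0) = real (card (J \<inter> {i - 2 * h..i + 2 * h})) * K\<^sup>2"
      by (subst sum.inter_restrict[OF J, symmetric]) simp
    also have "\<dots> \<le> real (4 * h + 1) * K\<^sup>2"
    proof (intro mult_right_mono of_nat_mono)
      have "card (J \<inter> {i - 2 * h..i + 2 * h}) \<le> card {i - 2 * h..i + 2 * h}"
        by (rule card_mono) auto
      also have "\<dots> \<le> 4 * h + 1" by simp
      finally show "card (J \<inter> {i - 2 * h..i + 2 * h}) \<le> 4 * h + 1" .
    qed simp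
    finally show "(\<Sum>j\<in>J. if j \<in> {i - 2 * h..i + 2 * h} then K\<^sup>2 else 0) \<le> (4 * real h + 1) * K\<^sup>2"
      by (simp only: of_nat_add of_nat_mult of_nat_numeral of_nat_1)
  qed
  finally have second: "mean (\<lambda>s. (\<Sum>i\<in>J. Z i s)\<^sup>2) \<le> real (card J) * (4 * real h + 1) * K\<^sup>2"
    by simp
  have sumZ: "integrable M (\<lambda>\<omega>. \<Sum>i\<in>J. Z i (walk \<omega>))"
    by (intro Bochner_Integration.integrable_sum intZ)
  have sumZ2: "integrable M (\<lambda>\<omega>. (\<Sum>i\<in>J. Z i (walk \<omega>))\<^sup>2)"
    unfolding power2_eq_square sum_product by (intro Bochner_Integration.integrable_sum intZZ)
  have "walk_prob (\<lambda>s. (\<Sum>i\<in>J. mean (Y i)) + t \<le> (\<Sum>i\<in>J. Y i s))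
      \<le> walk_prob (\<lambda>s. t \<le> \<bar>\<Sum>i\<in>J. Z i s\<bar>)"
  proof (rule finite_measure_mono)
    show "{\<omega>\<in>space M. (\<Sum>i\<in>J. mean (Y i)) + t \<le> (\<Sum>i\<in>J. Y i (walk \<omega>))}
      \<subseteq> {\<omega>\<in>space M. t \<le> \<bar>\<Sum>i\<in>J. Z i (walk \<omega>)\<bar>}"
      by (auto simp: Z_def sum_subtractf)
    show "{\<omega>\<in>space M. t \<le> \<bar>\<Sum>i\<in>J. Z i (walk \<omega>)\<bar>} \<in> events"
      using borel_measurable_integrable[OF sumZ] by measurable
  qed
  also have "\<dots> \<le> mean (\<lambda>s. (\<Sum>i\<in>J. Z i s)\<^sup>2) / t\<^sup>2"
    by (rule second_moment_method) (use sumZ sumZ2 t in auto)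
  also have "\<dots> \<le> real (card J) * (4 * real h + 1) * K\<^sup>2 / t\<^sup>2"
    by (rule divide_right_mono[OF second]) simp
  finally show ?thesis .
qed

text \<open>Summing over the values of the displacement \<open>s b - s a\<close> makes the two factors independent.\<close>

lemma expectation_decouple:
  fixes G :: "(nat \<Rightarrow> int ^ 'd) \<Rightarrow> real" and P :: "int ^ 'd \<Rightarrow> (nat \<Rightarrow> int ^ 'd) \<Rightarrow> bool"
  assumes I: "finite I" "incr_dep I G" and G: "\<And>s. 0 \<le> G s" and ab: "a \<le> b" "{a..<b} \<subseteq> I"
    and J: "finite J" "\<And>z. incr_dep J (P z)" and disj: "I \<inter> J = {}"
    and p: "\<And>z. heat_kernel (b - a) z \<noteq> 0 \<Longrightarrow> walk_prob (P z) \<le> p"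
  shows "mean (\<lambda>s. G s * of_bool (P (s b - s a) s)) \<le> p * mean G"
proof -
  let ?Z = "\<lambda>s. s b - s a"
  let ?C = "cube (b - a) :: (int ^ 'd) set"
  have dZ: "incr_dep I (\<lambda>s. of_bool (?Z s = z) :: real)" for z
    by (rule incr_dep_compose[OF incr_dep_diff[OF ab(2,1)]])
  have dGZ: "incr_dep I (\<lambda>s. G s * of_bool (?Z s = z))" for z
    by (rule incr_dep_compose2[OF I(2) dZ])
  have dP: "incr_dep J (\<lambda>s. of_bool (P z s) :: real)" for z
    by (rule incr_dep_compose[OF J(2)])
  have intGZ: "integrable M (\<lambda>\<omega>. G (walk \<omega>) * of_bool (?Z (walk \<omega>) = z))" for z
    by (rule integrable_incr_dep[OF I(1) dGZ])
  have intGZP: "integrable M (\<lambda>\<omega>. G (walk \<omega>) * of_bool (?Z (walk \<omega>) = z) * of_bool (P z (walk \<omega>)))" for z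
    by (rule integrable_incr_dep[OF finite_UnI[OF I(1) J(1)]
      incr_dep_compose2[OF incr_dep_mono[OF dGZ] incr_dep_mono[OF dP], where h = "(*)"]]) auto
  have AE: "AE \<omega> in M. walk \<omega> b - walk \<omega> a \<in> ?C" by (rule AE_diff_cube[OF ab(1)])
  have meas: "(\<lambda>\<omega>. G (walk \<omega>) * of_bool (P (?Z (walk \<omega>)) (walk \<omega>))) \<in> borel_measurable M"
  proof -
    have "incr_dep (I \<union> J) (\<lambda>s. of_bool (P (?Z s) s) :: real)"
      by (rule incr_dep_bind[OF incr_dep_diff[OF _ ab(1)] incr_dep_mono[OF dP]]) (use ab(2) in auto)
    from incr_dep_compose2[OF incr_dep_mono[OF I(2), of "I \<union> J"] this, where h = "(*)"]
    have "incr_dep (I \<union> J) (\<lambda>s. G s * of_bool (P (?Z s) s))" by simp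
    from borel_measurable_incr_dep[OF _ this] show ?thesis using I J by simp
  qed
  have "mean (\<lambda>s. G s * of_bool (P (?Z s) s))
      = mean (\<lambda>s. \<Sum>z\<in>?C. G s * of_bool (?Z s = z) * of_bool (P z s))"
  proof (rule integral_cong_AE)
    show "AE \<omega> in M. G (walk \<omega>) * of_bool (P (?Z (walk \<omega>)) (walk \<omega>))
      = (\<Sum>z\<in>?C. G (walk \<omega>) * of_bool (?Z (walk \<omega>) = z) * of_bool (P z (walk \<omega>)))"
      using AE
    proof eventually_elim
      case (elim \<omega>)
      have "(\<Sum>z\<in>?C. G (walk \<omega>) * of_bool (?Z (walk \<omega>) = z) * of_bool (P z (walk \<omega>)))
          = (\<Sum>z\<in>?C. if ?Z (walk \<omega>) = z then G (walk \<omega>) * of_bool (P z (walk \<omega>)) else 0)"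
        by (intro sum.cong refl) auto
      then show ?case using elim by (subst (asm) sum.delta') auto
    qed
    show "(\<lambda>\<omega>. \<Sum>z\<in>?C. G (walk \<omega>) * of_bool (?Z (walk \<omega>) = z) * of_bool (P z (walk \<omega>))) \<in> borel_measurable M"
      by (intro borel_measurable_sum borel_measurable_integrable intGZP)
  qed (rule meas)
  also have "\<dots> = (\<Sum>z\<in>?C. mean (\<lambda>s. G s * of_bool (?Z s = z) * of_bool (P z s)))"
    by (rule Bochner_Integration.integral_sum) (rule intGZP)
  also have "\<dots> = (\<Sum>z\<in>?C. mean (\<lambda>s. G s * of_bool (?Z s = z)) * walk_prob (P z))"
    by (intro sum.cong refl)
       (subst expectation_mult_incr_dep[OF I(1) dGZ J(1) dP disj], subst prob_eq_expectation[OF J], rule refl)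
  also have "\<dots> \<le> (\<Sum>z\<in>?C. mean (\<lambda>s. G s * of_bool (?Z s = z)) * p)"
  proof (rule sum_mono)
    fix z
    show "mean (\<lambda>s. G s * of_bool (?Z s = z)) * walk_prob (P z)
      \<le> mean (\<lambda>s. G s * of_bool (?Z s = z)) * p"
    \<comment> \<open>Unreachable displacements have probability zero. Hence \<open>p\<close> has to
      bound the probability only where the kernel does not vanish, which is the range covered by
      \<open>sum_green_tail_ge\<close>.\<close>
    proof (cases "heat_kernel (b - a) z = 0")
      case True
      have "{\<omega>\<in>space M. walk \<omega> b - walk \<omega> a = z} \<in> events"
        by (rule events_incr_dep[OF I(1) incr_dep_diff_eq[OF ab(2,1)]])
      moreover have "walk_prob (\<lambda>s. s b - s a = z) = 0"
        using True prob_diff[OF ab(1)] by simp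
      ultimately have "AE \<omega> in M. \<not> (walk \<omega> b - walk \<omega> a = z)"
        by (subst AE_iff_measurable[OF _ refl]) (auto simp: emeasure_eq_measure)
      then have "mean (\<lambda>s. G s * of_bool (?Z s = z)) = 0"
        by (intro integral_eq_zero_AE) auto
      then show ?thesis by simp
    next
      case False
      then show ?thesis
        using p G by (intro mult_left_mono integral_nonneg_AE) auto
    qed
  qed
  also have "\<dots> = p * mean (\<lambda>s. \<Sum>z\<in>?C. G s * of_bool (?Z s = z))"
    by (subst Bochner_Integration.integral_sum) (auto simp: intGZ sum_distrib_left mult.commute)
  also have "mean (\<lambda>s. \<Sum>z\<in>?C. G s * of_bool (?Z s = z)) = mean G"
  proof (rule integral_cong_AE)
    show "AE \<omega> in M. (\<Sum>z\<in>?C. G (walk \<omega>) * of_bool (?Z (walk \<omega>) = z)) = G (walk \<omega>)"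
      using AE
    proof eventually_elim
      case (elim \<omega>)
      have "(\<Sum>z\<in>?C. G (walk \<omega>) * of_bool (?Z (walk \<omega>) = z))
          = (\<Sum>z\<in>?C. if ?Z (walk \<omega>) = z then G (walk \<omega>) else 0)"
        by (intro sum.cong refl) auto
      then show ?case using elim by (subst (asm) sum.delta') auto
    qed
    show "(\<lambda>\<omega>. \<Sum>z\<in>?C. G (walk \<omega>) * of_bool (?Z (walk \<omega>) = z)) \<in> borel_measurable M"
      by (intro borel_measurable_sum borel_measurable_integrable intGZ)
  qed (rule borel_measurable_incr_dep[OF I])
  finally show ?thesis .
qed

end

section \<open>Logarithmic asymptotics\<close>

lemma sum_inverse_le_ln:
  assumes "0 < q" "q \<le> r"
  shows "(\<Sum>i\<in>{q<..r}. 1 / real i) \<le> ln (real r) - ln (real q)"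
  using assms(2)
proof (induction r rule: dec_induct)
  case (step r)
  have r: "real r > 0" using step assms(1) by simp
  have "ln (real r / (real r + 1)) \<le> real r / (real r + 1) - 1"
    using r by (intro ln_le_minus_one) auto
  also have "\<dots> = - (1 / (real r + 1))"
    using r by (simp add: field_simps)
  finally have "1 / (real r + 1) \<le> ln (real r + 1) - ln (real r)"
    using r by (simp add: ln_div)
  moreover have "{q<..Suc r} = insert (Suc r) {q<..r}" using step by auto
  ultimately show ?case using step.IH by (simp add: add.commute)
qed simp

lemma tendsto_harm_over_ln: "(\<lambda>n. (\<Sum>i\<in>{0<..n}. 1 / real i) / ln (real n)) \<longlonglongrightarrow> 1"
proof -
  have "(\<lambda>n. (harm n - ln (real n)) / ln (real n)) \<longlonglongrightarrow> 0"
    by (rule tendsto_divide_0[OF euler_mascheroni_LIMSEQ]) real_asymp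
  then have "(\<lambda>n. (harm n - ln (real n)) / ln (real n) + 1) \<longlonglongrightarrow> 0 + 1"
    by (intro tendsto_intros)
  moreover have "\<forall>\<^sub>F n in sequentially. (harm n - ln (real n)) / ln (real n) + 1 = (\<Sum>i\<in>{0<..n}. 1 / real i) / ln (real n)"
    using eventually_gt_at_top[of 1]
  proof eventually_elim
    case (elim n)
    have "{0<..n} = {1..n}" by auto
    then have "harm n = (\<Sum>i\<in>{0<..n}. 1 / real i)"
      by (simp add: harm_def inverse_eq_divide)
    with elim show ?case by (simp add: diff_divide_distrib)
  qed
  ultimately show ?thesis by (auto elim: Lim_transform_eventually)
qed

text \<open>Cesaro averaging with the weights \<open>1 / i\<close>: finitely many large terms are
  negligible against \<open>ln n\<close>.\<close>

lemma tendsto_weighted_sum_over_ln_0: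
  fixes d :: "nat \<Rightarrow> real"
  assumes "d \<longlonglongrightarrow> 0"
  shows "(\<lambda>n. (\<Sum>i\<in>{0<..n}. d i / real i) / ln (real n)) \<longlonglongrightarrow> 0"
proof (rule tendstoI)
  fix e :: real assume e: "e > 0"
  obtain K where K: "\<And>n. n \<ge> K \<Longrightarrow> \<bar>d n\<bar> < e / 4"
    using LIMSEQ_D[OF assms, of "e / 4"] e by auto
  let ?H = "\<lambda>n. \<Sum>i\<in>{0<..n}. 1 / real i"
  define C where "C = (\<Sum>i\<in>{0<..K}. \<bar>d i\<bar> / real i)"
  have bound: "\<bar>\<Sum>i\<in>{0<..n}. d i / real i\<bar> \<le> C + e / 4 * ?H n" for n
  proof -
    have "\<bar>\<Sum>i\<in>{0<..n}. d i / real i\<bar> \<le> (\<Sum>i\<in>{0<..n}. \<bar>d i\<bar> / real i)"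
      by (rule order_trans[OF sum_abs]) simp
    also have "\<dots> \<le> (\<Sum>i\<in>{0<..n}. (if i \<in> {0<..K} then \<bar>d i\<bar> / real i else 0) + e / 4 * (1 / real i))"
    proof (rule sum_mono)
      fix i assume "i \<in> {0<..n}"
      then show "\<bar>d i\<bar> / real i \<le> (if i \<in> {0<..K} then \<bar>d i\<bar> / real i else 0) + e / 4 * (1 / real i)"
      proof (cases "i \<le> K")
        case False
        then have "\<bar>d i\<bar> / real i \<le> e / 4 / real i"
          using K[of i] by (intro divide_right_mono) auto
        with False show ?thesis by simp
      qed (use e \<open>i \<in> {0<..n}\<close> in auto)
    qed
    also have "\<dots> = (\<Sum>i\<in>{0<..n} \<inter> {0<..K}. \<bar>d i\<bar> / real i) + e / 4 * ?H n"
      unfolding sum.distrib sum_distrib_left by (subst sum.inter_restrict) auto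
    also have "\<dots> \<le> C + e / 4 * ?H n"
      unfolding C_def by (intro add_right_mono sum_mono2) auto
    finally show ?thesis .
  qed
  have "(\<lambda>n. C / ln (real n)) \<longlonglongrightarrow> 0" by real_asymp
  then have 1: "\<forall>\<^sub>F n in sequentially. C / ln (real n) < e / 4"
    using e by (intro order_tendstoD) auto
  have 2: "\<forall>\<^sub>F n in sequentially. ?H n / ln (real n) < 2"
    by (rule order_tendstoD(2)[OF tendsto_harm_over_ln]) simp
  show "\<forall>\<^sub>F n in sequentially. dist ((\<Sum>i\<in>{0<..n}. d i / real i) / ln (real n)) 0 < e"
    using 1 2 eventually_gt_at_top[of 1]
  proof eventually_elim
    case (elim n)
    have ln: "ln (real n) > 0" using elim by simp
    have "\<bar>(\<Sum>i\<in>{0<..n}. d i / real i) / ln (real n)\<bar> \<le> (C + e / 4 * ?H n) / ln (real n)"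
      using ln bound[of n] by (simp add: abs_div divide_right_mono)
    also have "\<dots> = C / ln (real n) + e / 4 * (?H n / ln (real n))"
      by (simp add: add_divide_distrib)
    also have "\<dots> < e / 4 + e / 4 * 2"
      using elim e by (intro add_strict_mono mult_strict_left_mono) auto
    also have "\<dots> < e" using e by simp
    finally show ?case by simp
  qed
qed

lemma tendsto_green_sum: "(\<lambda>n. green_sum q n / ln (real n)) \<longlonglongrightarrow> 4 / pi\<^sup>2"
proof -
  let ?c = "4 / pi\<^sup>2" and ?H = "\<lambda>n. \<Sum>i\<in>{0<..n}. 1 / real i"
  define d where "d k = real k * green_tail k 0 - ?c" for k
  have "d \<longlonglongrightarrow> ?c - ?c"
    unfolding d_def by (intro tendsto_intros tendsto_green_tail_zero)
  then have "d \<longlonglongrightarrow> 0" by simp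
  then have "(\<lambda>n. ?c * (?H n / ln (real n)) + (\<Sum>i\<in>{0<..n}. d i / real i) / ln (real n) - green_sum 0 q / ln (real n))
      \<longlonglongrightarrow> ?c * 1 + 0 - 0"
    by (intro tendsto_intros tendsto_harm_over_ln tendsto_weighted_sum_over_ln_0[OF \<open>d \<longlonglongrightarrow> 0\<close>]) real_asymp
  moreover have "\<forall>\<^sub>F n in sequentially. ?c * (?H n / ln (real n)) + (\<Sum>i\<in>{0<..n}. d i / real i) / ln (real n)
      - green_sum 0 q / ln (real n) = green_sum q n / ln (real n)"
    using eventually_ge_at_top[of q]
  proof eventually_elim
    case (elim n)
    have "green_sum 0 n = (\<Sum>i\<in>{0<..n}. ?c * (1 / real i) + d i / real i)"
      unfolding green_sum_def by (intro sum.cong refl) (auto simp: d_def field_simps)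
    moreover have "green_sum 0 n = green_sum 0 q + green_sum q n"
      unfolding green_sum_def using elim by (subst sum.union_disjoint[symmetric]) (auto intro!: sum.cong)
    ultimately have "green_sum q n = ?c * ?H n + (\<Sum>i\<in>{0<..n}. d i / real i) - green_sum 0 q"
      by (simp add: sum.distrib sum_distrib_left)
    then show ?case by (simp add: add_divide_distrib diff_divide_distrib)
  qed
  ultimately show ?thesis by (auto elim: Lim_transform_eventually)
qed

lemma tendsto_moment_bound:
  "(\<lambda>n. moment_bound n / ln (real n)) \<longlonglongrightarrow> 432 + (2 + 2 * green 0) * (4 / pi\<^sup>2)"
proof -
  have "(\<lambda>n. 432 * ((\<Sum>i\<in>{0<..n}. 1 / real i) / ln (real n)) + (2 + 2 * green 0) * (green_sum 0 n / ln (real n))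
      + (green 0)\<^sup>2 / ln (real n)) \<longlonglongrightarrow> 432 * 1 + (2 + 2 * green 0) * (4 / pi\<^sup>2) + 0"
    by (intro tendsto_intros tendsto_harm_over_ln tendsto_green_sum) real_asymp
  then show ?thesis by (simp add: moment_bound_def add_divide_distrib)
qed

lemma moment_bound_nonneg: "moment_bound n \<ge> 0"
  unfolding moment_bound_def by (intro add_nonneg_nonneg mult_nonneg_nonneg sum_nonneg) auto

context srw4
begin

text \<open>For a fixed displacement \<open>z\<close> across half the window, each side is a fresh
  Green sum started at \<open>z\<close>, whose defect is at most 1 by the choice of
  \<open>q\<close>. The mean of \<open>no_return\<close> survives as a factor; this is what makes
  the upper bound sharp, since the Chebyshev factor alone will be of order \<open>1 / ln n\<close>.
  The radius is even to match \<open>sum_green_tail_ge\<close>.\<close>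

lemma expectation_bad_weight_le:
  assumes q: "64 ^ k * (2 * real k) * green_tail q 0 \<le> 1" and c: "c < green_sum q r" and i: "2 * k + r \<le> i"
  shows "mean (bad_weight (2 * k) q r c i)
    \<le> 2 * (moment_bound r / (green_sum q r - c)\<^sup>2) * mean (no_return (2 * k) i)"
proof -
  let ?m = "2 * k" and ?t = "green_sum q r - c"
  let ?p = "moment_bound r / ?t\<^sup>2"
  have t: "?t > 0" using c by simp
  have defect: "green_sum q r \<le> (\<Sum>i\<in>{q<..r}. green_tail i z) + 1" if "heat_kernel ?m z \<noteq> 0" for z
    using sum_green_tail_ge[OF that, of q r] q by linarith
  have F: "walk_prob (\<lambda>s. forward_sum q r (i + ?m) z s < c) \<le> ?p" if "heat_kernel ?m z \<noteq> 0" for z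
  proof -
    have "walk_prob (\<lambda>s. forward_sum q r (i + ?m) z s < c)
        \<le> walk_prob (\<lambda>s. ?t \<le> \<bar>forward_sum q r (i + ?m) z s - green_sum q r\<bar>)"
      by (rule finite_measure_mono)
         (auto intro: events_incr_dep[OF _ incr_dep_compose[OF incr_dep_forward_sum, where h = "\<lambda>x. ?t \<le> \<bar>x - green_sum q r\<bar>"]])
    also have "\<dots> \<le> ?p" by (rule forward_chebyshev[OF defect[OF that] t])
    finally show ?thesis .
  qed
  have B: "walk_prob (\<lambda>s. backward_sum q r (i - ?m) z s < c) \<le> ?p" if "heat_kernel ?m z \<noteq> 0" for z
  proof -
    have "walk_prob (\<lambda>s. backward_sum q r (i - ?m) z s < c)
        \<le> walk_prob (\<lambda>s. ?t \<le> \<bar>backward_sum q r (i - ?m) z s - green_sum q r\<bar>)"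
      by (rule finite_measure_mono)
         (auto intro: events_incr_dep[OF _ incr_dep_compose[OF incr_dep_backward_sum, where h = "\<lambda>x. ?t \<le> \<bar>x - green_sum q r\<bar>"]])
    also have "\<dots> \<le> ?p" by (rule backward_chebyshev[OF defect[OF that] t]) (use i in simp)
    finally show ?thesis .
  qed
  let ?W = "{i - ?m..<i + ?m}"
  let ?f = "\<lambda>s. no_return ?m i s * of_bool (forward_sum q r (i + ?m) (s (i + ?m) - s i) s < c)"
  let ?b = "\<lambda>s. no_return ?m i s * of_bool (backward_sum q r (i - ?m) (s i - s (i - ?m)) s < c)"
  have f: "mean ?f \<le> ?p * mean (no_return ?m i)"
  proof (rule expectation_decouple[of ?W "no_return ?m i" i "i + ?m" "{i + ?m..<i + ?m + r}"
        "\<lambda>z s. forward_sum q r (i + ?m) z s < c"])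
    show "incr_dep {i + ?m..<i + ?m + r} (\<lambda>s. forward_sum q r (i + ?m) z s < c)" for z
      by (rule incr_dep_compose[OF incr_dep_forward_sum])
  qed (use F incr_dep_no_return in auto)
  have b: "mean ?b \<le> ?p * mean (no_return ?m i)"
  proof (rule expectation_decouple[of ?W "no_return ?m i" "i - ?m" i "{i - ?m - r..<i - ?m}"
        "\<lambda>z s. backward_sum q r (i - ?m) z s < c"])
    show "incr_dep {i - ?m - r..<i - ?m} (\<lambda>s. backward_sum q r (i - ?m) z s < c)" for z
      by (rule incr_dep_compose[OF incr_dep_backward_sum])
  qed (use B i incr_dep_no_return in auto)
  let ?I = "{i - ?m - r..<i + ?m + r}"
  have dn: "incr_dep ?I (no_return ?m i)"
    by (rule incr_dep_mono[OF incr_dep_no_return]) auto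
  have df: "incr_dep ?I ?f"
    by (rule incr_dep_compose2[OF dn incr_dep_bad_forward]) (simp add: ivl_subset)
  have db: "incr_dep ?I ?b"
    by (rule incr_dep_compose2[OF dn incr_dep_bad_backward]) (simp add: ivl_subset)
  have "mean (bad_weight ?m q r c i) = mean (\<lambda>s. ?f s + ?b s)"
    by (simp add: bad_weight_def distrib_left)
  also have "\<dots> = mean ?f + mean ?b"
    by (rule Bochner_Integration.integral_add) (rule integrable_incr_dep[OF _ df] integrable_incr_dep[OF _ db], simp)+
  finally show ?thesis using f b by simp
qed

lemma integrable_bad_weight: "integrable M (\<lambda>\<omega>. bad_weight m q r c i (walk \<omega>))"
  by (rule integrable_incr_dep[OF _ incr_dep_bad_weight[OF order_refl]]) simp

lemma integrable_no_return: "integrable M (\<lambda>\<omega>. no_return m i (walk \<omega>))"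
  by (rule integrable_incr_dep[OF _ incr_dep_no_return]) simp

lemma expectation_no_return_le_1: "mean (no_return m i) \<le> 1"
  by (intro integral_le_const AE_I2 no_return_le_1 integrable_no_return)

text \<open>Bootstrapping: the local weights of a block are bounded by its capacity, and
  \<open>capacity_range_le\<close> with window radius 0 already shows that the mean of this capacity
  is a small fraction of the block length. This replaces a direct analysis of the event that the
  walk and an independent one do not meet.\<close>

lemma sum_expectation_no_return_block:
  assumes "\<delta> > 0"
  shows "\<exists>m0. \<forall>m\<ge>m0. \<forall>a. (\<Sum>i\<in>{a..a + m}. mean (no_return m i)) \<le> \<delta> * (real m + 1)"
proof -
  let ?A = "green_sum 0" and ?B = moment_bound
  have ln: "filterlim (\<lambda>n. ln (real n)) at_top sequentially" by real_asymp
  have A_top: "filterlim ?A at_top sequentially"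
  proof -
    have "filterlim (\<lambda>n. ?A n / ln (real n) * ln (real n)) at_top sequentially"
      by (rule filterlim_tendsto_pos_mult_at_top[OF tendsto_green_sum _ ln]) simp
    moreover have "\<forall>\<^sub>F n in sequentially. ?A n / ln (real n) * ln (real n) = ?A n"
      using eventually_gt_at_top[of 1] by eventually_elim simp
    ultimately show ?thesis by (simp cong: filterlim_cong)
  qed
  have "(\<lambda>n. ?B n / ln (real n) / ((?A n / ln (real n))\<^sup>2) * (1 / ln (real n)))
      \<longlonglongrightarrow> (432 + (2 + 2 * green 0) * (4 / pi\<^sup>2)) / (4 / pi\<^sup>2)\<^sup>2 * 0"
    by (intro tendsto_intros tendsto_moment_bound tendsto_green_sum) (simp, real_asymp)
  moreover have "\<forall>\<^sub>F n in sequentially. ?B n / ln (real n) / ((?A n / ln (real n))\<^sup>2) * (1 / ln (real n)) = ?B n / (?A n)\<^sup>2"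
    using eventually_gt_at_top[of 1]
    by eventually_elim (simp add: power_divide power2_eq_square)
  ultimately have "(\<lambda>n. ?B n / (?A n)\<^sup>2) \<longlonglongrightarrow> (432 + (2 + 2 * green 0) * (4 / pi\<^sup>2)) / (4 / pi\<^sup>2)\<^sup>2 * 0"
    by (rule Lim_transform_eventually)
  then have BA: "(\<lambda>n. ?B n / (?A n)\<^sup>2) \<longlonglongrightarrow> 0" by simp
  have "\<forall>\<^sub>F n in sequentially. ?B n / (?A n)\<^sup>2 < \<delta> / 32"
    by (rule order_tendstoD(2)[OF BA]) (use assms in simp)
  moreover have "\<forall>\<^sub>F n in sequentially. ?A n \<ge> 4 / \<delta>"
    using A_top by (simp add: filterlim_at_top)
  ultimately have "\<forall>\<^sub>F n in sequentially. ?B n / (?A n)\<^sup>2 < \<delta> / 32 \<and> ?A n \<ge> 4 / \<delta>"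
    by (rule eventually_conj)
  \<comment> \<open>The budget per time: the main term \<open>1 / ?A r\<close> and the bad times
    take \<open>\<delta> / 4\<close> each, and the boundary term \<open>2 * r\<close> takes
    \<open>\<delta> / 2\<close> once \<open>m\<close> is at least
    \<open>4 * r / \<delta>\<close>.\<close>
  then obtain r where r: "?B r / (?A r)\<^sup>2 < \<delta> / 32" "?A r \<ge> 4 / \<delta>"
    by (auto simp: eventually_sequentially)
  have Apos: "?A r > 0" using r(2) assms by (smt (verit) divide_pos_pos)
  define c where "c = ?A r / 2"
  have c: "c > 0" "c < ?A r" using Apos by (auto simp: c_def)
  have bad: "mean (bad_weight 0 0 r c i) \<le> \<delta> / 4" if "r \<le> i" for i
  proof -
    \<comment> \<open>With \<open>k = 0\<close> the displacement is zero, and the condition on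
      \<open>q\<close> holds already for \<open>q = 0\<close>.\<close>
    have "mean (bad_weight (2 * 0) 0 r c i)
        \<le> 2 * (?B r / (?A r - c)\<^sup>2) * mean (no_return (2 * 0) i)"
      by (rule expectation_bad_weight_le) (use c that in auto)
    also have "\<dots> \<le> 2 * (?B r / (?A r - c)\<^sup>2) * 1"
      by (intro mult_left_mono expectation_no_return_le_1)
        (auto intro!: divide_nonneg_nonneg mult_nonneg_nonneg moment_bound_nonneg)
    also have "\<dots> = 8 * (?B r / (?A r)\<^sup>2)"
      by (simp add: c_def power_divide)
    also have "\<dots> \<le> \<delta> / 4" using r(1) by linarith
    finally show ?thesis by simp
  qed
  show ?thesis
  proof (intro exI allI impI)
    fix m a :: nat
    assume m: "m \<ge> nat \<lceil>4 * real r / \<delta>\<rceil>"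
    then have m': "4 * real r / \<delta> \<le> real m" by linarith
    let ?J = "{a + (0 + r)..a + m - (0 + r)}"
    have pt: "2 * c * (\<Sum>i\<in>{a..a + m}. no_return m i s) \<le> real (m + 1) + 2 * c * (2 * real (0 + r) + (\<Sum>i\<in>?J. bad_weight 0 0 r c i s))"
      for s :: "nat \<Rightarrow> int ^ 4"
    proof -
      have "2 * c * (\<Sum>i\<in>{a..a + m}. no_return m i s) \<le> 2 * c * capacity (s ` {a..a + m})"
        using c by (intro mult_left_mono sum_no_return_le_capacity) auto
      also have "\<dots> \<le> real (m + 1) + 2 * c * (2 * real (0 + r) + (\<Sum>i\<in>?J. bad_weight 0 0 r c i s))"
        by (rule capacity_range_le[OF c(1)])
      finally show ?thesis .
    qed
    have "mean (\<lambda>s. 2 * c * (\<Sum>i\<in>{a..a + m}. no_return m i s))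
        \<le> mean (\<lambda>s. real (m + 1) + 2 * c * (2 * real (0 + r) + (\<Sum>i\<in>?J. bad_weight 0 0 r c i s)))"
      by (intro integral_mono pt Bochner_Integration.integrable_add integrable_mult_right Bochner_Integration.integrable_sum
          integrable_no_return integrable_bad_weight) auto
    also have "\<dots> = real (m + 1) + 2 * c * (2 * real r + (\<Sum>i\<in>?J. mean (bad_weight 0 0 r c i)))"
      using integrable_bad_weight by (simp add: prob_space)
    also have "\<dots> \<le> real (m + 1) + 2 * c * (2 * real r + (real m + 1) * (\<delta> / 4))"
    proof (intro add_left_mono mult_left_mono)
      have "(\<Sum>i\<in>?J. mean (bad_weight 0 0 r c i)) \<le> (\<Sum>i\<in>?J. \<delta> / 4)"
        by (intro sum_mono bad) auto
      also have "\<dots> = real (card ?J) * (\<delta> / 4)" by simp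
      also have "\<dots> \<le> (real m + 1) * (\<delta> / 4)"
        using assms by (intro mult_right_mono) auto
      finally show "(\<Sum>i\<in>?J. mean (bad_weight 0 0 r c i)) \<le> (real m + 1) * (\<delta> / 4)" .
    qed (use c in auto)
    finally have "2 * c * (\<Sum>i\<in>{a..a + m}. mean (no_return m i))
        \<le> real (m + 1) + 2 * c * (2 * real r + (real m + 1) * (\<delta> / 4))"
      using integrable_no_return by simp
    also have "real (m + 1) \<le> 2 * c * ((real m + 1) * (\<delta> / 4))"
    proof -
      have "1 \<le> ?A r * (\<delta> / 4)" using r(2) assms by (simp add: field_simps)
      then have "(real m + 1) * 1 \<le> (real m + 1) * (?A r * (\<delta> / 4))" by (intro mult_left_mono) auto
      then show ?thesis by (simp add: c_def mult_ac)
    qed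
    finally have "2 * c * (\<Sum>i\<in>{a..a + m}. mean (no_return m i))
        \<le> 2 * c * ((real m + 1) * (\<delta> / 4)) + 2 * c * (2 * real r + (real m + 1) * (\<delta> / 4))"
      by simp
    also have "\<dots> = 2 * c * (2 * real r + (real m + 1) * (\<delta> / 2))"
      by (simp add: field_simps)
    finally have "2 * c * (\<Sum>i\<in>{a..a + m}. mean (no_return m i))
        \<le> 2 * c * (2 * real r + (real m + 1) * (\<delta> / 2))" .
    then have "(\<Sum>i\<in>{a..a + m}. mean (no_return m i)) \<le> 2 * real r + (real m + 1) * (\<delta> / 2)"
      using c by (subst (asm) mult_le_cancel_left_pos) auto
    also have "2 * real r \<le> (real m + 1) * (\<delta> / 2)"
      using m' assms by (simp add: field_simps)
    finally show "(\<Sum>i\<in>{a..a + m}. mean (no_return m i)) \<le> \<delta> * (real m + 1)"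
      by (simp add: algebra_simps)
  qed
qed

lemma sum_expectation_no_return:
  assumes block: "\<And>a. (\<Sum>i\<in>{a..a + m}. mean (no_return m i)) \<le> \<delta> * (real m + 1)"
    and \<delta>: "\<delta> > 0" and J: "J \<subseteq> {..n}"
  shows "(\<Sum>i\<in>J. mean (no_return m i)) \<le> \<delta> * (real n + real m + 1)"
proof -
  let ?e = "\<lambda>i. mean (no_return m i)"
  let ?K = "n div Suc m + 1"
  have n: "n < ?K * Suc m"
  proof -
    have "?K * Suc m = n div Suc m * Suc m + Suc m" by simp
    moreover have "n mod Suc m < Suc m" by simp
    ultimately show ?thesis using div_mult_mod_eq[of n "Suc m"] by linarith
  qed
  have e0: "?e i \<ge> 0" for i by (intro integral_nonneg_AE) auto
  have "(\<Sum>i\<in>J. ?e i) \<le> (\<Sum>i<?K * Suc m. ?e i)"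
    by (rule sum_mono2) (use J n e0 in auto)
  also have "\<dots> = (\<Sum>b<?K. sum ?e {b * Suc m..<b * Suc m + Suc m})"
    by (rule sum.nat_group[symmetric])
  also have "\<dots> \<le> (\<Sum>b<?K. \<delta> * (real m + 1))"
  proof (rule sum_mono)
    fix b
    have "{b * Suc m..<b * Suc m + Suc m} = {b * Suc m..b * Suc m + m}" by auto
    then show "sum ?e {b * Suc m..<b * Suc m + Suc m} \<le> \<delta> * (real m + 1)"
      using block[of "b * Suc m"] by simp
  qed
  also have "\<dots> = \<delta> * real (?K * Suc m)"
    by (simp add: algebra_simps)
  also have "\<dots> \<le> \<delta> * (real n + real m + 1)"
  proof (intro mult_left_mono)
    have "?K * Suc m \<le> n + m + 1"
      using div_times_less_eq_dividend[of n "Suc m"] by simp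
    then show "real (?K * Suc m) \<le> real n + real m + 1" by linarith
  qed (use \<delta> in simp)
  finally show ?thesis .
qed

end

section \<open>Bounds in probability\<close>

text \<open>The window is shorter than the walk by a power of the logarithm only: so short that windows at different
  places are nearly independent, yet with \<open>ln (window n)\<close> asymptotic to \<open>ln n\<close>.\<close>

definition window :: "nat \<Rightarrow> nat" where
  "window n = nat \<lfloor>real n / ln (real n) ^ 4\<rfloor>"

lemma window_at_top: "filterlim window at_top sequentially"
  unfolding window_def by real_asymp

lemma eventually_window_ge: "\<forall>\<^sub>F n in sequentially. k \<le> window n"
  using window_at_top unfolding filterlim_at_top by blast

lemma eventually_window_le: "\<forall>\<^sub>F n in sequentially. real (window n) \<le> real n"
  unfolding window_def by real_asymp

lemma tendsto_ln_window: "(\<lambda>n. ln (real (window n)) / ln (real n)) \<longlonglongrightarrow> 1"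
  unfolding window_def by real_asymp

lemma tendsto_over_ln_window:
  fixes f :: "nat \<Rightarrow> real"
  assumes "(\<lambda>n. f n / ln (real n)) \<longlonglongrightarrow> c"
  shows "(\<lambda>n. f (window n) / ln (real n)) \<longlonglongrightarrow> c"
proof -
  have "(\<lambda>n. f (window n) / ln (real (window n)) * (ln (real (window n)) / ln (real n))) \<longlonglongrightarrow> c * 1"
    by (intro tendsto_mult tendsto_ln_window filterlim_compose[OF assms window_at_top])
  moreover have "\<forall>\<^sub>F n in sequentially. f (window n) / ln (real (window n)) * (ln (real (window n)) / ln (real n)) = f (window n) / ln (real n)"
    using eventually_window_ge[of 2] by eventually_elim simp
  ultimately show ?thesis by (auto elim: Lim_transform_eventually)
qed

text \<open>\<open>D\<close> is quantified before \<open>q\<close>: in the upper bound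
  \<open>D\<close> determines the tolerance for the local weights, hence the window radius, and only
  the latter determines \<open>q\<close>. This is possible because the limit of
  \<open>green_sum q n / ln n\<close> is the same for every \<open>q\<close>.\<close>

lemma moment_bound_window_le:
  assumes "\<kappa> \<noteq> 4 / pi\<^sup>2"
  shows "\<exists>D>0. \<forall>q. \<forall>\<^sub>F n in sequentially.
    moment_bound (window n) / (green_sum q (window n) - \<kappa> * ln (real n))\<^sup>2 \<le> D / ln (real n)"
proof -
  let ?l = "432 + (2 + 2 * green 0) * (4 / pi\<^sup>2)" and ?d = "(4 / pi\<^sup>2 - \<kappa>)\<^sup>2"
  have d: "?d > 0" using assms by simp
  have l: "?l > 0" by (intro add_pos_nonneg) auto
  have "\<forall>\<^sub>F n in sequentially.
    moment_bound (window n) / (green_sum q (window n) - \<kappa> * ln (real n))\<^sup>2 \<le> (?l / ?d + 1) / ln (real n)" for q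
  proof -
    have "(\<lambda>n. (moment_bound (window n) / ln (real n)) / (green_sum q (window n) / ln (real n) - \<kappa>)\<^sup>2) \<longlonglongrightarrow> ?l / ?d"
      using d by (intro tendsto_intros tendsto_over_ln_window tendsto_moment_bound tendsto_green_sum) auto
    then have "\<forall>\<^sub>F n in sequentially. (moment_bound (window n) / ln (real n)) / (green_sum q (window n) / ln (real n) - \<kappa>)\<^sup>2 < ?l / ?d + 1"
      by (rule order_tendstoD) simp
    then show ?thesis
      using eventually_gt_at_top[of 1]
    proof eventually_elim
      case (elim n)
      let ?L = "ln (real n)"
      have L: "?L > 0" using elim by simp
      have "green_sum q (window n) - \<kappa> * ?L = ?L * (green_sum q (window n) / ?L - \<kappa>)"
        using L by (simp add: field_simps)
      then have "moment_bound (window n) / (green_sum q (window n) - \<kappa> * ?L)\<^sup>2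
          = (moment_bound (window n) / ?L) / (green_sum q (window n) / ?L - \<kappa>)\<^sup>2 / ?L"
        using L by (simp add: power_mult_distrib power2_eq_square)
      also have "\<dots> \<le> (?l / ?d + 1) / ?L"
        using L elim by (intro divide_right_mono) auto
      finally show ?case .
    qed
  qed
  moreover have "?l / ?d + 1 > 0" using l d by (simp add: add_pos_pos)
  ultimately show ?thesis by blast
qed

section \<open>The upper bound\<close>

context srw4
begin

lemma capacity_upper:
  assumes \<epsilon>: "\<epsilon> > 0"
  shows "\<exists>E C. (\<forall>n. E n \<in> events) \<and> (\<forall>\<^sub>F n in sequentially. prob (E n) \<le> C / (ln (real n))\<^sup>2) \<and>
    (\<forall>\<^sub>F n in sequentially. \<forall>\<omega>\<in>space M - E n. ln (real n) / real n * capacity (walk \<omega> ` {0..n}) \<le> pi\<^sup>2 / 8 + \<epsilon>)"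
proof -
  \<comment> \<open>Slightly below 4 / pi^2, so that a one-sided sum below
    \<open>\<kappa> * ln n\<close> is atypical; the leading term \<open>1 / (2 * \<kappa>)\<close>
    of the bound equals pi^2 / 8 + \<open>\<epsilon> / 4\<close>.\<close>
  define \<kappa> where "\<kappa> = 1 / (2 * (pi\<^sup>2 / 8 + \<epsilon> / 4))"
  have pe: "pi\<^sup>2 / 8 + \<epsilon> / 4 > 0" using \<epsilon> by (simp add: add_pos_pos)
  have \<kappa>0: "\<kappa> > 0" using pe by (simp add: \<kappa>_def)
  have \<kappa>1: "\<kappa> < 4 / pi\<^sup>2"
  proof -
    have "1 / (2 * (pi\<^sup>2 / 8 + \<epsilon> / 4)) < 1 / (2 * (pi\<^sup>2 / 8))"
      using \<epsilon> pe by (intro divide_strict_left_mono mult_pos_pos) auto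
    then show ?thesis by (simp add: \<kappa>_def)
  qed
  obtain D where D: "D > 0" "\<And>q. \<forall>\<^sub>F n in sequentially.
      moment_bound (window n) / (green_sum q (window n) - \<kappa> * ln (real n))\<^sup>2 \<le> D / ln (real n)"
    using moment_bound_window_le[of \<kappa>] \<kappa>1 by auto
  \<comment> \<open>The mean total weight of the bad times will be at most about
    \<open>2 * D * \<delta> * n / ln n\<close>; after normalisation this is
    \<open>\<epsilon> / 16\<close>.\<close>
  define \<delta> where "\<delta> = \<epsilon> / (32 * D)"
  have \<delta>: "\<delta> > 0" using \<epsilon> D(1) by (simp add: \<delta>_def)
  obtain k where k: "\<forall>m\<ge>k. \<forall>a. (\<Sum>i\<in>{a..a + m}. mean (no_return m i)) \<le> \<delta> * (real m + 1)"
    using sum_expectation_no_return_block[OF \<delta>] by blast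
  \<comment> \<open>Even, as \<open>expectation_bad_weight_le\<close> requires, and still at least
    \<open>k\<close>.\<close>
  define m where "m = 2 * k"
  have block: "(\<Sum>i\<in>{a..a + m}. mean (no_return m i)) \<le> \<delta> * (real m + 1)" for a
    unfolding m_def using k[rule_format, of "2 * k" a] by simp
  have "(\<lambda>q. 64 ^ k * (2 * real k) * (6 / (real q + 1))) \<longlonglongrightarrow> 0" by real_asymp
  then have "\<forall>\<^sub>F q in sequentially. 64 ^ k * (2 * real k) * (6 / (real q + 1)) < 1"
    by (rule order_tendstoD) simp
  then obtain q where "64 ^ k * (2 * real k) * (6 / (real q + 1)) < 1"
    by (auto simp: eventually_sequentially)
  moreover have "64 ^ k * (2 * real k) * green_tail q 0 \<le> 64 ^ k * (2 * real k) * (6 / (real q + 1))"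
    by (intro mult_left_mono green_tail_le) auto
  ultimately have q: "64 ^ k * (2 * real k) * green_tail q 0 \<le> 1" by linarith
  define c where "c n = \<kappa> * ln (real n)" for n :: nat
  define J where "J n = {0 + (m + window n)..0 + n - (m + window n)}" for n
  define Y where "Y n i = bad_weight m q (window n) (c n) i" for n i
  define t where "t n = \<epsilon> / 8 * (real n / ln (real n))" for n :: nat
  define E where "E n = {\<omega>\<in>space M. (\<Sum>i\<in>J n. mean (Y n i)) + t n \<le> (\<Sum>i\<in>J n. Y n i (walk \<omega>))}" for n
  have ev: "E n \<in> events" for n
  proof -
    have "incr_dep {0..<2 * n} (\<lambda>s. (\<Sum>i\<in>J n. mean (Y n i)) + t n \<le> (\<Sum>i\<in>J n. Y n i s))"
    proof (rule incr_dep_compose[OF incr_dep_sum])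
      fix i assume "i \<in> J n"
      then show "incr_dep {0..<2 * n} (Y n i)"
        unfolding Y_def by (intro incr_dep_mono[OF incr_dep_bad_weight[OF order_refl]]) (auto simp: J_def)
    qed
    from events_incr_dep[OF _ this] show ?thesis by (simp add: E_def)
  qed
  have cardJ: "real (card (J n)) \<le> real n + 1" for n
    by (simp add: J_def)
  \<comment> \<open>About \<open>n\<close> summands with a range of dependence of order
    \<open>n / (ln n)^4\<close> stand against the square of \<open>t n\<close>, of order
    \<open>(n / ln n)^2\<close>. The fourth power in \<open>window\<close> is what leaves a bound of
    order \<open>1 / (ln n)^2\<close>.\<close>
  have lim: "(\<lambda>n. (real n + 1) * (4 * (real m + real (window n)) + 1) * ln (real n) ^ 4 / real n ^ 2) \<longlonglongrightarrow> 4"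
    unfolding window_def by real_asymp
  have prob_E: "\<forall>\<^sub>F n in sequentially. prob (E n) \<le> (5 * (4 * 64 / \<epsilon>\<^sup>2)) / (ln (real n))\<^sup>2"
  proof -
    have "\<forall>\<^sub>F n in sequentially. (real n + 1) * (4 * (real m + real (window n)) + 1) * ln (real n) ^ 4 / real n ^ 2 < 5"
      by (rule order_tendstoD(2)[OF lim]) simp
    then show ?thesis
      using eventually_gt_at_top[of 1]
    proof eventually_elim
      case (elim n)
      let ?L = "ln (real n)"
      have L: "?L > 0" "real n > 0" using elim by auto
      have tn: "t n > 0" using L \<epsilon> by (simp add: t_def)
      have "prob (E n) \<le> real (card (J n)) * (4 * real (m + window n) + 1) * 2\<^sup>2 / (t n)\<^sup>2"
        unfolding E_def
        by (rule range_dependent_chebyshev)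
           (auto simp: Y_def J_def tn bad_weight_le_2 intro!: incr_dep_bad_weight)
      also have "\<dots> \<le> (real n + 1) * (4 * real (m + window n) + 1) * 2\<^sup>2 / (t n)\<^sup>2"
        by (intro divide_right_mono mult_right_mono cardJ) auto
      also have "\<dots> = ((real n + 1) * (4 * (real m + real (window n)) + 1) * ?L ^ 4 / real n ^ 2) * (4 * 64 / \<epsilon>\<^sup>2) / ?L\<^sup>2"
        using L \<epsilon> by (simp add: t_def field_simps power2_eq_square power4_eq_xxxx)
      also have "\<dots> \<le> 5 * (4 * 64 / \<epsilon>\<^sup>2) / ?L\<^sup>2"
        using elim by (intro divide_right_mono mult_right_mono) auto
      finally show ?case .
    qed
  qed
  have "(\<lambda>n. (real n + 1) / (2 * \<kappa> * real n) + 2 * (real m + real (window n)) * ln (real n) / real n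
      + 2 * D * \<delta> * (real n + real m + 1) / real n + \<epsilon> / 8)
    \<longlonglongrightarrow> 1 / (2 * \<kappa>) + 0 + 2 * D * \<delta> + \<epsilon> / 8"
  proof (intro tendsto_add tendsto_const)
    show "(\<lambda>n. (real n + 1) / (2 * \<kappa> * real n)) \<longlonglongrightarrow> 1 / (2 * \<kappa>)"
    proof -
      have "(\<lambda>n. 1 / (2 * \<kappa>) * ((real n + 1) / real n)) \<longlonglongrightarrow> 1 / (2 * \<kappa>) * 1"
        by (intro tendsto_mult_left) real_asymp
      then show ?thesis by simp
    qed
    show "(\<lambda>n. 2 * (real m + real (window n)) * ln (real n) / real n) \<longlonglongrightarrow> 0"
      unfolding window_def by real_asymp
    show "(\<lambda>n. 2 * D * \<delta> * (real n + real m + 1) / real n) \<longlonglongrightarrow> 2 * D * \<delta>"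
      by real_asymp
  qed
  moreover have "1 / (2 * \<kappa>) + 0 + 2 * D * \<delta> + \<epsilon> / 8 < pi\<^sup>2 / 8 + \<epsilon>"
    using \<epsilon> D(1) by (simp add: \<kappa>_def \<delta>_def add_divide_distrib)
  ultimately have ev_lt: "\<forall>\<^sub>F n in sequentially. (real n + 1) / (2 * \<kappa> * real n)
      + 2 * (real m + real (window n)) * ln (real n) / real n
      + 2 * D * \<delta> * (real n + real m + 1) / real n + \<epsilon> / 8 < pi\<^sup>2 / 8 + \<epsilon>"
    by (rule order_tendstoD)
  have "\<forall>\<^sub>F n in sequentially. \<kappa> < green_sum q (window n) / ln (real n)"
    by (rule order_tendstoD(1)[OF tendsto_over_ln_window[OF tendsto_green_sum] \<kappa>1])
  then have "\<forall>\<^sub>F n in sequentially. \<forall>\<omega>\<in>space M - E n. ln (real n) / real n * capacity (walk \<omega> ` {0..n}) \<le> pi\<^sup>2 / 8 + \<epsilon>"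
    using ev_lt D(2)[of q] eventually_gt_at_top[of 1]
  proof eventually_elim
    case (elim n)
    let ?L = "ln (real n)" and ?r = "window n"
    have L: "?L > 0" "real n > 0" using elim by auto
    have cn: "c n > 0" "c n < green_sum q ?r"
      using L \<kappa>0 elim(1) by (auto simp: c_def field_simps)
    have EY: "mean (Y n i) \<le> 2 * (D / ?L) * mean (no_return m i)" if "i \<in> J n" for i
    proof -
      have "mean (Y n i)
          \<le> 2 * (moment_bound ?r / (green_sum q ?r - c n)\<^sup>2) * mean (no_return m i)"
        unfolding Y_def m_def
        by (rule expectation_bad_weight_le[OF q cn(2)]) (use that in \<open>simp add: J_def m_def\<close>)
      also have "\<dots> \<le> 2 * (D / ?L) * mean (no_return m i)"
        using elim(3) unfolding c_def by (intro mult_right_mono mult_left_mono integral_nonneg_AE) auto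
      finally show ?thesis .
    qed
    have sumEY: "(\<Sum>i\<in>J n. mean (Y n i)) \<le> 2 * (D / ?L) * (\<delta> * (real n + real m + 1))"
    proof -
      have "(\<Sum>i\<in>J n. mean (Y n i)) \<le> 2 * (D / ?L) * (\<Sum>i\<in>J n. mean (no_return m i))"
        unfolding sum_distrib_left by (intro sum_mono EY)
      also have "\<dots> \<le> 2 * (D / ?L) * (\<delta> * (real n + real m + 1))"
        using D(1) L by (intro mult_left_mono sum_expectation_no_return[OF block \<delta>]) (auto simp: J_def)
      finally show ?thesis .
    qed
    show ?case
    proof
      fix \<omega> assume \<omega>: "\<omega> \<in> space M - E n"
      have "(\<Sum>i\<in>J n. Y n i (walk \<omega>)) \<le> 2 * (D / ?L) * (\<delta> * (real n + real m + 1)) + t n"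
        using \<omega> sumEY by (auto simp: E_def)
      then have "2 * c n * capacity (walk \<omega> ` {0..0 + n}) \<le> real (n + 1)
          + 2 * c n * (2 * real (m + ?r) + (2 * (D / ?L) * (\<delta> * (real n + real m + 1)) + t n))"
        using capacity_range_le[OF cn(1), of "walk \<omega>" 0 n m ?r q] cn(1)
        unfolding J_def[symmetric] Y_def[symmetric]
        by (elim order_trans) (intro add_left_mono mult_left_mono, auto)
      then have "capacity (walk \<omega> ` {0..n}) \<le> real (n + 1) / (2 * c n)
          + (2 * real (m + ?r) + (2 * (D / ?L) * (\<delta> * (real n + real m + 1)) + t n))"
        using cn(1) by (simp add: field_simps)
      then have "?L / real n * capacity (walk \<omega> ` {0..n}) \<le> ?L / real n * (real (n + 1) / (2 * c n)
          + (2 * real (m + ?r) + (2 * (D / ?L) * (\<delta> * (real n + real m + 1)) + t n)))"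
        using L by (intro mult_left_mono) auto
      also have "\<dots> = (real n + 1) / (2 * \<kappa> * real n) + 2 * (real m + real ?r) * ?L / real n
          + 2 * D * \<delta> * (real n + real m + 1) / real n + \<epsilon> / 8"
        using L \<kappa>0 by (simp add: c_def t_def field_simps)
      finally show "?L / real n * capacity (walk \<omega> ` {0..n}) \<le> pi\<^sup>2 / 8 + \<epsilon>"
        using elim(2) by linarith
    qed
  qed
  with ev prob_E show ?thesis by blast
qed

section \<open>The lower bound\<close>

lemma sum_green_eq_forward_backward:
  assumes "i \<le> n"
  shows "(\<Sum>j\<in>{0..n}. green (s i - s j)) = green 0 + forward_sum 0 (n - i) i 0 s + backward_sum 0 i i 0 s"
proof -
  have "forward_sum 0 (n - i) i 0 s = (\<Sum>j\<in>{i<..n}. green (s i - s j))"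
    unfolding forward_sum_def
    by (rule sum.reindex_bij_witness[of _ "\<lambda>j. j - i" "\<lambda>k. i + k"]) (use assms in \<open>auto simp: green_minus_commute[of "s i"]\<close>)
  moreover have "backward_sum 0 i i 0 s = (\<Sum>j\<in>{0..<i}. green (s i - s j))"
    unfolding backward_sum_def
    by (rule sum.reindex_bij_witness[of _ "\<lambda>j. i - j" "\<lambda>k. i - k"]) auto
  moreover have "(\<Sum>j\<in>{0..n}. green (s i - s j)) = green 0 + ((\<Sum>j\<in>{i<..n}. green (s i - s j)) + (\<Sum>j\<in>{0..<i}. green (s i - s j)))"
  proof -
    have "{0..n} = insert i ({i<..n} \<union> {0..<i})" using assms by auto
    then have "(\<Sum>j\<in>{0..n}. green (s i - s j)) = green (s i - s i) + (\<Sum>j\<in>{i<..n} \<union> {0..<i}. green (s i - s j))"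
      by simp
    also have "(\<Sum>j\<in>{i<..n} \<union> {0..<i}. green (s i - s j)) = (\<Sum>j\<in>{i<..n}. green (s i - s j)) + (\<Sum>j\<in>{0..<i}. green (s i - s j))"
      by (rule sum.union_disjoint) auto
    finally show ?thesis by simp
  qed
  ultimately show ?thesis by simp
qed

lemma forward_sum_split: "r \<le> n \<Longrightarrow> forward_sum 0 n a z s = forward_sum 0 r a z s + forward_sum r n a z s"
  and backward_sum_split: "r \<le> n \<Longrightarrow> backward_sum 0 n a z s = backward_sum 0 r a z s + backward_sum r n a z s"
proof -
  assume "r \<le> n"
  then have *: "{0<..n} = {0<..r} \<union> {r<..n}" by auto
  show "forward_sum 0 n a z s = forward_sum 0 r a z s + forward_sum r n a z s"
    and "backward_sum 0 n a z s = backward_sum 0 r a z s + backward_sum r n a z s"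
    unfolding forward_sum_def backward_sum_def * by (rule sum.union_disjoint; auto)+
qed

text \<open>Second-moment bound for the contribution from time distances between
  \<open>window n\<close> and \<open>n\<close>. As \<open>window n\<close> is \<open>n\<close> over
  the fourth power of the logarithm, \<open>h\<close> is asymptotic to
  \<open>4 * ln (ln n)\<close>.\<close>

definition tail_estimate :: "nat \<Rightarrow> real" where
  "tail_estimate n = (let h = ln (real n) - ln (real (window n)) in (6 * h + green 0)\<^sup>2 + 432 * h)"

lemma tail_estimate_nonneg: "0 < window n \<Longrightarrow> window n \<le> n \<Longrightarrow> 0 \<le> tail_estimate n"
  by (simp add: tail_estimate_def Let_def)

lemma second_moment_le_tail_estimate:
  assumes "0 < window n" "window n \<le> n" "n' \<le> n"
  shows "(green_sum (window n) n' + green 0)\<^sup>2 + 432 * (\<Sum>i\<in>{window n<..n'}. 1 / real i) \<le> tail_estimate n"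
proof -
  let ?H = "\<Sum>i\<in>{window n<..n'}. 1 / real i" and ?h = "ln (real n) - ln (real (window n))"
  have "?H \<le> (\<Sum>i\<in>{window n<..n}. 1 / real i)"
    using assms by (intro sum_mono2) auto
  also have "\<dots> \<le> ?h" by (rule sum_inverse_le_ln) (use assms in auto)
  finally have H: "?H \<le> ?h" .
  have "green_sum (window n) n' \<le> (\<Sum>i\<in>{window n<..n'}. 6 * (1 / real i))"
    unfolding green_sum_def
  proof (rule sum_mono)
    fix i assume "i \<in> {window n<..n'}"
    then have "6 / (real i + 1) \<le> 6 / real i" by (intro divide_left_mono) auto
    then show "green_tail i 0 \<le> 6 * (1 / real i)" using green_tail_le[of i 0] by simp
  qed
  also have "\<dots> \<le> 6 * ?h" unfolding sum_distrib_left[symmetric] by (intro mult_left_mono H) auto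
  finally have "(green_sum (window n) n' + green 0)\<^sup>2 \<le> (6 * ?h + green 0)\<^sup>2"
    by (intro power_mono) auto
  then show ?thesis using H by (simp add: tail_estimate_def Let_def)
qed

text \<open>Within the window Chebyshev's inequality with a short range of dependence applies
  (\<open>Y\<close>, \<open>E\<close>). The contributions from beyond it reach over the whole path,
  but their second moment is only of order \<open>(ln (ln n))^2\<close>; the mean number of times at
  which they exceed \<open>\<tau> * ln n\<close> is then so small that Markov's inequality suffices
  (\<open>X\<close>, \<open>F\<close>).\<close>

lemma capacity_lower:
  assumes \<epsilon>: "\<epsilon> > 0"
  shows "\<exists>E C. (\<forall>n. E n \<in> events) \<and> (\<forall>\<^sub>F n in sequentially. prob (E n) \<le> C * (ln (ln (real n)))\<^sup>2 / (ln (real n))\<^sup>2) \<and>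
    (\<forall>\<^sub>F n in sequentially. \<forall>\<omega>\<in>space M - E n. pi\<^sup>2 / 8 - \<epsilon> \<le> ln (real n) / real n * capacity (walk \<omega> ` {0..n}))"
proof -
  have "((\<lambda>\<tau>. (1 - \<tau>) / (8 / pi\<^sup>2 + 5 * \<tau>)) \<longlongrightarrow> (1 - 0) / (8 / pi\<^sup>2 + 5 * 0)) (at_right 0)"
    by (intro tendsto_intros) auto
  moreover have "pi\<^sup>2 / 8 - \<epsilon> < (1 - 0) / (8 / pi\<^sup>2 + 5 * 0)" using \<epsilon> by simp
  ultimately have "\<forall>\<^sub>F \<tau> in at_right 0. pi\<^sup>2 / 8 - \<epsilon> < (1 - \<tau>) / (8 / pi\<^sup>2 + 5 * \<tau>)"
    by (rule order_tendstoD)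
  then obtain b where b: "b > 0" "\<And>\<tau>. 0 < \<tau> \<Longrightarrow> \<tau> < b \<Longrightarrow> pi\<^sup>2 / 8 - \<epsilon> < (1 - \<tau>) / (8 / pi\<^sup>2 + 5 * \<tau>)"
    by (auto simp: eventually_at_right_field)
  define \<tau> where "\<tau> = b / 2"
  have \<tau>: "\<tau> > 0" using b(1) by (simp add: \<tau>_def)
  have \<tau>\<epsilon>: "pi\<^sup>2 / 8 - \<epsilon> < (1 - \<tau>) / (8 / pi\<^sup>2 + 5 * \<tau>)"
    unfolding \<tau>_def by (rule b(2)) (use b(1) in auto)
  \<comment> \<open>\<open>2 * \<kappa>\<close> for the two sides within the window, and
    \<open>\<tau>\<close> each for the two sides beyond it and for the term
    \<open>green 0\<close>.\<close>
  define K where "K = 8 / pi\<^sup>2 + 5 * \<tau>"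
  have K: "K > 0" using \<tau> by (simp add: K_def add_nonneg_pos)
  define \<kappa> where "\<kappa> = 4 / pi\<^sup>2 + \<tau>"
  have \<kappa>1: "4 / pi\<^sup>2 < \<kappa>" using \<tau> by (simp add: \<kappa>_def)
  obtain D where D: "D > 0" "\<And>q. \<forall>\<^sub>F n in sequentially.
      moment_bound (window n) / (green_sum q (window n) - \<kappa> * ln (real n))\<^sup>2 \<le> D / ln (real n)"
    using moment_bound_window_le[of \<kappa>] \<kappa>1 by auto
  define c where "c n = \<kappa> * ln (real n)" for n :: nat
  define J where "J n = {window n..n - window n}" for n
  define Y where "Y n i s = (of_bool (c n < forward_sum 0 (window n) i 0 s) + of_bool (c n < backward_sum 0 (window n) i 0 s) :: real)" for n i s
  define X where "X n i s = (of_bool (\<tau> * ln (real n) < forward_sum (window n) (n - i) i 0 s)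
      + of_bool (\<tau> * ln (real n) < backward_sum (window n) i i 0 s) :: real)" for n i s
  \<comment> \<open>Used once in \<open>E\<close> and once in \<open>F\<close>, so that the two
    deviations together cost \<open>\<tau> / 2 * n\<close> times.\<close>
  define t where "t n = \<tau> / 4 * real n" for n :: nat
  define E where "E n = {\<omega>\<in>space M. (\<Sum>i\<in>J n. mean (Y n i)) + t n \<le> (\<Sum>i\<in>J n. Y n i (walk \<omega>))}" for n
  define F where "F n = {\<omega>\<in>space M. t n \<le> (\<Sum>i\<in>J n. X n i (walk \<omega>))}" for n
  have depf: "incr_dep I (\<lambda>s. of_bool (x < forward_sum q r a z s) :: real)" if "{a..<a + r} \<subseteq> I" for I x q r a z
    by (rule incr_dep_compose[OF incr_dep_mono[OF incr_dep_forward_sum that]])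
  have depb: "incr_dep I (\<lambda>s. of_bool (x < backward_sum q r a z s) :: real)" if "{a - r..<a} \<subseteq> I" for I x q r a z
    by (rule incr_dep_compose[OF incr_dep_mono[OF incr_dep_backward_sum that]])
  have depY: "incr_dep {i - window n..<i + window n} (Y n i)" for n i
    unfolding Y_def by (rule incr_dep_compose2[OF depf depb]) auto
  have depX: "incr_dep {0..<n + i} (X n i)" for n i
    unfolding X_def by (rule incr_dep_compose2[OF depf depb]) auto
  have evE: "E n \<in> events" for n
  proof -
    have "incr_dep {0..<2 * n} (\<lambda>s. (\<Sum>i\<in>J n. mean (Y n i)) + t n \<le> (\<Sum>i\<in>J n. Y n i s))"
    proof (rule incr_dep_compose[OF incr_dep_sum])
      fix i assume "i \<in> J n"
      then show "incr_dep {0..<2 * n} (Y n i)"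
        by (intro incr_dep_mono[OF depY]) (auto simp: J_def)
    qed
    from events_incr_dep[OF _ this] show ?thesis by (simp add: E_def)
  qed
  have intX: "integrable M (\<lambda>\<omega>. X n i (walk \<omega>))" for n i
    by (rule integrable_incr_dep[OF _ depX]) simp
  have int_sumX: "integrable M (\<lambda>\<omega>. \<Sum>i\<in>J n. X n i (walk \<omega>))" for n
    by (intro Bochner_Integration.integrable_sum intX)
  have evF: "F n \<in> events" for n
    unfolding F_def using borel_measurable_integrable[OF int_sumX[of n]] by measurable
  have cardJ: "real (card (J n)) \<le> real n + 1" for n
    by (simp add: J_def)
  have E2: "mean (\<lambda>s. of_bool (x < forward_sum q r a z s) + of_bool (y < backward_sum q' r' a' z' s))
      = walk_prob (\<lambda>s. x < forward_sum q r a z s) + walk_prob (\<lambda>s. y < backward_sum q' r' a' z' s)"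
    for x y q r a z q' r' a' z'
  proof -
    have 1: "incr_dep {a..<a + r} (\<lambda>s. x < forward_sum q r a z s)"
      by (rule incr_dep_compose[OF incr_dep_forward_sum])
    have 2: "incr_dep {a' - r'..<a'} (\<lambda>s. y < backward_sum q' r' a' z' s)"
      by (rule incr_dep_compose[OF incr_dep_backward_sum])
    have "integrable M (\<lambda>\<omega>. of_bool (x < forward_sum q r a z (walk \<omega>)) :: real)"
      by (rule integrable_incr_dep[OF _ depf[OF order_refl]]) simp
    moreover have "integrable M (\<lambda>\<omega>. of_bool (y < backward_sum q' r' a' z' (walk \<omega>)) :: real)"
      by (rule integrable_incr_dep[OF _ depb[OF order_refl]]) simp
    ultimately show ?thesis
      using prob_eq_expectation[OF _ 1] prob_eq_expectation[OF _ 2] by simp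
  qed
  have EX: "\<forall>\<^sub>F n in sequentially. \<forall>i\<in>J n. mean (X n i) \<le> 2 * tail_estimate n / (\<tau> * ln (real n))\<^sup>2"
  proof -
    show ?thesis
      using eventually_window_le eventually_window_ge[of 1] eventually_gt_at_top[of 1]
    proof eventually_elim
      case (elim n)
      have L: "\<tau> * ln (real n) > 0" using elim \<tau> by simp
      have w: "0 < window n" "window n \<le> n" using elim by auto
      show ?case
      proof
        fix i assume i: "i \<in> J n"
        then have "i \<le> n" by (auto simp: J_def)
        have "walk_prob (\<lambda>s. \<tau> * ln (real n) < forward_sum (window n) (n - i) i 0 s) \<le> tail_estimate n / (\<tau> * ln (real n))\<^sup>2"
          by (rule order_trans[OF forward_tail_bound[OF L] divide_right_mono[OF second_moment_le_tail_estimate[OF w]]]) auto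
        moreover have "walk_prob (\<lambda>s. \<tau> * ln (real n) < backward_sum (window n) i i 0 s) \<le> tail_estimate n / (\<tau> * ln (real n))\<^sup>2"
          by (rule order_trans[OF backward_tail_bound[OF L] divide_right_mono[OF second_moment_le_tail_estimate[OF w]]])
             (use \<open>i \<le> n\<close> in auto)
        ultimately show "mean (X n i) \<le> 2 * tail_estimate n / (\<tau> * ln (real n))\<^sup>2"
          unfolding X_def E2 by simp
      qed
    qed
  qed
  \<comment> \<open>\<open>576 = (6 * 4)\<^sup>2\<close>, from \<open>6 * h\<close> with
    \<open>h\<close> asymptotic to \<open>4 * ln (ln n)\<close>.\<close>
  have limF: "(\<lambda>n. (real n + 1) / real n * (tail_estimate n / (ln (ln (real n)))\<^sup>2)) \<longlonglongrightarrow> 576"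
    unfolding tail_estimate_def Let_def window_def by real_asymp
  have "\<forall>\<^sub>F n in sequentially. (real n + 1) / real n * (tail_estimate n / (ln (ln (real n)))\<^sup>2) < 577"
    by (rule order_tendstoD(2)[OF limF]) simp
  then have prob_F: "\<forall>\<^sub>F n in sequentially. prob (F n) \<le> 577 * (8 / \<tau> ^ 3) * (ln (ln (real n)))\<^sup>2 / (ln (real n))\<^sup>2"
    using EX eventually_gt_at_top[of 3] eventually_window_le eventually_window_ge[of 1]
  proof eventually_elim
    case (elim n)
    let ?L = "ln (real n)"
    have "exp 1 < real n" using e_less_272 elim(3) by linarith
    then have "ln (exp 1) < ?L" using elim(3) by (subst ln_less_cancel_iff) auto
    then have L1: "?L > 1" by simp
    then have LL: "ln ?L > 0" by simp
    have L: "?L > 0" "real n > 0" using elim L1 by auto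
    have tn: "t n > 0" using L \<tau> by (simp add: t_def)
    have "prob (F n) \<le> mean (\<lambda>s. \<Sum>i\<in>J n. X n i s) / t n"
      unfolding F_def
      by (rule integral_Markov_inequality_measure[OF int_sumX, of "{}"]) (use tn in \<open>auto simp: X_def intro!: sum_nonneg\<close>)
    also have "mean (\<lambda>s. \<Sum>i\<in>J n. X n i s) = (\<Sum>i\<in>J n. mean (X n i))"
      by (rule Bochner_Integration.integral_sum) (rule intX)
    also have "\<dots> / t n \<le> (\<Sum>i\<in>J n. 2 * tail_estimate n / (\<tau> * ?L)\<^sup>2) / t n"
      using elim tn by (intro divide_right_mono sum_mono) auto
    also have "\<dots> = real (card (J n)) * (2 * tail_estimate n / (\<tau> * ?L)\<^sup>2) / t n" by simp
    also have "\<dots> \<le> (real n + 1) * (2 * tail_estimate n / (\<tau> * ?L)\<^sup>2) / t n"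
    proof (intro divide_right_mono mult_right_mono cardJ)
      have "0 \<le> tail_estimate n"
        using elim by (intro tail_estimate_nonneg) auto
      then show "0 \<le> 2 * tail_estimate n / (\<tau> * ?L)\<^sup>2" by simp
    qed (use tn in auto)
    also have "\<dots> = ((real n + 1) / real n * (tail_estimate n / (ln ?L)\<^sup>2)) * (8 / \<tau> ^ 3) * (ln ?L)\<^sup>2 / ?L\<^sup>2"
      using L LL \<tau> by (simp add: t_def field_simps power2_eq_square power3_eq_cube)
    also have "\<dots> \<le> 577 * (8 / \<tau> ^ 3) * (ln ?L)\<^sup>2 / ?L\<^sup>2"
      using elim \<tau> by (intro divide_right_mono mult_right_mono) auto
    finally show ?case .
  qed
  have limE: "(\<lambda>n. (real n + 1) * (4 * real (window n) + 1) * ln (real n) ^ 4 / real n ^ 2) \<longlonglongrightarrow> 4"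
    unfolding window_def by real_asymp
  have "\<forall>\<^sub>F n in sequentially. (real n + 1) * (4 * real (window n) + 1) * ln (real n) ^ 4 / real n ^ 2 < 5"
    by (rule order_tendstoD(2)[OF limE]) simp
  moreover have "\<forall>\<^sub>F n in sequentially. 1 / ln (real n) ^ 4 \<le> (ln (ln (real n)))\<^sup>2 / (ln (real n))\<^sup>2"
    by real_asymp
  ultimately have prob_E: "\<forall>\<^sub>F n in sequentially. prob (E n) \<le> 5 * (64 / \<tau>\<^sup>2) * ((ln (ln (real n)))\<^sup>2 / (ln (real n))\<^sup>2)"
    using eventually_gt_at_top[of 1]
  proof eventually_elim
    case (elim n)
    let ?L = "ln (real n)"
    have L: "?L > 0" "real n > 0" using elim by auto
    have tn: "t n > 0" using L \<tau> by (simp add: t_def)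
    have "prob (E n) \<le> real (card (J n)) * (4 * real (window n) + 1) * 2\<^sup>2 / (t n)\<^sup>2"
      unfolding E_def
      by (rule range_dependent_chebyshev[OF _ depY]) (auto simp: J_def tn Y_def)
    also have "\<dots> \<le> (real n + 1) * (4 * real (window n) + 1) * 2\<^sup>2 / (t n)\<^sup>2"
      by (intro divide_right_mono mult_right_mono cardJ) auto
    also have "\<dots> = ((real n + 1) * (4 * real (window n) + 1) * ?L ^ 4 / real n ^ 2) * (64 / \<tau>\<^sup>2) * (1 / ?L ^ 4)"
      using L \<tau> by (simp add: t_def field_simps power2_eq_square)
    also have "\<dots> \<le> 5 * (64 / \<tau>\<^sup>2) * (1 / ?L ^ 4)"
      using elim L by (intro mult_right_mono) auto
    also have "\<dots> \<le> 5 * (64 / \<tau>\<^sup>2) * ((ln ?L)\<^sup>2 / ?L\<^sup>2)"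
      using elim by (intro mult_left_mono) auto
    finally show ?case .
  qed
  have prob_EF: "\<forall>\<^sub>F n in sequentially. prob (E n \<union> F n)
      \<le> (5 * (64 / \<tau>\<^sup>2) + 577 * (8 / \<tau> ^ 3)) * (ln (ln (real n)))\<^sup>2 / (ln (real n))\<^sup>2"
    using prob_E prob_F
  proof eventually_elim
    case (elim n)
    have "prob (E n \<union> F n) \<le> prob (E n) + prob (F n)"
      by (rule measure_Un_le[OF evE evF])
    with elim show ?case by (simp add: algebra_simps add_divide_distrib)
  qed
  have "(\<lambda>n. ((real n + 1 - 2 * real (window n)) / real n - 2 * D * (real n + 1) / (real n * ln (real n)) - \<tau> / 2) / K)
      \<longlonglongrightarrow> (1 - 0 - \<tau> / 2) / K"
  proof (intro tendsto_divide tendsto_diff tendsto_const)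
    show "(\<lambda>n. (real n + 1 - 2 * real (window n)) / real n) \<longlonglongrightarrow> 1"
      unfolding window_def by real_asymp
    show "(\<lambda>n. 2 * D * (real n + 1) / (real n * ln (real n))) \<longlonglongrightarrow> 0"
      by real_asymp
    show "K \<noteq> 0" using K by simp
  qed simp
  moreover have "pi\<^sup>2 / 8 - \<epsilon> < (1 - 0 - \<tau> / 2) / K"
    by (rule less_le_trans[OF \<tau>\<epsilon>]) (use K \<tau> in \<open>auto simp: K_def[symmetric] intro!: divide_right_mono\<close>)
  ultimately have ev_lt: "\<forall>\<^sub>F n in sequentially. pi\<^sup>2 / 8 - \<epsilon>
      < ((real n + 1 - 2 * real (window n)) / real n - 2 * D * (real n + 1) / (real n * ln (real n)) - \<tau> / 2) / K"
    by (rule order_tendstoD)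
  have ev1: "\<forall>\<^sub>F n in sequentially. green_sum 0 (window n) / ln (real n) < \<kappa>"
    by (rule order_tendstoD(2)[OF tendsto_over_ln_window[OF tendsto_green_sum] \<kappa>1])
  have ev2: "\<forall>\<^sub>F n in sequentially. real (2 * window n) \<le> real n"
    unfolding window_def by real_asymp
  have ev3: "\<forall>\<^sub>F n in sequentially. green 0 < \<tau> * ln (real n)"
    using \<tau> by real_asymp
  have "\<forall>\<^sub>F n in sequentially. \<forall>\<omega>\<in>space M - (E n \<union> F n). pi\<^sup>2 / 8 - \<epsilon> \<le> ln (real n) / real n * capacity (walk \<omega> ` {0..n})"
    using ev_lt ev1 ev2 ev3 D(2)[of 0] eventually_gt_at_top[of 1]
  proof eventually_elim
    case (elim n)
    let ?L = "ln (real n)" and ?r = "window n"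
    have L: "?L > 0" "real n > 0" using elim by auto
    have rn: "2 * ?r \<le> n" using elim(3) by linarith
    have cn: "green_sum 0 ?r < c n" using L elim(2) by (simp add: c_def field_simps)
    have EY: "mean (Y n i) \<le> 2 * (D / ?L)" if i: "i \<in> J n" for i
    proof -
      let ?p = "moment_bound ?r / (c n - green_sum 0 ?r)\<^sup>2"
      \<comment> \<open>From displacement zero there is no defect, so \<open>q = 0\<close> can be
        taken here.\<close>
      have z: "green_sum 0 ?r \<le> (\<Sum>i\<in>{0<..?r}. green_tail i 0) + 1" by (simp add: green_sum_def)
      have "walk_prob (\<lambda>s. c n < forward_sum 0 ?r i 0 s)
          \<le> walk_prob (\<lambda>s. c n - green_sum 0 ?r \<le> \<bar>forward_sum 0 ?r i 0 s - green_sum 0 ?r\<bar>)"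
        by (rule finite_measure_mono)
           (auto intro: events_incr_dep[OF _ incr_dep_compose[OF incr_dep_forward_sum, where h = "\<lambda>x. c n - green_sum 0 ?r \<le> \<bar>x - green_sum 0 ?r\<bar>"]])
      also have "\<dots> \<le> ?p" by (rule forward_chebyshev[OF z]) (use cn in simp)
      finally have 1: "walk_prob (\<lambda>s. c n < forward_sum 0 ?r i 0 s) \<le> ?p" .
      have "walk_prob (\<lambda>s. c n < backward_sum 0 ?r i 0 s)
          \<le> walk_prob (\<lambda>s. c n - green_sum 0 ?r \<le> \<bar>backward_sum 0 ?r i 0 s - green_sum 0 ?r\<bar>)"
        by (rule finite_measure_mono)
           (auto intro: events_incr_dep[OF _ incr_dep_compose[OF incr_dep_backward_sum, where h = "\<lambda>x. c n - green_sum 0 ?r \<le> \<bar>x - green_sum 0 ?r\<bar>"]])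
      also have "\<dots> \<le> ?p" by (rule backward_chebyshev[OF z]) (use cn i in \<open>auto simp: J_def\<close>)
      finally have 2: "walk_prob (\<lambda>s. c n < backward_sum 0 ?r i 0 s) \<le> ?p" .
      have "?p \<le> D / ?L" using elim(5) by (simp add: c_def power2_commute)
      then show ?thesis using 1 2 unfolding Y_def E2 by linarith
    qed
    have "(\<Sum>i\<in>J n. mean (Y n i)) \<le> real (card (J n)) * (2 * (D / ?L))"
      by (rule sum_bounded_above[OF EY])
    also have "\<dots> \<le> (real n + 1) * (2 * (D / ?L))"
      using D(1) L by (intro mult_right_mono cardJ) auto
    finally have sumEY: "(\<Sum>i\<in>J n. mean (Y n i)) \<le> (real n + 1) * (2 * (D / ?L))" .
    show ?case
    proof
      fix \<omega> assume \<omega>: "\<omega> \<in> space M - (E n \<union> F n)"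
      let ?s = "walk \<omega>"
      \<comment> \<open>The typical times. At every other time of \<open>J n\<close> the sum of
        \<open>Y\<close> and \<open>X\<close> is at least 1, so their totals bound the number of
        times lost.\<close>
      define G where "G = {i\<in>J n. Y n i ?s + X n i ?s = 0}"
      have YX: "Y n i ?s + X n i ?s \<ge> (if i \<in> G then 0 else 1)" if "i \<in> J n" for i
        using that by (auto simp: G_def Y_def X_def of_bool_def split: if_splits)
      have "real (card (J n - G)) = (\<Sum>i\<in>J n. if i \<in> G then 0 else 1)"
        by (simp add: sum.If_cases J_def Diff_eq)
      also have "\<dots> \<le> (\<Sum>i\<in>J n. Y n i ?s + X n i ?s)"
        by (intro sum_mono YX)
      also have "\<dots> \<le> (real n + 1) * (2 * (D / ?L)) + t n + t n"
        using \<omega> sumEY by (auto simp: E_def F_def sum.distrib)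
      finally have bad: "real (card (J n - G)) \<le> (real n + 1) * (2 * (D / ?L)) + t n + t n" .
      have GJ: "G \<subseteq> J n" "finite (J n)" by (auto simp: G_def J_def)
      have "card (J n) = n + 1 - 2 * ?r" using rn by (simp add: J_def)
      then have cardG: "real (card G) \<ge> real n + 1 - 2 * real ?r - ((real n + 1) * (2 * (D / ?L)) + t n + t n)"
        using bad card_Diff_subset[OF finite_subset[OF GJ] GJ(1)] card_mono[OF GJ(2,1)] rn by linarith
      have V: "(\<Sum>j\<in>G. green (?s i - ?s j)) \<le> K * ?L" if i: "i \<in> G" for i
      proof -
        have iJ: "?r \<le> i" "i + ?r \<le> n" using i rn by (auto simp: G_def J_def)
        have "Y n i ?s = 0" "X n i ?s = 0"
          using i by (auto simp: G_def Y_def X_def of_bool_def split: if_splits)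
        then have "forward_sum 0 ?r i 0 ?s \<le> c n" "backward_sum 0 ?r i 0 ?s \<le> c n"
          "forward_sum ?r (n - i) i 0 ?s \<le> \<tau> * ?L" "backward_sum ?r i i 0 ?s \<le> \<tau> * ?L"
          by (auto simp: Y_def X_def of_bool_def split: if_splits)
        moreover have "(\<Sum>j\<in>G. green (?s i - ?s j)) \<le> (\<Sum>j\<in>{0..n}. green (?s i - ?s j))"
          by (rule sum_mono2) (auto simp: G_def J_def)
        moreover have "(\<Sum>j\<in>{0..n}. green (?s i - ?s j)) = green 0 + forward_sum 0 (n - i) i 0 ?s + backward_sum 0 i i 0 ?s"
          by (rule sum_green_eq_forward_backward) (use iJ in simp)
        moreover have "forward_sum 0 (n - i) i 0 ?s = forward_sum 0 ?r i 0 ?s + forward_sum ?r (n - i) i 0 ?s"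
          by (rule forward_sum_split) (use iJ in simp)
        moreover have "backward_sum 0 i i 0 ?s = backward_sum 0 ?r i 0 ?s + backward_sum ?r i i 0 ?s"
          by (rule backward_sum_split) (use iJ in simp)
        moreover have "K * ?L = c n + c n + 3 * (\<tau> * ?L)"
          by (simp add: K_def c_def \<kappa>_def algebra_simps)
        ultimately show ?thesis using elim(4) by linarith
      qed
      have "real (card G) \<le> K * ?L * capacity (?s ` {0..n})"
        by (rule capacity_image_ge[OF _ _ V]) (use K L in \<open>auto simp: G_def J_def\<close>)
      with cardG have "real n + 1 - 2 * real ?r - ((real n + 1) * (2 * (D / ?L)) + t n + t n) \<le> K * ?L * capacity (?s ` {0..n})"
        by linarith
      then have "(real n + 1 - 2 * real ?r - ((real n + 1) * (2 * (D / ?L)) + t n + t n)) / (K * real n)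
          \<le> K * ?L * capacity (?s ` {0..n}) / (K * real n)"
        using K L by (intro divide_right_mono) auto
      also have "\<dots> = ?L / real n * capacity (?s ` {0..n})"
        using K by simp
      also have "(real n + 1 - 2 * real ?r - ((real n + 1) * (2 * (D / ?L)) + t n + t n)) / (K * real n)
          = ((real n + 1 - 2 * real ?r) / real n - 2 * D * (real n + 1) / (real n * ?L) - \<tau> / 2) / K"
        using K L by (simp add: t_def field_simps)
      finally show "pi\<^sup>2 / 8 - \<epsilon> \<le> ?L / real n * capacity (?s ` {0..n})"
        using elim(1) by linarith
    qed
  qed
  with evE evF prob_EF show ?thesis
    by (intro exI[of _ "\<lambda>n. E n \<union> F n"] exI conjI allI sets.Un) auto
qed

end

section \<open>Almost sure convergence\<close>

lemma (in prob_space) AE_eventually_not_in: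
  fixes f :: "nat \<Rightarrow> real" and \<nu> :: "nat \<Rightarrow> nat"
  assumes E: "\<And>n. E n \<in> events" and le: "\<forall>\<^sub>F n in sequentially. prob (E n) \<le> f n"
    and \<nu>: "filterlim \<nu> at_top sequentially" and f: "summable (\<lambda>k. f (\<nu> k))"
  shows "AE \<omega> in M. \<forall>\<^sub>F k in sequentially. \<omega> \<in> space M - E (\<nu> k)"
proof (rule borel_cantelli_AE1)
  have "\<forall>\<^sub>F k in sequentially. norm (prob (E (\<nu> k))) \<le> f (\<nu> k)"
    using \<nu>[unfolded filterlim_iff, rule_format, OF le] by simp
  then show "summable (\<lambda>k. prob (E (\<nu> k)))"
    by (rule summable_comparison_test_ev[OF _ f])
qed (use E in \<open>auto simp: emeasure_eq_measure\<close>)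

text \<open>Between two subsequence times \<open>ln\<close> and \<open>g\<close> increase while the
  reciprocal decreases, so the value at \<open>n\<close> is squeezed between the neighbouring values
  up to one factor of the ratio, which tends to 1.\<close>

lemma tendsto_from_subsequence:
  fixes g :: "nat \<Rightarrow> real" and \<nu> :: "nat \<Rightarrow> nat"
  assumes g: "mono g" "\<And>n. g n \<ge> 0"
    and \<nu>: "filterlim \<nu> at_top sequentially" and ratio: "(\<lambda>k. real (\<nu> (Suc k)) / real (\<nu> k)) \<longlonglongrightarrow> 1"
    and lim: "(\<lambda>k. ln (real (\<nu> k)) / real (\<nu> k) * g (\<nu> k)) \<longlonglongrightarrow> L"
  shows "(\<lambda>n. ln (real n) / real n * g n) \<longlonglongrightarrow> L"
proof -
  define x where "x k = ln (real (\<nu> k)) / real (\<nu> k) * g (\<nu> k)" for k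
  have x: "x \<longlonglongrightarrow> L" using lim unfolding x_def[abs_def] .
  \<comment> \<open>The last index whose time does not exceed \<open>n\<close>; the time at the next
    index then exceeds \<open>n\<close>, whether or not \<open>\<nu>\<close> is monotone.\<close>
  define K where "K n = Max {k. \<nu> k \<le> n}" for n
  have fin: "finite {k. \<nu> k \<le> n}" for n
  proof -
    obtain N where "\<And>k. k \<ge> N \<Longrightarrow> Suc n \<le> \<nu> k"
      using \<nu> unfolding filterlim_at_top eventually_sequentially by blast
    then have "{k. \<nu> k \<le> n} \<subseteq> {..<N}" by (force simp: not_le[symmetric])
    then show ?thesis by (rule finite_subset) simp
  qed
  have K_ge: "k \<le> K n" if "\<nu> k \<le> n" for k n
    unfolding K_def by (rule Max_ge[OF fin]) (use that in simp)
  have K_top: "filterlim K at_top sequentially"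
    unfolding filterlim_at_top eventually_sequentially using K_ge by blast
  have lower: "\<nu> (K n) \<le> n" if "\<nu> 0 \<le> n" for n
    using Max_in[OF fin, of n] that unfolding K_def by auto
  have upper: "n < \<nu> (Suc (K n))" for n
    using K_ge[of "Suc (K n)" n] by (cases "\<nu> (Suc (K n)) \<le> n") auto
  have 1: "\<forall>\<^sub>F n in sequentially. \<nu> (K n) \<ge> 1"
    using filterlim_compose[OF \<nu> K_top] unfolding filterlim_at_top by blast
  have "(\<lambda>k. x k * (1 / (real (\<nu> (Suc k)) / real (\<nu> k)))) \<longlonglongrightarrow> L * (1 / 1)"
    by (intro tendsto_intros x ratio) simp
  then have lo: "(\<lambda>n. x (K n) * (1 / (real (\<nu> (Suc (K n))) / real (\<nu> (K n))))) \<longlonglongrightarrow> L"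
    using filterlim_compose[OF _ K_top] by fastforce
  have "(\<lambda>k. x (Suc k) * (real (\<nu> (Suc k)) / real (\<nu> k))) \<longlonglongrightarrow> L * 1"
    by (intro tendsto_intros LIMSEQ_Suc[OF x] ratio)
  then have hi: "(\<lambda>n. x (Suc (K n)) * (real (\<nu> (Suc (K n))) / real (\<nu> (K n)))) \<longlonglongrightarrow> L"
    using filterlim_compose[OF _ K_top] by fastforce
  show ?thesis
  proof (rule tendsto_sandwich[OF _ _ lo hi])
    show "\<forall>\<^sub>F n in sequentially. x (K n) * (1 / (real (\<nu> (Suc (K n))) / real (\<nu> (K n)))) \<le> ln (real n) / real n * g n"
      using 1 eventually_ge_at_top[of "\<nu> 0"]
    proof eventually_elim
      case (elim n)
      let ?a = "\<nu> (K n)" and ?b = "\<nu> (Suc (K n))"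
      have an: "?a \<le> n" "1 \<le> ?a" "n < ?b" using lower elim upper by auto
      have "x (K n) * (1 / (real ?b / real ?a)) = ln (real ?a) / real ?b * g ?a"
        using an by (simp add: x_def)
      also have "\<dots> \<le> ln (real n) / real n * g n"
        using an g by (intro mult_mono frac_le) (auto simp: mono_def)
      finally show ?case .
    qed
    show "\<forall>\<^sub>F n in sequentially. ln (real n) / real n * g n \<le> x (Suc (K n)) * (real (\<nu> (Suc (K n))) / real (\<nu> (K n)))"
      using 1 eventually_ge_at_top[of "\<nu> 0"]
    proof eventually_elim
      case (elim n)
      let ?a = "\<nu> (K n)" and ?b = "\<nu> (Suc (K n))"
      have an: "?a \<le> n" "1 \<le> ?a" "n < ?b" using lower elim upper by auto
      have "ln (real n) / real n * g n \<le> ln (real ?b) / real ?a * g ?b"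
        using an g by (intro mult_mono frac_le) (auto simp: mono_def)
      also have "\<dots> = x (Suc (K n)) * (real ?b / real ?a)"
        using an by (simp add: x_def)
      finally show ?case .
    qed
  qed
qed

text \<open>The exponent is below 1, so that consecutive ratios tend to 1, and above 1/2, so that \<open>(ln n)\<^sup>-\<^sup>2\<close> is summable
  along the subsequence.\<close>

definition subseq_time :: "nat \<Rightarrow> nat" where
  "subseq_time k = nat \<lfloor>exp (real k powr (3 / 4))\<rfloor>"

lemma subseq_time_at_top: "filterlim subseq_time at_top sequentially"
  unfolding subseq_time_def by real_asymp

lemma subseq_time_ratio: "(\<lambda>k. real (subseq_time (Suc k)) / real (subseq_time k)) \<longlonglongrightarrow> 1"
  unfolding subseq_time_def by real_asymp

text \<open>\<open>ln (subseq_time k)\<close> grows like \<open>k powr (3 / 4)\<close>, so its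
  inverse square decays like \<open>k powr (- 3 / 2)\<close>; the comparison exponent
  \<open>- 5 / 4\<close> leaves room for the iterated logarithm.\<close>

lemma summable_subseq_time:
  "summable (\<lambda>k. C / (ln (real (subseq_time k)))\<^sup>2)"
  "summable (\<lambda>k. C * (ln (ln (real (subseq_time k))))\<^sup>2 / (ln (real (subseq_time k)))\<^sup>2)"
proof -
  have s: "summable (\<lambda>k. real k powr (- 5 / 4))"
    by (subst summable_real_powr_iff) simp
  have "(\<lambda>k. 1 / (ln (real (subseq_time k)))\<^sup>2) \<in> O(\<lambda>k. real k powr (- 5 / 4))"
    unfolding subseq_time_def by real_asymp
  from summable_mult[OF summable_comparison_test_bigo[OF _ this], of C]
  show "summable (\<lambda>k. C / (ln (real (subseq_time k)))\<^sup>2)" using s by simp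
  have "(\<lambda>k. (ln (ln (real (subseq_time k))))\<^sup>2 / (ln (real (subseq_time k)))\<^sup>2) \<in> O(\<lambda>k. real k powr (- 5 / 4))"
    unfolding subseq_time_def by real_asymp
  from summable_mult[OF summable_comparison_test_bigo[OF _ this], of C]
  show "summable (\<lambda>k. C * (ln (ln (real (subseq_time k))))\<^sup>2 / (ln (real (subseq_time k)))\<^sup>2)" using s by simp
qed

lemma (in srw4) capacity_law_of_large_numbers:
  "AE \<omega> in M. (\<lambda>n. ln (real n) / real n * capacity (walk \<omega> ` {0..n})) \<longlonglongrightarrow> pi\<^sup>2 / 8"
proof -
  let ?x = "\<lambda>\<omega> n. ln (real n) / real n * capacity (walk \<omega> ` {0..n})"
  have near: "AE \<omega> in M. \<forall>\<^sub>F k in sequentially. \<bar>?x \<omega> (subseq_time k) - pi\<^sup>2 / 8\<bar> \<le> \<epsilon>" if \<epsilon>: "\<epsilon> > 0" for \<epsilon>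
  proof -
    obtain E C where E: "\<And>n. E n \<in> events" "\<forall>\<^sub>F n in sequentially. prob (E n) \<le> C / (ln (real n))\<^sup>2"
      "\<forall>\<^sub>F n in sequentially. \<forall>\<omega>\<in>space M - E n. ?x \<omega> n \<le> pi\<^sup>2 / 8 + \<epsilon>"
      using capacity_upper[OF \<epsilon>] by blast
    obtain F C' where F: "\<And>n. F n \<in> events" "\<forall>\<^sub>F n in sequentially. prob (F n) \<le> C' * (ln (ln (real n)))\<^sup>2 / (ln (real n))\<^sup>2"
      "\<forall>\<^sub>F n in sequentially. \<forall>\<omega>\<in>space M - F n. pi\<^sup>2 / 8 - \<epsilon> \<le> ?x \<omega> n"
      using capacity_lower[OF \<epsilon>] by blast
    have sub: "\<forall>\<^sub>F k in sequentially. P (subseq_time k)" if "\<forall>\<^sub>F n in sequentially. P n" for P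
      using subseq_time_at_top that by (simp add: filterlim_iff)
    have "AE \<omega> in M. \<forall>\<^sub>F k in sequentially. \<omega> \<in> space M - E (subseq_time k)"
      by (rule AE_eventually_not_in[OF E(1,2) subseq_time_at_top summable_subseq_time(1)])
    moreover have "AE \<omega> in M. \<forall>\<^sub>F k in sequentially. \<omega> \<in> space M - F (subseq_time k)"
      by (rule AE_eventually_not_in[OF F(1,2) subseq_time_at_top summable_subseq_time(2)])
    ultimately show ?thesis
    proof eventually_elim
      case (elim \<omega>)
      from elim sub[OF E(3)] sub[OF F(3)] show ?case
      proof eventually_elim
        case (elim k)
        then have "?x \<omega> (subseq_time k) \<le> pi\<^sup>2 / 8 + \<epsilon>" "pi\<^sup>2 / 8 - \<epsilon> \<le> ?x \<omega> (subseq_time k)" by blast+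
        then show ?case unfolding abs_le_iff by linarith
      qed
    qed
  qed
  \<comment> \<open>Countably many tolerances, so that one null set serves for all of them.\<close>
  have "AE \<omega> in M. \<forall>j. \<forall>\<^sub>F k in sequentially. \<bar>?x \<omega> (subseq_time k) - pi\<^sup>2 / 8\<bar> \<le> 1 / real (Suc j)"
    unfolding AE_all_countable by (intro allI near) simp
  then show ?thesis
  proof eventually_elim
    case (elim \<omega>)
    have "(\<lambda>k. ?x \<omega> (subseq_time k)) \<longlonglongrightarrow> pi\<^sup>2 / 8"
    proof (rule tendstoI)
      fix e :: real assume "e > 0"
      then obtain j where "1 / real (Suc j) < e" by (rule nat_approx_posE)
      then show "\<forall>\<^sub>F k in sequentially. dist (?x \<omega> (subseq_time k)) (pi\<^sup>2 / 8) < e"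
        using elim[rule_format, of j] by (auto simp: dist_real_def elim: eventually_mono)
    qed
    moreover have "mono (\<lambda>n. capacity (walk \<omega> ` {0..n}))"
      by (auto simp: mono_def intro!: capacity_mono)
    ultimately show ?case
      using tendsto_from_subsequence[of "\<lambda>n. capacity (walk \<omega> ` {0..n})" subseq_time]
        capacity_nonneg subseq_time_at_top subseq_time_ratio by blast
  qed
qed

theorem theorem1p1:
  fixes M :: "'a measure" and S :: "nat \<Rightarrow> 'a \<Rightarrow> int ^ 4"
  assumes "simple_random_walk M 0 S"
  shows "AE \<omega> in M.
    (\<lambda>n. ln (real n) / real n * capacity (walk_range (\<lambda>k. S k \<omega>) n)) \<longlonglongrightarrow> pi\<^sup>2 / 8"
proof -
  interpret srw4 M 0 S
    using assms by (simp add: srw4_def srw_def)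
  have "walk \<omega> ` {0..n} = walk_range (\<lambda>k. S k \<omega>) n" for \<omega> n
    by (simp add: walk_range_def walk_def)
  then show ?thesis
    using capacity_law_of_large_numbers by simp
qed

end
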